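(* Let $N\ge 2$, let $\Omega\subset\mathbb{R}^N$ be a nonempty open bounded set, let $\lambda>0$, $p\in(N-1,+\infty)$, and let $f\in L^{q_0}(\Omega)$ with $f\neq 0$ (in $L^{q_0}(\Omega)$), where $q_0$ is as defined below. Then the functional \[ \mathcal{F}_{\lambda,f,\Omega}(\Sigma)=C_{f,\Omega}(\Sigma)+\lambda\,\mathcal{H}^1(\Sigma) \] admits no minimizer over the class of all closed proper subsets $\Sigma$ of $\overline{\Omega}$ (the empty set included; no connectedness assumption is imposed).
   Context: $\mathcal{H}^1$ denotes the one-dimensional Hausdorff measure. The exponent $q_0$ is defined by: $q_0=(p^* )'$ if $1<p<N$, where $p^*=Np/(N-p)$ and $1/p^*+1/(p^* )'=1$; $q_0>1$ (arbitrary) if $p=N$; $q_0=1$ if $p>N$. For $u\in W^{1,p}_0(\Omega)$ let $E_{f,\Omega}(u)=\frac1p\int_\Omega|\nabla u|^p\,dx-\int_\Omega fu\,dx$. For a closed proper subset $\Sigma$ of $\overline{\Omega}$, $u_{f,\Omega,\Sigma}$ denotes the unique minimizer of $E_{f,\Omega}$ over $W^{1,p}_0(\Omega\setminus\Sigma)$ (equivalently the unique weak solution of $-\Delta_p u=f$ in $\Omega\setminus\Sigma$, $u\in W^{1,p}_0(\Omega\setminus\Sigma)$), where $W^{1,p}_0(U)$ is the closure of $C_0^\infty(U)$ in $W^{1,p}(U)$. The $p$-compliance is $C_{f,\Omega}(\Sigma)=-E_{f,\Omega}(u_{f,\Omega,\Sigma})=\frac{1}{p'}\int_\Omega|\nabla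 u_{f,\Omega,\Sigma}|^p\,dx=\frac1{p'}\int_\Omega f u_{f,\Omega,\Sigma}\,dx$, with $1/p+1/p'=1$. *)

theory Defs
  imports "HOL-Analysis.Analysis"
begin

fun Ck :: "nat \<Rightarrow> ('a::euclidean_space \<Rightarrow> real) \<Rightarrow> bool" where
  "Ck 0 \<phi> = continuous_on UNIV \<phi>"
| "Ck (Suc k) \<phi> = (\<phi> differentiable_on UNIV \<and>
      (\<forall>b\<in>Basis. Ck k (\<lambda>x. frechet_derivative \<phi> (at x) b)))"

definition smooth_fun :: "('a::euclidean_space \<Rightarrow> real) \<Rightarrow> bool" where
  "smooth_fun \<phi> \<longleftrightarrow> (\<forall>k. Ck k \<phi>)"

definition grad :: "('a::euclidean_space \<Rightarrow> real) \<Rightarrow> 'a \<Rightarrow> 'a" where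
  "grad \<phi> x = (\<Sum>b\<in>Basis. frechet_derivative \<phi> (at x) b *\<^sub>R b)"

definition test_fun :: "'a::euclidean_space set \<Rightarrow> ('a \<Rightarrow> real) \<Rightarrow> bool" where
  "test_fun U \<phi> \<longleftrightarrow> smooth_fun \<phi> \<and> compact (closure {x. \<phi> x \<noteq> 0})
      \<and> closure {x. \<phi> x \<noteq> 0} \<subseteq> U"

text \<open>Closure of C_0^infinity(U) in W^{1,p}. Elements are pairs (u, g) of a function
  and its (weak) gradient, both extended by zero outside U (integrals over all of R^N).\<close>
definition W0 :: "real \<Rightarrow> 'a::euclidean_space set \<Rightarrow> (('a \<Rightarrow> real) \<times> ('a \<Rightarrow> 'a)) set" where
  "W0 p U = {(u, g). u \<in> borel_measurable lebesgue \<and> g \<in> borel_measurable lebesgue \<and>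
      (\<exists>\<phi> :: nat \<Rightarrow> 'a \<Rightarrow> real. (\<forall>k. test_fun U (\<phi> k)) \<and>
        (\<lambda>k. \<integral>\<^sup>+ x. ennreal (\<bar>\<phi> k x - u x\<bar> powr p) \<partial>lebesgue) \<longlonglongrightarrow> 0 \<and>
        (\<lambda>k. \<integral>\<^sup>+ x. ennreal (norm (grad (\<phi> k) x - g x) powr p) \<partial>lebesgue) \<longlonglongrightarrow> 0)}"

definition energy :: "real \<Rightarrow> ('a::euclidean_space \<Rightarrow> real) \<Rightarrow> 'a set
    \<Rightarrow> ('a \<Rightarrow> real) \<times> ('a \<Rightarrow> 'a) \<Rightarrow> real" where
  "energy p f \<Omega> w =
     (1 / p) * (\<integral>x. indicator \<Omega> x * norm (snd w x) powr p \<partial>lebesgue)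
     - (\<integral>x. indicator \<Omega> x * (f x * fst w x) \<partial>lebesgue)"

definition min_sol :: "real \<Rightarrow> ('a::euclidean_space \<Rightarrow> real) \<Rightarrow> 'a set \<Rightarrow> 'a set
    \<Rightarrow> ('a \<Rightarrow> real) \<times> ('a \<Rightarrow> 'a)" where
  "min_sol p f \<Omega> \<Sigma> = (SOME w. w \<in> W0 p (\<Omega> - \<Sigma>) \<and>
      (\<forall>v\<in>W0 p (\<Omega> - \<Sigma>). energy p f \<Omega> w \<le> energy p f \<Omega> v))"

definition compliance :: "real \<Rightarrow> ('a::euclidean_space \<Rightarrow> real) \<Rightarrow> 'a set \<Rightarrow> 'a set \<Rightarrow> real" where
  "compliance p f \<Omega> \<Sigma> = - energy p f \<Omega> (min_sol p f \<Omega> \<Sigma>)"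

definition hdiam :: "'a::metric_space set \<Rightarrow> ennreal" where
  "hdiam C = (if bounded C then ennreal (diameter C) else \<infinity>)"

definition H1_delta :: "real \<Rightarrow> 'a::metric_space set \<Rightarrow> ennreal" where
  "H1_delta \<delta> A = (INF C \<in> {C :: nat \<Rightarrow> 'a set. A \<subseteq> (\<Union>i. C i) \<and> (\<forall>i. hdiam (C i) \<le> ennreal \<delta>)}.
       \<Sum>i. hdiam (C i))"

definition H1 :: "'a::metric_space set \<Rightarrow> ennreal" where
  "H1 A = (SUP \<delta>\<in>{0<..}. H1_delta \<delta> A)"

definition Ffun :: "real \<Rightarrow> real \<Rightarrow> ('a::euclidean_space \<Rightarrow> real) \<Rightarrow> 'a set \<Rightarrow> 'a set \<Rightarrow> ereal" where
  "Ffun lam p f \<Omega> \<Sigma> = ereal (compliance p f \<Omega> \<Sigma>) + ereal lam * enn2ereal (H1 \<Sigma>)"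

definition q0_adm :: "nat \<Rightarrow> real \<Rightarrow> real \<Rightarrow> bool" where
  "q0_adm N p q \<longleftrightarrow>
     (1 < p \<and> p < real N \<and> (let ps = real N * p / (real N - p) in 1 / ps + 1 / q = 1))
   \<or> (p = real N \<and> q > 1)
   \<or> (p > real N \<and> q = 1)"

definition Lq_on :: "real \<Rightarrow> 'a::euclidean_space set \<Rightarrow> ('a \<Rightarrow> real) \<Rightarrow> bool" where
  "Lq_on q \<Omega> f \<longleftrightarrow> (\<lambda>x. indicator \<Omega> x * f x) \<in> borel_measurable lebesgue \<and>
     (\<integral>\<^sup>+ x. indicator \<Omega> x * ennreal (\<bar>f x\<bar> powr q) \<partial>lebesgue) < \<infinity>"

definition closed_proper_subset :: "'a::topological_space set \<Rightarrow> 'a set \<Rightarrow> bool" where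
  "closed_proper_subset \<Omega> \<Sigma> \<longleftrightarrow> closed \<Sigma> \<and> \<Sigma> \<subseteq> closure \<Omega> \<and> \<Sigma> \<noteq> closure \<Omega>"

end

theory Submission
  imports Defs "HOL-Computational_Algebra.Polynomial"
begin

text \<open>
The compliance of \<open>\<Sigma>\<close> is minus the infimum of the energy over test functions on \<open>\<Omega> - \<Sigma>\<close>. If \<open>\<Sigma>\<close>
were a minimizer, adding a segment of length \<open>r\<close> anywhere would raise this infimum by at most
\<open>lam * r\<close>, so for every segment there is a test function \<open>\<phi>\<close> vanishing on it whose energy is within
\<open>O(r)\<close> of the infimum. By strict convexity the gradients of \<open>\<phi>\<close> and of any other near-minimizer
\<open>\<psi>\<close> differ by at most a small multiple of \<open>|grad \<psi>|\<close> plus a term whose \<open>p\<close>-th power has integral \<open>O(r)\<close>. Since \<open>\<psi> = \<psi> - \<phi>\<close> on the segment, the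
Riesz potential estimate bounds the mean of \<open>|\<psi>|\<close> over the segment; the potential of a segment has
\<open>q\<close>-norm (\<open>q\<close> conjugate to \<open>p\<close>) of order \<open>r powr (1 / q + \<theta>)\<close> with \<open>\<theta> > 0\<close> exactly because
\<open>p > N - 1\<close>, so averaging over all positions of the segment shows that near-minimizers tend to \<open>0\<close> in
the mean. Hence the minimizer is \<open>0\<close>, the infimum is nonnegative, and \<open>f\<close> vanishes almost everywhere off
\<open>\<Sigma>\<close>. But \<open>\<Sigma>\<close> has finite length, hence is null, contradicting \<open>f \<noteq> 0\<close>.
\<close>

section \<open>Smooth functions and test functions\<close>

text \<open>Why short segments: for \<open>N - 1 < p < N\<close> the p-capacity of a segment of
  length \<open>r\<close> scales like \<open>r powr (N - p)\<close> and so dominates the cost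
  \<open>lam * r\<close> as \<open>r\<close> tends to 0. Wherever the state does not vanish, a short
  enough segment would pay off. The proof turns this round: minimality gives an upper bound on means
  over segments, and all estimates stay on smooth near-minimizers.

  The convexity estimate must serve \<open>p < 2\<close> and \<open>p \<ge> 2\<close> alike. Its
  relative error \<open>\<eta> * norm (grad \<psi>)\<close> does not shrink with \<open>r\<close>,
  so it is paired with the plain integral of the segment potential, of order \<open>r\<close>; only
  the energy excess is paired with the \<open>q\<close>-norm. After averaging and division by
  \<open>r\<close> the two contribute multiples of \<open>\<eta>\<close> and of
  \<open>r powr \<theta>\<close>.

  The function \<open>f\<close> enters through one inequality, which bounds the integral of
  \<open>\<bar>f x * \<phi> x\<bar>\<close> by the \<open>p\<close>-norm of the gradient. The
  exponent \<open>q0\<close> is dictated by it: by the Sobolev inequality for \<open>p < N\<close>,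
  by a bound on the supremum for \<open>p > N\<close>, while \<open>p = N\<close> is reduced to a
  smaller exponent.\<close>

lemma Ck_Suc_imp: "Ck (Suc k) u \<Longrightarrow> Ck k u"
proof (induction k arbitrary: u)
  case 0
  then show ?case
    by (auto intro: differentiable_imp_continuous_on)
next
  case (Suc k)
  then show ?case
    by (metis Ck.simps(2))
qed

lemma frechet_derivative_eqI:
  "(f has_derivative f') (at x) \<Longrightarrow> frechet_derivative f (at x) h = f' h"
  by (simp add: frechet_derivative_at[symmetric])

lemma differentiable_on_UNIV_D:
  "u differentiable_on UNIV \<Longrightarrow> (u has_derivative frechet_derivative u (at x)) (at x)"
  using frechet_derivative_works differentiable_on_eq_differentiable_at by blast

lemma Ck_const: "Ck k (\<lambda>x. c)"
proof (induction k arbitrary: c)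
  case (Suc k)
  have "frechet_derivative (\<lambda>x. c) (at x) b = (0::real)" for x b :: 'a
    by (rule frechet_derivative_eqI[where f'="\<lambda>_. 0", simplified]) auto
  then show ?case
    using Suc by simp
qed auto

lemma Ck_add: "Ck k u \<Longrightarrow> Ck k v \<Longrightarrow> Ck k (\<lambda>x. u x + v x)"
proof (induction k arbitrary: u v)
  case 0
  then show ?case
    by (auto intro: continuous_intros)
next
  case (Suc k)
  have "frechet_derivative (\<lambda>x. u x + v x) (at x) b
      = frechet_derivative u (at x) b + frechet_derivative v (at x) b" for x b
    using Suc.prems by (intro frechet_derivative_eqI has_derivative_add differentiable_on_UNIV_D) auto
  then show ?case
    using Suc by auto
qed

lemma Ck_mult: "Ck k u \<Longrightarrow> Ck k v \<Longrightarrow> Ck k (\<lambda>x. u x * v x)"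
proof (induction k arbitrary: u v)
  case 0
  then show ?case
    by (auto intro: continuous_intros)
next
  case (Suc k)
  have *: "frechet_derivative (\<lambda>x. u x * v x) (at x) b
      = u x * frechet_derivative v (at x) b + frechet_derivative u (at x) b * v x" for x b
    using Suc.prems by (intro frechet_derivative_eqI has_derivative_mult differentiable_on_UNIV_D) auto
  have "Ck k u" "Ck k v"
    using Suc.prems Ck_Suc_imp by auto
  then have "\<forall>b\<in>Basis. Ck k (\<lambda>x. frechet_derivative (\<lambda>x. u x * v x) (at x) b)"
    unfolding * using Suc by (auto intro!: Ck_add)
  moreover have "(\<lambda>x. u x * v x) differentiable_on UNIV"
    using Suc.prems by (auto intro!: differentiable_on_mult)
  ultimately show ?case
    by simp
qed

lemma smooth_fun_const: "smooth_fun (\<lambda>x. c)"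
  by (simp add: smooth_fun_def Ck_const)

lemma smooth_fun_add: "smooth_fun u \<Longrightarrow> smooth_fun v \<Longrightarrow> smooth_fun (\<lambda>x. u x + v x)"
  by (simp add: smooth_fun_def Ck_add)

lemma smooth_fun_mult: "smooth_fun u \<Longrightarrow> smooth_fun v \<Longrightarrow> smooth_fun (\<lambda>x. u x * v x)"
  by (simp add: smooth_fun_def Ck_mult)

lemma smooth_fun_diff: "smooth_fun u \<Longrightarrow> smooth_fun v \<Longrightarrow> smooth_fun (\<lambda>x. u x - v x)"
  using smooth_fun_add[OF _ smooth_fun_mult[OF smooth_fun_const[of "-1"]], of u v] by simp

lemma smooth_fun_power: "smooth_fun u \<Longrightarrow> smooth_fun (\<lambda>x. u x ^ n)"
  by (induction n) (auto intro: smooth_fun_const smooth_fun_mult)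

lemma smooth_fun_prod:
  "(\<And>i. i \<in> I \<Longrightarrow> smooth_fun (u i)) \<Longrightarrow> smooth_fun (\<lambda>x. \<Prod>i\<in>I. u i x)"
  by (induction I rule: infinite_finite_induct) (auto intro: smooth_fun_const smooth_fun_mult)

text \<open>All successive derivatives are supplied as one sequence \<open>g\<close>, so that the
  induction on the order can move from \<open>g n\<close> to \<open>g (Suc n)\<close>: a partial
  derivative only changes the index and adds the constant factor
  \<open>b \<bullet> e\<close>.\<close>

lemma smooth_fun_comp_affine:
  fixes g :: "nat \<Rightarrow> real \<Rightarrow> real" and e :: "'a::euclidean_space"
  assumes "\<And>n s. (g n has_field_derivative g (Suc n) s) (at s)"
  shows "smooth_fun (\<lambda>x. g n (x \<bullet> e + c))"
proof -
  have "Ck k (\<lambda>x. g n (x \<bullet> e + c))" for k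
  proof (induction k arbitrary: n)
    case 0
    have "continuous_on UNIV (g n)"
      using assms by (meson DERIV_continuous_on has_field_derivative_at_within)
    then show ?case
      by (auto intro!: continuous_intros continuous_on_compose2[of UNIV "g n"])
  next
    case (Suc k)
    have *: "((\<lambda>x. g n (x \<bullet> e + c)) has_derivative (\<lambda>h. g (Suc n) (x \<bullet> e + c) * (h \<bullet> e))) (at x)" for x
    proof -
      have "((\<lambda>x. x \<bullet> e + c) has_derivative (\<lambda>h. h \<bullet> e)) (at x)"
        by (auto intro!: derivative_eq_intros)
      from has_derivative_compose[OF this, of "g n"] assms[of n "x \<bullet> e + c"] show ?thesis
        by (simp add: has_field_derivative_def)
    qed
    have **: "frechet_derivative (\<lambda>x. g n (x \<bullet> e + c)) (at x) b = g (Suc n) (x \<bullet> e + c) * (b \<bullet> e)" for x b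
      by (rule frechet_derivative_eqI[OF *])
    show ?case
      using Suc * by (auto simp: ** differentiable_on_def differentiable_def intro!: Ck_mult Ck_const)
  qed
  then show ?thesis
    by (simp add: smooth_fun_def)
qed

lemma test_fun_add:
  assumes "test_fun U u" "test_fun U v"
  shows "test_fun U (\<lambda>x. u x + v x)"
proof -
  have "closure {x. u x + v x \<noteq> 0} \<subseteq> closure {x. u x \<noteq> 0} \<union> closure {x. v x \<noteq> 0}"
    unfolding closure_Un[symmetric] by (intro closure_mono) auto
  moreover have "compact (closure {x. u x \<noteq> 0} \<union> closure {x. v x \<noteq> 0})"
    "closure {x. u x \<noteq> 0} \<union> closure {x. v x \<noteq> 0} \<subseteq> U"
    using assms unfolding test_fun_def by auto
  ultimately show ?thesis
    using assms smooth_fun_add[of u v] unfolding test_fun_def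
    by (meson bounded_subset closed_closure compact_eq_bounded_closed order_trans)
qed

lemma test_fun_smult:
  assumes "test_fun U v" "smooth_fun u"
  shows "test_fun U (\<lambda>x. u x * v x)"
proof -
  have "closure {x. u x * v x \<noteq> 0} \<subseteq> closure {x. v x \<noteq> 0}"
    by (intro closure_mono) auto
  then show ?thesis
    using assms unfolding test_fun_def
    using smooth_fun_mult[of u v]
    by (meson bounded_subset closed_closure compact_eq_bounded_closed order_trans)
qed

lemma test_fun_cmult: "test_fun U v \<Longrightarrow> test_fun U (\<lambda>x. c * v x)"
  by (rule test_fun_smult) (auto intro: smooth_fun_const)

lemma test_fun_diff: "test_fun U u \<Longrightarrow> test_fun U v \<Longrightarrow> test_fun U (\<lambda>x. u x - v x)"
  using test_fun_add[OF _ test_fun_cmult[of U v "-1"]] by simp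

lemma test_fun_0: "test_fun U (\<lambda>x. 0)"
  by (simp add: test_fun_def smooth_fun_const)

lemma test_fun_mono: "test_fun U u \<Longrightarrow> U \<subseteq> V \<Longrightarrow> test_fun V u"
  by (auto simp: test_fun_def)

lemma test_fun_eq_0: "test_fun U u \<Longrightarrow> x \<notin> U \<Longrightarrow> u x = 0"
  using closure_subset[of "{x. u x \<noteq> 0}"] by (auto simp: test_fun_def)

lemma test_fun_differentiable: "test_fun U u \<Longrightarrow> u differentiable_on UNIV"
  unfolding test_fun_def smooth_fun_def by (metis Ck.simps(2))

lemma test_fun_continuous: "test_fun U u \<Longrightarrow> continuous_on S u"
  by (meson test_fun_differentiable differentiable_imp_continuous_on continuous_on_subset subset_UNIV)

lemma grad_inner_Basis: "b \<in> Basis \<Longrightarrow> grad u x \<bullet> b = frechet_derivative u (at x) b"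
  unfolding grad_def by (simp add: inner_sum_left inner_Basis if_distrib cong: if_cong)

text \<open>Linearity of the derivative: \<open>grad\<close>, built from the basis directions only,
  represents it in every direction.\<close>

lemma test_fun_has_derivative:
  assumes "test_fun U u"
  shows "(u has_derivative (\<lambda>h. grad u x \<bullet> h)) (at x)"
proof -
  have 1: "(u has_derivative frechet_derivative u (at x)) (at x)"
    by (rule differentiable_on_UNIV_D[OF test_fun_differentiable[OF assms]])
  have "frechet_derivative u (at x) h = grad u x \<bullet> h" for h
  proof -
    have lin: "linear (frechet_derivative u (at x))"
      using 1 has_derivative_linear by blast
    have "frechet_derivative u (at x) h = frechet_derivative u (at x) (\<Sum>b\<in>Basis. (h \<bullet> b) *\<^sub>R b)"
      by (simp add: euclidean_representation)
    also have "\<dots> = (\<Sum>b\<in>Basis. (h \<bullet> b) * frechet_derivative u (at x) b)"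
      by (simp add: linear_sum[OF lin] linear_scale[OF lin])
    also have "\<dots> = grad u x \<bullet> h"
      by (subst (3) euclidean_representation[symmetric])
        (simp add: inner_sum_right grad_inner_Basis mult.commute)
    finally show ?thesis .
  qed
  then have "frechet_derivative u (at x) = (\<lambda>h. grad u x \<bullet> h)"
    by auto
  with 1 show ?thesis
    by simp
qed

lemma grad_eqI:
  assumes "(u has_derivative (\<lambda>h. g \<bullet> h)) (at x)"
  shows "grad u x = g"
proof (rule euclidean_eqI)
  fix b :: 'a
  assume "b \<in> Basis"
  then show "grad u x \<bullet> b = g \<bullet> b"
    by (simp only: grad_inner_Basis frechet_derivative_eqI[OF assms])
qed

lemma grad_add:
  "test_fun U u \<Longrightarrow> test_fun V v \<Longrightarrow> grad (\<lambda>x. u x + v x) x = grad u x + grad v x"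
  by (rule grad_eqI) (auto simp: inner_add_left intro!: has_derivative_add test_fun_has_derivative)

lemma grad_cmult: "test_fun U u \<Longrightarrow> grad (\<lambda>x. c * u x) x = c *\<^sub>R grad u x"
  by (rule grad_eqI) (auto intro!: derivative_eq_intros test_fun_has_derivative)

lemma grad_diff:
  "test_fun U u \<Longrightarrow> test_fun V v \<Longrightarrow> grad (\<lambda>x. u x - v x) x = grad u x - grad v x"
  by (rule grad_eqI) (auto simp: inner_diff_left intro!: has_derivative_diff test_fun_has_derivative)

lemma test_fun_grad_continuous:
  assumes "test_fun U u"
  shows "continuous_on S (grad u)"
proof -
  have "Ck (Suc 0) u"
    using assms unfolding test_fun_def smooth_fun_def by blast
  then have "continuous_on UNIV (grad u)"
    unfolding grad_def by (auto intro!: continuous_intros)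
  then show ?thesis
    by (rule continuous_on_subset) auto
qed

text \<open>The closure of the nonzero set lies in \<open>U\<close>, so \<open>x\<close> has a whole
  neighbourhood on which \<open>u\<close> is 0, also when \<open>x\<close> is a boundary point of
  \<open>U\<close>.\<close>

lemma test_fun_grad_eq_0:
  assumes "test_fun U u" "x \<notin> U"
  shows "grad u x = 0"
proof (rule grad_eqI)
  let ?S = "- closure {x. u x \<noteq> 0}"
  have "(u has_derivative (\<lambda>h. 0)) (at x)"
  proof (rule has_derivative_transform_within_open)
    show "((\<lambda>x. 0) has_derivative (\<lambda>h. 0)) (at x)"
      by (rule has_derivative_const)
    show "open ?S"
      by (rule open_Compl[OF closed_closure])
    show "x \<in> ?S"
      using assms unfolding test_fun_def by auto
    show "0 = u y" if "y \<in> ?S" for y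
      using that closure_subset[of "{x. u x \<noteq> 0}"] by auto
  qed
  then show "(u has_derivative (\<lambda>h. 0 \<bullet> h)) (at x)"
    by simp
qed

lemma test_fun_measurable: "test_fun U u \<Longrightarrow> u \<in> borel_measurable borel"
  by (intro borel_measurable_continuous_onI test_fun_continuous)

lemma test_fun_grad_measurable: "test_fun U u \<Longrightarrow> grad u \<in> borel_measurable borel"
  by (intro borel_measurable_continuous_onI test_fun_grad_continuous)

lemma test_fun_bounded:
  assumes "test_fun U u"
  obtains B where "0 < B" "\<And>x. \<bar>u x\<bar> \<le> B" "\<And>x. norm (grad u x) \<le> B"
proof -
  let ?K = "closure {x. u x \<noteq> 0}"
  have "compact ?K"
    using assms by (simp add: test_fun_def)
  then have "bounded (u ` ?K)" "bounded (grad u ` ?K)"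
    by (auto intro!: compact_imp_bounded compact_continuous_image test_fun_continuous[OF assms]
        test_fun_grad_continuous[OF assms])
  then obtain B1 B2 where B: "0 < B1" "0 < B2" "\<And>x. x \<in> ?K \<Longrightarrow> \<bar>u x\<bar> \<le> B1" "\<And>x. x \<in> ?K \<Longrightarrow> norm (grad u x) \<le> B2"
    unfolding bounded_pos by auto
  have "test_fun ?K u"
    using assms by (simp add: test_fun_def)
  then have "x \<notin> ?K \<Longrightarrow> u x = 0" "x \<notin> ?K \<Longrightarrow> grad u x = 0" for x
    using test_fun_eq_0 test_fun_grad_eq_0 by blast+
  with B have "\<bar>u x\<bar> \<le> max B1 B2" "norm (grad u x) \<le> max B1 B2" for x
    by (metis abs_zero le_max_iff_disj less_eq_real_def, metis norm_zero le_max_iff_disj less_eq_real_def)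
  then show ?thesis
    using B that[of "max B1 B2"] by auto
qed

section \<open>Bump functions and the fundamental lemma of the calculus of variations\<close>

text \<open>With \<open>t = 1 / s\<close>, the derivative in \<open>s\<close> of
  \<open>P t * exp (- t)\<close> is \<open>t^2 * (P t - P' t) * exp (- t)\<close>; the factor
  \<open>[:0, 0, 1:]\<close> is the \<open>t^2\<close>.\<close>

primrec flat_poly :: "nat \<Rightarrow> real poly" where
  "flat_poly 0 = 1"
| "flat_poly (Suc n) = [:0, 0, 1:] * (flat_poly n - pderiv (flat_poly n))"

text \<open>The \<^term>\<open>n\<close>-th derivative of the flat function equal to \<open>exp (- 1 / s)\<close> for \<open>s > 0\<close> and to \<open>0\<close> for \<open>s \<le> 0\<close>.\<close>

definition flat_deriv :: "nat \<Rightarrow> real \<Rightarrow> real" where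
  "flat_deriv n s = (if s \<le> 0 then 0 else poly (flat_poly n) (1 / s) * exp (- (1 / s)))"

lemma tendsto_poly_mult_exp_minus: "((\<lambda>t::real. poly q t * exp (- t)) \<longlongrightarrow> 0) at_top"
proof (induction q)
  case 0
  then show ?case by simp
next
  case (pCons a q)
  have "((\<lambda>t. \<Sum>i\<le>degree (pCons a q). coeff (pCons a q) i * (t ^ i / exp t)) \<longlongrightarrow> (\<Sum>i\<le>degree (pCons a q). coeff (pCons a q) i * 0)) at_top"
    by (intro tendsto_intros tendsto_power_div_exp_0)
  then show ?case
    by (simp add: poly_altdef exp_minus divide_inverse sum_distrib_right mult.assoc)
qed

lemma flat_deriv_DERIV: "(flat_deriv n has_field_derivative flat_deriv (Suc n) s) (at s)"
proof (cases s "0::real" rule: linorder_cases)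
  case less
  have "((\<lambda>_. 0) has_field_derivative 0) (at s)"
    by (rule DERIV_const)
  then have "(flat_deriv n has_field_derivative 0) (at s)"
    by (rule has_field_derivative_transform_within_open[where S="{..<0}"])
      (use less in \<open>auto simp: flat_deriv_def\<close>)
  then show ?thesis
    using less by (simp add: flat_deriv_def)
next
  case greater
  have "((\<lambda>s. poly (flat_poly n) (1 / s) * exp (- (1 / s))) has_field_derivative
      (poly (pderiv (flat_poly n)) (1 / s) * (- 1 / s^2) * exp (- (1 / s)) +
        exp (- (1 / s)) * (1 / s^2) * poly (flat_poly n) (1 / s))) (at s)"
    using greater
    by (auto intro!: derivative_eq_intros DERIV_chain'[where f="\<lambda>s. 1 / s", OF _ poly_DERIV]
        simp: power2_eq_square)
  also have "(poly (pderiv (flat_poly n)) (1 / s) * (- 1 / s^2) * exp (- (1 / s)) +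
        exp (- (1 / s)) * (1 / s^2) * poly (flat_poly n) (1 / s)) = flat_deriv (Suc n) s"
    using greater by (simp add: flat_deriv_def field_simps power2_eq_square)
  finally show ?thesis
    by (rule has_field_derivative_transform_within_open[where S="{0<..}"])
      (use greater in \<open>auto simp: flat_deriv_def\<close>)
next
  case equal
  have lim: "((\<lambda>h. flat_deriv n h / h) \<longlongrightarrow> 0) (at 0)"
  proof -
    have "((\<lambda>h. flat_deriv n h / h) \<longlongrightarrow> 0) (at_left 0)"
      by (rule tendsto_eventually) (auto simp: eventually_at_left_field flat_deriv_def intro: exI[of _ "-1"])
    moreover have "((\<lambda>h. flat_deriv n h / h) \<longlongrightarrow> 0) (at_right 0)"
    proof -
      \<comment> \<open>The substitution \<open>t = inverse h\<close> turns the difference quotient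
        at 0 into a polynomial times \<open>exp (- t)\<close>; the factor \<open>[:0, 1:]\<close> is
        the division by \<open>h\<close>.\<close>
      have "((\<lambda>h. poly ([:0, 1:] * flat_poly n) (inverse h) * exp (- inverse h)) \<longlongrightarrow> 0) (at_right 0)"
        by (rule filterlim_compose[OF tendsto_poly_mult_exp_minus filterlim_inverse_at_top_right])
      then show ?thesis
        by (rule Lim_transform_eventually)
          (auto simp: eventually_at_right_field flat_deriv_def field_simps intro!: exI[of _ 1])
    qed
    ultimately show ?thesis
      by (simp add: filterlim_split_at)
  qed
  then show ?thesis
    using equal by (simp add: has_field_derivative_iff flat_deriv_def)
qed

text \<open>A product over coordinates rather than a radial profile: the nonvanishing set is then
  exactly an open box, and boxes are what exhausts an open set below.\<close>

definition bump :: "'a::euclidean_space \<Rightarrow> 'a \<Rightarrow> 'a \<Rightarrow> real" where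
  "bump a b x = (\<Prod>i\<in>Basis. flat_deriv 0 (x \<bullet> i - a \<bullet> i) * flat_deriv 0 (b \<bullet> i - x \<bullet> i))"

lemma flat_deriv_0_bounds: "0 \<le> flat_deriv 0 s" "flat_deriv 0 s \<le> 1"
  by (auto simp: flat_deriv_def)

lemma flat_deriv_0_eq_0_iff: "flat_deriv 0 s = 0 \<longleftrightarrow> s \<le> 0"
  by (auto simp: flat_deriv_def)

lemma bump_bounds: "0 \<le> bump a b x" "bump a b x \<le> 1"
  unfolding bump_def
  by (auto intro!: prod_nonneg prod_le_1 mult_nonneg_nonneg mult_le_one flat_deriv_0_bounds)

lemma bump_support: "{x. bump a b x \<noteq> 0} = box a b"
  by (auto simp: bump_def box_def flat_deriv_0_eq_0_iff)

lemma test_fun_bump: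
  assumes "cbox a b \<subseteq> U"
  shows "test_fun U (bump a b)"
proof -
  have "smooth_fun (bump a b)"
    unfolding bump_def
  proof (intro smooth_fun_prod smooth_fun_mult)
    fix i :: 'a
    show "smooth_fun (\<lambda>x. flat_deriv 0 (x \<bullet> i - a \<bullet> i))"
      using smooth_fun_comp_affine[of flat_deriv, OF flat_deriv_DERIV, of 0 i "- (a \<bullet> i)"] by simp
    show "smooth_fun (\<lambda>x. flat_deriv 0 (b \<bullet> i - x \<bullet> i))"
      using smooth_fun_comp_affine[of flat_deriv, OF flat_deriv_DERIV, of 0 "- i" "b \<bullet> i"] by simp
  qed
  moreover have "closure (box a b) \<subseteq> cbox a b"
    by (intro closure_minimal box_subset_cbox closed_cbox)
  ultimately show ?thesis
    using assms unfolding test_fun_def bump_support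
    by (meson compact_cbox compact_eq_bounded_closed bounded_subset closed_closure order_trans)
qed

text \<open>The constant 1 is not a test function, so the power and the product are unrolled one
  factor at a time into a test function plus a smooth function times a test function.\<close>

lemma test_fun_1_minus_prod:
  fixes n :: nat
  assumes "\<And>i. i < n \<Longrightarrow> test_fun U (\<phi> i)"
  shows "test_fun U (\<lambda>x. 1 - (\<Prod>i<n. (1 - \<phi> i x) ^ m))"
proof -
  have pow: "test_fun U (\<lambda>x. 1 - (1 - u x) ^ m)" if "test_fun U u" for u
  proof (induction m)
    case 0
    then show ?case by (simp add: test_fun_0)
  next
    case (Suc m)
    have "test_fun U (\<lambda>x. (1 - (1 - u x) ^ m) + (1 - u x) ^ m * u x)"
      by (intro test_fun_add test_fun_smult Suc that smooth_fun_power smooth_fun_diff smooth_fun_const)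
        (use that in \<open>simp add: test_fun_def\<close>)
    then show ?case
      by (simp add: algebra_simps)
  qed
  show ?thesis
    using assms
  proof (induction n)
    case 0
    then show ?case by (simp add: test_fun_0)
  next
    case (Suc n)
    have sm: "smooth_fun (\<lambda>x. \<Prod>i<n. (1 - \<phi> i x) ^ m)"
      by (intro smooth_fun_prod smooth_fun_power smooth_fun_diff smooth_fun_const)
        (use Suc.prems in \<open>simp add: test_fun_def\<close>)
    have "test_fun U (\<lambda>x. (1 - (\<Prod>i<n. (1 - \<phi> i x) ^ m)) + (\<Prod>i<n. (1 - \<phi> i x) ^ m) * (1 - (1 - \<phi> n x) ^ m))"
      by (intro test_fun_add test_fun_smult sm pow) (use Suc in auto)
    then show ?case
      by (simp add: algebra_simps)
  qed
qed

text \<open>Cover \<open>V\<close> by countably many boxes, each with its bump, and subtract from 1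
  the product over \<open>i < n\<close> of \<open>(1 - bump (a i) (b i) x) ^ n\<close>. The growing
  power drives the product to 0 as soon as one bump is positive at \<open>x\<close>, while outside
  \<open>V\<close> every factor is 1.\<close>

lemma indicator_open_limit_test_fun:
  fixes V :: "'a::euclidean_space set"
  assumes "open V"
  obtains \<eta> where "\<And>n::nat. test_fun V (\<eta> n)" "\<And>n x. 0 \<le> \<eta> n x" "\<And>n x. \<eta> n x \<le> 1"
    "\<And>x. (\<lambda>n. \<eta> n x) \<longlonglongrightarrow> indicator V x"
proof -
  obtain \<D> where D: "countable \<D>" "\<And>X. X \<in> \<D> \<Longrightarrow> \<exists>a b. cbox a b \<subseteq> V \<and> X = box a b" "\<Union>\<D> = V"
  proof -
    have "\<exists>\<D>. countable \<D> \<and> \<D> \<subseteq> {box a b | a b. cbox a b \<subseteq> V} \<and> \<Union>\<D> = \<Union>{box a b | a b. cbox a b \<subseteq> V}"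
      using Lindelof[of "{box a b | a b. cbox a b \<subseteq> V}"] by (smt (verit) mem_Collect_eq open_box)
    moreover have "\<Union>{box a b | a b. cbox a b \<subseteq> V} = V"
    proof -
      have "\<exists>a b. cbox a b \<subseteq> V \<and> x \<in> box a b" if "x \<in> V" for x
        using open_contains_cbox[OF assms that] by metis
      moreover have "x \<in> V" if "cbox a b \<subseteq> V" "x \<in> box a b" for x a b
        using that box_subset_cbox by blast
      ultimately show ?thesis
        by fastforce
    qed
    ultimately show ?thesis
      using that by (smt (verit, ccfv_SIG) mem_Collect_eq subset_iff)
  qed
  have "\<exists>X::nat \<Rightarrow> 'a set. (\<Union>i. X i) = V \<and> (\<forall>i. \<exists>a b. cbox a b \<subseteq> V \<and> X i = box a b)"
  proof (cases "\<D> = {}")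
    case True
    then have "V = {}"
      using D by auto
    \<comment> \<open>An empty family cannot be enumerated by \<open>from_nat_into\<close>; a
      constant sequence of empty boxes serves instead.\<close>
    obtain i :: 'a where "i \<in> Basis"
      using nonempty_Basis by blast
    then have "cbox One (0::'a) = {}" "box One (0::'a) = {}"
      by (auto simp: box_eq_empty intro!: bexI[of _ i])
    then have "\<exists>a b. cbox a b \<subseteq> V \<and> {} = box a b"
      by (metis empty_subsetI)
    then show ?thesis
      using \<open>V = {}\<close> by (intro exI[of _ "\<lambda>_. {}"]) simp
  next
    case False
    then show ?thesis
      using D by (intro exI[of _ "from_nat_into \<D>"]) (auto simp: range_from_nat_into from_nat_into)
  qed
  then obtain X :: "nat \<Rightarrow> 'a set" where X: "(\<Union>i. X i) = V" "\<And>i. \<exists>a b. cbox a b \<subseteq> V \<and> X i = box a b"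
    by blast
  from X(2) obtain a b where "\<And>i. cbox (a i) (b i) \<subseteq> V \<and> X i = box (a i) (b i)"
    by metis
  with X(1) have ab: "\<And>i::nat. cbox (a i) (b i) \<subseteq> V" "(\<Union>i. box (a i) (b i)) = V"
    by auto
  define \<eta> where "\<eta> n x = 1 - (\<Prod>i<n. (1 - bump (a i) (b i) x) ^ n)" for n x
  have b01: "0 \<le> 1 - bump (a i) (b i) x" "1 - bump (a i) (b i) x \<le> 1" for i x
    using bump_bounds by (auto simp: algebra_simps)
  have p: "0 \<le> (\<Prod>i<n. (1 - bump (a i) (b i) x) ^ m)" "(\<Prod>i<n. (1 - bump (a i) (b i) x) ^ m) \<le> 1" for n m x
    by (auto intro!: prod_nonneg prod_le_1 power_le_one b01 zero_le_power)
  show ?thesis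
  proof (rule that)
    show tf: "test_fun V (\<eta> n)" for n
      unfolding \<eta>_def by (intro test_fun_1_minus_prod test_fun_bump ab)
    show "0 \<le> \<eta> n x" "\<eta> n x \<le> 1" for n x
      unfolding \<eta>_def using p[where n=n and m=n and x=x] by auto
    show "(\<lambda>n. \<eta> n x) \<longlonglongrightarrow> indicator V x" for x
    proof (cases "x \<in> V")
      case False
      then have "\<eta> n x = 0" for n
        using test_fun_eq_0 tf by blast
      then show ?thesis
        using False by simp
    next
      case True
      then obtain j where j: "x \<in> box (a j) (b j)"
        using ab by blast
      let ?q = "1 - bump (a j) (b j) x"
      have "bump (a j) (b j) x \<noteq> 0"
        using j bump_support by blast
      then have q: "0 \<le> ?q" "?q < 1"
        using b01[of j x] bump_bounds[of "a j" "b j" x] by auto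
      have "(\<lambda>n. \<Prod>i<n. (1 - bump (a i) (b i) x) ^ n) \<longlonglongrightarrow> 0"
      proof (rule tendsto_sandwich[OF _ _ tendsto_const])
        show "\<forall>\<^sub>F n in sequentially. 0 \<le> (\<Prod>i<n. (1 - bump (a i) (b i) x) ^ n)"
          using p by auto
        show "\<forall>\<^sub>F n in sequentially. (\<Prod>i<n. (1 - bump (a i) (b i) x) ^ n) \<le> ?q ^ n"
        \<comment> \<open>From \<open>Suc j\<close> on the factor of the box containing
          \<open>x\<close> is present; the others are at most 1.\<close>
        proof (rule eventually_sequentiallyI[of "Suc j"])
          fix n assume "Suc j \<le> n"
          then have "(\<Prod>i<n. (1 - bump (a i) (b i) x) ^ n) = ?q ^ n * (\<Prod>i\<in>{..<n}-{j}. (1 - bump (a i) (b i) x) ^ n)"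
            by (subst prod.remove[of _ j]) auto
          also have "\<dots> \<le> ?q ^ n * 1"
            using q by (intro mult_left_mono prod_le_1) (auto intro!: power_le_one b01 zero_le_power)
          finally show "(\<Prod>i<n. (1 - bump (a i) (b i) x) ^ n) \<le> ?q ^ n"
            by simp
        qed
        show "(\<lambda>n. ?q ^ n) \<longlonglongrightarrow> 0"
          using q by (intro LIMSEQ_realpow_zero) auto
      qed
      from tendsto_diff[OF tendsto_const[of 1] this] show ?thesis
        using True by (simp add: \<eta>_def)
    qed
  qed
qed

text \<open>Cut-offs converging to the indicator of an open set make the integral of
  \<open>f\<close> vanish over every open subset of \<open>U\<close>. A Dynkin argument extends this
  to Borel sets, and discarding null sets to Lebesgue sets; vanishing integrals over all measurable
  sets give 0 almost everywhere.\<close>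

lemma AE_eq_0_if_test_integral_0:
  fixes f :: "'a::euclidean_space \<Rightarrow> real"
  assumes U: "open U" and f: "integrable lebesgue f"
    and 0: "\<And>\<phi>. test_fun U \<phi> \<Longrightarrow> (\<integral>x. f x * \<phi> x \<partial>lebesgue) = 0"
  shows "AE x in lebesgue. x \<in> U \<longrightarrow> f x = 0"
proof -
  have [measurable]: "f \<in> borel_measurable lebesgue"
    using f by auto
  have openV: "(\<integral>x. f x * indicator V x \<partial>lebesgue) = 0" if "open V" "V \<subseteq> U" for V
  proof -
    obtain \<eta> where chi: "\<And>n::nat. test_fun V (\<eta> n)" "\<And>n x. 0 \<le> \<eta> n x" "\<And>n x. \<eta> n x \<le> 1"
      "\<And>x. (\<lambda>n. \<eta> n x) \<longlonglongrightarrow> indicator V x"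
      using indicator_open_limit_test_fun[OF \<open>open V\<close>] by blast
    have "(\<lambda>n. \<integral>x. f x * \<eta> n x \<partial>lebesgue) \<longlonglongrightarrow> (\<integral>x. f x * indicator V x \<partial>lebesgue)"
    proof (rule integral_dominated_convergence[where w="\<lambda>x. norm (f x)"])
      show "(\<lambda>x. f x * indicator V x) \<in> borel_measurable lebesgue"
        using \<open>open V\<close> by (intro borel_measurable_times borel_measurable_indicator) auto
      show "(\<lambda>x. f x * \<eta> n x) \<in> borel_measurable lebesgue" for n
        using test_fun_measurable[OF chi(1), of n] by (intro borel_measurable_times) (auto intro: measurable_completion)
      show "AE x in lebesgue. (\<lambda>n. f x * \<eta> n x) \<longlonglongrightarrow> f x * indicator V x"
        by (auto intro!: AE_I2 tendsto_intros chi)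
      show "AE x in lebesgue. norm (f x * \<eta> n x) \<le> norm (f x)" for n
        using chi by (auto simp: abs_mult intro!: AE_I2 mult_left_le)
    qed (use f in auto)
    moreover have "(\<integral>x. f x * \<eta> n x \<partial>lebesgue) = 0" for n
      using 0 test_fun_mono[OF chi(1)] that by blast
    ultimately show ?thesis
      by (simp add: LIMSEQ_const_iff)
  qed
  \<comment> \<open>Cutting \<open>f\<close> off outside \<open>U\<close> lets all open sets, and
    not only those inside \<open>U\<close>, serve as the generator of the Borel sets.\<close>
  define h where "h x = f x * indicator U x" for x
  have mU: "U \<in> sets lebesgue"
    using U by (simp add: borel_open)
  have h: "integrable lebesgue h"
    unfolding h_def using f mU by (rule integrable_real_mult_indicator[rotated])
  have si: "set_integrable lebesgue A h" if "A \<in> sets lebesgue" for A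
    using integrable_mult_indicator[OF that h] by (simp add: set_integrable_def)
  have 1: "set_lebesgue_integral lebesgue A h = 0" if "open A" for A
  proof -
    have "set_lebesgue_integral lebesgue A h = (\<integral>x. f x * indicator (U \<inter> A) x \<partial>lebesgue)"
      unfolding set_lebesgue_integral_def h_def by (intro Bochner_Integration.integral_cong) (auto simp: indicator_def)
    then show ?thesis
      using openV[of "U \<inter> A"] that U by auto
  qed
  have 2: "set_lebesgue_integral lebesgue A h = 0" if "A \<in> sets borel" for A
  proof -
    have "Int_stable {S::'a set. open S}" "{S::'a set. open S} \<subseteq> Pow UNIV" "A \<in> sigma_sets UNIV {S. open S}"
      using that by (auto simp: Int_stable_def borel_def)
    then show ?thesis
    proof (induction rule: sigma_sets_induct_disjoint)
      case (basic A)
      then show ?case using 1 by simp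
    next
      case empty
      then show ?case by (simp add: set_lebesgue_integral_def)
    next
      case (compl A)
      then have "A \<in> sets lebesgue"
        by (metis (no_types, lifting) borel_def lborelD_Collect sets_completionI_sets sets_lborel sets_measure_of top_greatest Pow_UNIV)
      then have "set_lebesgue_integral lebesgue (A \<union> (UNIV - A)) h = set_lebesgue_integral lebesgue A h + set_lebesgue_integral lebesgue (UNIV - A) h"
        by (intro set_integral_Un si) auto
      then show ?case
        using compl 1[of UNIV] by simp
    next
      case (union A)
      have m: "A i \<in> sets lebesgue" for i
        using union by (metis (no_types, lifting) borel_def range_subsetD sets_completionI_sets sets_lborel sets_measure_of top_greatest Pow_UNIV)
      then have "set_lebesgue_integral lebesgue (\<Union>i. A i) h = (\<Sum>i. set_lebesgue_integral lebesgue (A i) h)"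
        using union by (intro lebesgue_integral_countable_add si) (auto simp: disjoint_family_on_def)
      then show ?case
        using union by simp
    qed
  qed
  have "set_lebesgue_integral lebesgue A h = 0" if "A \<in> sets lebesgue" for A
  proof -
    \<comment> \<open>A Lebesgue set differs from its Borel \<open>main_part\<close> by a null
      set.\<close>
    have "AE x in lebesgue. indicator A x *\<^sub>R h x = indicator (main_part lborel A) x *\<^sub>R h x"
    proof -
      have "AE x in lborel. x \<notin> null_part lborel A"
        using that by (rule AE_notin_null_part)
      moreover have "x \<in> A \<longleftrightarrow> x \<in> main_part lborel A" if "x \<notin> null_part lborel A" for x
        using main_part_null_part_Un[OF \<open>A \<in> sets lebesgue\<close>] that by blast
      ultimately have "AE x in lborel. x \<in> A \<longleftrightarrow> x \<in> main_part lborel A"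
        by (auto elim!: eventually_mono)
      then show ?thesis
        unfolding AE_completion_iff by (rule eventually_mono) (auto simp: indicator_def)
    qed
    moreover have m: "main_part lborel A \<in> sets borel"
      using main_part_sets[OF that] by simp
    ultimately have "set_lebesgue_integral lebesgue A h = set_lebesgue_integral lebesgue (main_part lborel A) h"
      unfolding set_lebesgue_integral_def
      using si[OF that] si[of "main_part lborel A"] by (intro integral_cong_AE) (auto simp: set_integrable_def)
    then show ?thesis
      using 2[OF m] by simp
  qed
  then have "AE x in lebesgue. h x = 0"
    using density_unique_real[OF h, of "\<lambda>_. 0"] by (simp add: set_lebesgue_integral_def)
  then show ?thesis
    by (auto simp: h_def elim!: eventually_mono)
qed

section \<open>Integral inequalities and strict convexity of the \<open>p\<close>-th power\<close>

text \<open>Real powers on \<open>ennreal\<close>, so that Hoelder, Minkowski and Tonelli can be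
  used before integrability is known. The case \<open>top\<close> is explicit because
  \<open>enn2real top\<close> is 0; with the value 0 at 0 it keeps \<open>epow_mult\<close> valid
  for \<open>0 * top\<close>.\<close>

definition epow :: "ennreal \<Rightarrow> real \<Rightarrow> ennreal" where
  "epow x a = (if x = top then top else ennreal (enn2real x powr a))"

lemma epow_ennreal: "0 \<le> x \<Longrightarrow> epow (ennreal x) a = ennreal (x powr a)"
  by (simp add: epow_def)

lemma epow_top [simp]: "epow top a = top"
  by (simp add: epow_def)

lemma epow_0 [simp]: "epow 0 a = 0"
  by (simp add: epow_def)

lemma epow_one [simp]: "epow x 1 = x"
  by (cases x) (auto simp: epow_ennreal)

lemma measurable_epow [measurable]:
  "f \<in> borel_measurable M \<Longrightarrow> (\<lambda>x. epow (f x) a) \<in> borel_measurable M"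
proof -
  assume [measurable]: "f \<in> borel_measurable M"
  have "{x \<in> space M. f x = top} \<in> sets M" "(\<lambda>x. enn2real (f x) powr a) \<in> borel_measurable M"
    by measurable
  then show ?thesis
    unfolding epow_def by (intro measurable_If) auto
qed

lemma epow_mono: "x \<le> y \<Longrightarrow> 0 \<le> a \<Longrightarrow> epow x a \<le> epow y a"
  by (cases x; cases y) (auto simp: epow_ennreal top_unique intro!: ennreal_leI powr_mono2)

lemma epow_mult:
  assumes "0 < a"
  shows "epow (x * y) a = epow x a * epow y a"
proof (cases x; cases y)
  fix r s assume "x = ennreal r" "0 \<le> r" "y = ennreal s" "0 \<le> s"
  then show ?thesis
    by (simp add: epow_ennreal powr_mult flip: ennreal_mult)
next
  fix r assume *: "x = ennreal r" "0 \<le> r" "y = top"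
  show ?thesis
  proof (cases "r = 0")
    case False
    then show ?thesis
      using * assms by (simp add: epow_ennreal ennreal_mult_top)
  qed (use * in simp)
next
  fix s assume *: "x = top" "y = ennreal s" "0 \<le> s"
  show ?thesis
  proof (cases "s = 0")
    case False
    then show ?thesis
      using * assms by (simp add: epow_ennreal ennreal_top_mult)
  qed (use * in simp)
qed (simp add: ennreal_mult_top)

lemma epow_epow: "epow (epow x a) b = epow x (a * b)"
  by (cases x) (auto simp: epow_ennreal powr_powr)

lemma epow_eq_0_iff: "epow x a = 0 \<longleftrightarrow> x = 0"
  by (cases x) (auto simp: epow_ennreal ennreal_eq_0_iff)

lemma epow_eq_top_iff: "epow x a = top \<longleftrightarrow> x = top"
  by (cases x) (auto simp: epow_ennreal)

text \<open>Convexity of \<open>exp\<close> at the points \<open>ln (x i)\<close>; if some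
  \<open>x i\<close> is 0, the left side vanishes.\<close>

lemma weighted_AM_GM:
  fixes w x :: "'i \<Rightarrow> real"
  assumes I: "finite I" and w: "\<And>i. i \<in> I \<Longrightarrow> 0 < w i" "sum w I = 1" and x: "\<And>i. i \<in> I \<Longrightarrow> 0 \<le> x i"
  shows "(\<Prod>i\<in>I. x i powr w i) \<le> (\<Sum>i\<in>I. w i * x i)"
proof (cases "\<exists>i\<in>I. x i = 0")
  case True
  then have "(\<Prod>i\<in>I. x i powr w i) = 0"
    using I by (auto simp: prod_zero_iff)
  moreover have "0 \<le> (\<Sum>i\<in>I. w i * x i)"
    using w x by (intro sum_nonneg mult_nonneg_nonneg) (auto intro: less_imp_le)
  ultimately show ?thesis
    by simp
next
  case False
  then have x: "0 < x i" if "i \<in> I" for i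
    using x[OF that] that by force
  have "(\<Prod>i\<in>I. x i powr w i) = (\<Prod>i\<in>I. exp (w i * ln (x i)))"
    using x by (intro prod.cong) (force simp: powr_def)+
  also have "\<dots> = exp (\<Sum>i\<in>I. w i *\<^sub>R ln (x i))"
    using I by (simp add: exp_sum)
  also have "\<dots> \<le> (\<Sum>i\<in>I. w i * exp (ln (x i)))"
    using w I by (intro convex_on_sum[OF _ _ exp_convex]) (auto intro: less_imp_le)
  also have "\<dots> = (\<Sum>i\<in>I. w i * x i)"
    using x by (intro sum.cong) auto
  finally show ?thesis .
qed

text \<open>Each factor is divided by its integral and the weighted AM-GM inequality is applied
  pointwise; after integration the weights add up to 1. The form with finitely many factors is what
  Gagliardo's induction consumes.\<close>

lemma Holder_nn_integral_prod:
  assumes I: "finite I" and w: "\<And>i. i \<in> I \<Longrightarrow> 0 < w i" "sum w I = 1"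
    and [measurable]: "\<And>i. i \<in> I \<Longrightarrow> G i \<in> borel_measurable M"
  shows "(\<integral>\<^sup>+x. (\<Prod>i\<in>I. epow (G i x) (w i)) \<partial>M) \<le> (\<Prod>i\<in>I. epow (\<integral>\<^sup>+x. G i x \<partial>M) (w i))"
proof -
  \<comment> \<open>The normalization needs integrals strictly between 0 and \<open>top\<close>. A
    zero integral kills the left side even if another one is \<open>top\<close>, and is therefore
    split off first.\<close>
  consider (zero) i where "i \<in> I" "(\<integral>\<^sup>+x. G i x \<partial>M) = 0"
    | (top) j where "j \<in> I" "(\<integral>\<^sup>+x. G j x \<partial>M) = top" "\<And>i. i \<in> I \<Longrightarrow> (\<integral>\<^sup>+x. G i x \<partial>M) \<noteq> 0"
    | (fin) "\<And>i. i \<in> I \<Longrightarrow> (\<integral>\<^sup>+x. G i x \<partial>M) \<noteq> 0 \<and> (\<integral>\<^sup>+x. G i x \<partial>M) \<noteq> top"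
    by blast
  then show ?thesis
  proof cases
    case zero
    then have "AE x in M. G i x = 0"
      by (subst (asm) nn_integral_0_iff_AE) auto
    then have "AE x in M. (\<Prod>i\<in>I. epow (G i x) (w i)) = 0"
      using zero(1) I by (auto elim!: eventually_mono simp: prod_zero_iff epow_eq_0_iff)
    then have "(\<integral>\<^sup>+x. (\<Prod>i\<in>I. epow (G i x) (w i)) \<partial>M) = 0"
      by (subst nn_integral_0_iff_AE) auto
    then show ?thesis by simp
  next
    case top
    have "(\<Prod>i\<in>I - {j}. epow (\<integral>\<^sup>+x. G i x \<partial>M) (w i)) \<noteq> 0"
      using top I by (auto simp: prod_zero_iff epow_eq_0_iff)
    then have "(\<Prod>i\<in>I. epow (\<integral>\<^sup>+x. G i x \<partial>M) (w i)) = top"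
      using top I by (simp add: prod.remove[of I j] ennreal_top_mult)
    then show ?thesis by simp
  next
    case fin
    define A where "A i = enn2real (\<integral>\<^sup>+x. G i x \<partial>M)" for i
    have A: "(\<integral>\<^sup>+x. G i x \<partial>M) = ennreal (A i)" "0 < A i" if "i \<in> I" for i
      using fin[OF that] unfolding A_def by (auto simp: enn2real_positive_iff less_top zero_less_iff_neq_zero)
    define P where "P = (\<Prod>i\<in>I. A i powr w i)"
    have P: "0 < P"
      unfolding P_def using A(2) by (intro prod_pos) (auto dest: less_imp_neq[THEN not_sym])
    have ptw: "(\<Prod>i\<in>I. epow (G i x) (w i)) \<le> ennreal P * (\<Sum>i\<in>I. ennreal (w i / A i) * G i x)" for x
    proof (cases "\<exists>i\<in>I. G i x = top")
      case True
      then obtain j where j: "j \<in> I" "G j x = top" by blast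
      have "ennreal (w j / A j) * G j x = top"
        using j w(1)[of j] A(2)[of j] by (simp add: ennreal_mult_top)
      then have "(\<Sum>i\<in>I. ennreal (w i / A i) * G i x) = top"
        using I j(1) by (auto simp: sum.remove[of I j])
      then show ?thesis
        using P by (simp add: ennreal_mult_top)
    next
      case False
      define g where "g i = enn2real (G i x)" for i
      have g: "G i x = ennreal (g i)" "0 \<le> g i" if "i \<in> I" for i
        using False that unfolding g_def by (auto simp: less_top)
      have "(\<Prod>i\<in>I. g i powr w i) = (\<Prod>i\<in>I. A i powr w i * (g i / A i) powr w i)"
        using g(2) A(2) by (intro prod.cong) (auto simp: powr_mult[symmetric] dest: less_imp_le less_imp_neq[THEN not_sym])
      also have "\<dots> = P * (\<Prod>i\<in>I. (g i / A i) powr w i)"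
        by (simp add: P_def prod.distrib)
      also have "\<dots> \<le> P * (\<Sum>i\<in>I. w i * (g i / A i))"
        using P g(2) A(2) w I by (intro mult_left_mono weighted_AM_GM) (auto intro: less_imp_le divide_nonneg_pos)
      finally have "(\<Prod>i\<in>I. g i powr w i) \<le> P * (\<Sum>i\<in>I. w i / A i * g i)"
        by simp
      then have "ennreal (\<Prod>i\<in>I. g i powr w i) \<le> ennreal (P * (\<Sum>i\<in>I. w i / A i * g i))"
        by (rule ennreal_leI)
      also have "\<dots> = ennreal P * (\<Sum>i\<in>I. ennreal (w i / A i * g i))"
        using P w(1) A(2) g(2)
        by (subst sum_ennreal) (auto simp: less_imp_le ennreal_mult' intro!: sum_nonneg mult_nonneg_nonneg divide_nonneg_pos)
      also have "\<dots> = ennreal P * (\<Sum>i\<in>I. ennreal (w i / A i) * G i x)"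
        using w(1) A(2) g by (intro arg_cong2[where f="(*)"] refl sum.cong)
            (auto simp: less_imp_le simp flip: ennreal_mult)
      finally show ?thesis
        using g by (simp add: epow_ennreal prod_ennreal[symmetric] cong: prod.cong)
    qed
    have "(\<integral>\<^sup>+x. (\<Prod>i\<in>I. epow (G i x) (w i)) \<partial>M) \<le> (\<integral>\<^sup>+x. ennreal P * (\<Sum>i\<in>I. ennreal (w i / A i) * G i x) \<partial>M)"
      by (intro nn_integral_mono ptw)
    also have "\<dots> = ennreal P * (\<Sum>i\<in>I. ennreal (w i / A i) * (\<integral>\<^sup>+x. G i x \<partial>M))"
      by (simp add: nn_integral_cmult nn_integral_sum)
    also have "(\<Sum>i\<in>I. ennreal (w i / A i) * (\<integral>\<^sup>+x. G i x \<partial>M)) = (\<Sum>i\<in>I. ennreal (w i))"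
      using A w(1) by (intro sum.cong) (auto simp: ennreal_mult'[symmetric] less_imp_le less_imp_neq[THEN not_sym] intro!: arg_cong[where f=ennreal])
    also have "\<dots> = 1"
      using w by (subst sum_ennreal) (auto intro: less_imp_le)
    also have "ennreal P * 1 = (\<Prod>i\<in>I. epow (\<integral>\<^sup>+x. G i x \<partial>M) (w i))"
      using A by (simp add: P_def epow_ennreal less_imp_le prod_ennreal[symmetric] cong: prod.cong)
    finally show ?thesis .
  qed
qed

lemma Holder_nn_integral:
  assumes "1 < p" "1 / p + 1 / q = 1" and [measurable]: "f \<in> borel_measurable M" "g \<in> borel_measurable M"
  shows "(\<integral>\<^sup>+x. f x * g x \<partial>M) \<le> epow (\<integral>\<^sup>+x. epow (f x) p \<partial>M) (1 / p) * epow (\<integral>\<^sup>+x. epow (g x) q \<partial>M) (1 / q)"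
proof -
  have q: "0 < 1 / q"
  proof -
    have "1 / p < 1"
      using assms(1) by simp
    then show ?thesis
      using assms(2) by linarith
  qed
  then have q0: "q \<noteq> 0" by auto
  have "(\<integral>\<^sup>+x. (\<Prod>i\<in>{True, False}. epow (if i then epow (f x) p else epow (g x) q) (if i then 1 / p else 1 / q)) \<partial>M)
    \<le> (\<Prod>i\<in>{True, False}. epow (\<integral>\<^sup>+x. (if i then epow (f x) p else epow (g x) q) \<partial>M) (if i then 1 / p else 1 / q))"
    using assms(1,2) q by (intro Holder_nn_integral_prod) auto
  then show ?thesis
    using assms(1) q0 by (simp add: epow_epow)
qed

text \<open>The mean value theorem on the two halves compares two values of a strictly increasing
  derivative. Differentiability is used only in the open interval, which admits
  \<open>x = 0\<close>.\<close>

lemma powr_midpoint_less: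
  fixes x y :: real
  assumes "0 \<le> x" "x < y" "1 < p"
  shows "((x + y) / 2) powr p < (x powr p + y powr p) / 2"
proof -
  define m where "m = (x + y) / 2"
  have m: "x < m" "m < y"
    using assms by (auto simp: m_def)
  have c: "continuous_on {a..b} (\<lambda>t. t powr p)" if "0 \<le> a" for a b :: real
    using assms that by (intro continuous_on_powr' continuous_on_id continuous_on_const) auto
  have d: "((\<lambda>t. t powr p) has_derivative (\<lambda>h. h * (p * t powr (p - 1)))) (at t)" if "0 < t" for t :: real
    using has_real_derivative_powr[OF that, of p] by (simp add: has_field_derivative_def mult.commute[of _ "p * _"])
  have mv: "\<exists>s. a < s \<and> s < b \<and> b powr p - a powr p = (b - a) * (p * s powr (p - 1))"
    if ab: "0 \<le> a" "a < b" for a b :: real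
  proof -
    obtain s where "s \<in> {a<..<b}" "b powr p - a powr p = (b - a) * (p * s powr (p - 1))"
      by (rule mvt[OF ab(2) c[OF ab(1)] d]) (use ab in auto)
    then show ?thesis by auto
  qed
  obtain s where s: "x < s" "s < m" "m powr p - x powr p = (m - x) * (p * s powr (p - 1))"
    using mv[of x m] m assms by auto
  obtain t where t: "m < t" "t < y" "y powr p - m powr p = (y - m) * (p * t powr (p - 1))"
    using mv[of m y] m assms by auto
  have "s powr (p - 1) < t powr (p - 1)"
    using s t assms by (intro powr_less_mono2) auto
  then have "(m - x) * (p * s powr (p - 1)) < (y - m) * (p * t powr (p - 1))"
    using m assms by (intro mult_le_less_imp_less) (auto simp: m_def field_simps)
  then show ?thesis
    using s t by (simp add: m_def)
qed

text \<open>The defect in midpoint convexity of the \<open>p\<close>-th power of the norm.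
  Integrated over gradients it is controlled by the energy excess, because the linear part of the
  energy cancels in it.\<close>

definition mid_gap :: "real \<Rightarrow> 'a::euclidean_space \<Rightarrow> 'a \<Rightarrow> real" where
  "mid_gap p a b = (norm a powr p + norm b powr p) / 2 - norm ((1 / 2) *\<^sub>R (a + b)) powr p"

text \<open>Two sources of strictness: if the norms differ, the power is strictly convex on the
  half-line; if they agree, the parallelogram law makes the midpoint strictly shorter.\<close>

lemma mid_gap_pos:
  fixes a b :: "'a::euclidean_space"
  assumes "1 < p" "a \<noteq> b"
  shows "0 < mid_gap p a b"
proof -
  have le: "norm ((1 / 2) *\<^sub>R (a + b)) \<le> (norm a + norm b) / 2"
    using norm_triangle_ineq[of a b] by simp
  show ?thesis
  proof (cases "norm a = norm b")
    case False
    have "norm ((1 / 2) *\<^sub>R (a + b)) powr p \<le> ((norm a + norm b) / 2) powr p"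
      using le assms by (intro powr_mono2) auto
    also have "\<dots> < (norm a powr p + norm b powr p) / 2"
      using powr_midpoint_less[of "norm a" "norm b" p] powr_midpoint_less[of "norm b" "norm a" p] False assms
      by (cases "norm a < norm b") (auto simp: add.commute)
    finally show ?thesis
      by (simp add: mid_gap_def)
  next
    case True
    have "(norm (a + b))\<^sup>2 + (norm (a - b))\<^sup>2 = 2 * (norm a)\<^sup>2 + 2 * (norm b)\<^sup>2"
      unfolding power2_norm_eq_inner by (simp add: inner_simps inner_commute)
    moreover have "0 < (norm (a - b))\<^sup>2"
      using assms by simp
    moreover have "(2 * norm a)\<^sup>2 = 2 * (norm a)\<^sup>2 + 2 * (norm b)\<^sup>2"
      using True by (simp add: power_mult_distrib)
    ultimately have "(norm (a + b))\<^sup>2 < (2 * norm a)\<^sup>2"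
      by linarith
    then have "norm (a + b) < 2 * norm a"
      by (rule power_less_imp_less_base) simp
    then have "norm ((1 / 2) *\<^sub>R (a + b)) powr p < norm a powr p"
      using assms by (intro powr_less_mono2) auto
    then show ?thesis
      using True by (simp add: mid_gap_def)
  qed
qed

lemma mid_gap_same: "mid_gap p a a = 0"
  by (simp add: mid_gap_def scaleR_2[symmetric])

lemma mid_gap_nonneg: "1 < p \<Longrightarrow> 0 \<le> mid_gap p a b"
  using mid_gap_pos[of p a b] mid_gap_same[of p a] by (cases "a = b") auto

lemma mid_gap_scaleR:
  assumes "0 < c"
  shows "mid_gap p (c *\<^sub>R a) (c *\<^sub>R b) = c powr p * mid_gap p a b"
proof -
  have "norm ((1 / 2) *\<^sub>R (c *\<^sub>R a + c *\<^sub>R b)) = c * norm ((1 / 2) *\<^sub>R (a + b))"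
    using assms by (simp add: scaleR_add_right[symmetric])
  then show ?thesis
    using assms unfolding mid_gap_def by (simp add: powr_mult algebra_simps)
qed

lemma continuous_on_mid_gap:
  fixes f g :: "'b::topological_space \<Rightarrow> 'a::euclidean_space"
  assumes "1 < p" "continuous_on S f" "continuous_on S g"
  shows "continuous_on S (\<lambda>x. mid_gap p (f x) (g x))"
  unfolding mid_gap_def using assms by (auto intro!: continuous_intros continuous_on_powr')

text \<open>Both sides are homogeneous of degree \<open>p\<close>, so a compactness argument on the unit sphere
  suffices; no explicit uniform convexity inequality is needed.\<close>

lemma norm_diff_powr_le_mid_gap:
  assumes p: "1 < p" and e: "0 < \<epsilon>"
  obtains C where "0 < C"
    "\<And>a b :: 'a::euclidean_space. norm (a - b) powr p \<le> \<epsilon> * norm b powr p + C * mid_gap p a b"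
proof -
  \<comment> \<open>Normalized pairs for which the \<open>\<epsilon>\<close> term is at most the
    left side, a compact set. On it \<open>a = b\<close> would force \<open>b = 0\<close>, hence the
    zero pair; so the gap has a positive lower bound \<open>m\<close> there.\<close>
  define S where "S = {z :: 'a \<times> 'a. norm z = 1 \<and> \<epsilon> * norm (snd z) powr p \<le> norm (fst z - snd z) powr p}"
  have "S = sphere 0 1 \<inter> {z. \<epsilon> * norm (snd z) powr p \<le> norm (fst z - snd z) powr p}"
    by (auto simp: S_def)
  moreover have "closed {z :: 'a \<times> 'a. \<epsilon> * norm (snd z) powr p \<le> norm (fst z - snd z) powr p}"
    using p by (intro closed_Collect_le continuous_intros continuous_on_powr') auto
  ultimately have S: "compact S"
    by (simp add: compact_Int_closed)
  have cG: "continuous_on S (\<lambda>z. mid_gap p (fst z) (snd z))"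
    using p by (intro continuous_on_mid_gap continuous_intros)
  have pos: "0 < mid_gap p (fst z) (snd z)" if "z \<in> S" for z
  proof (rule mid_gap_pos[OF p])
    show "fst z \<noteq> snd z"
    proof
      assume eq: "fst z = snd z"
      then have "\<epsilon> * norm (snd z) powr p \<le> 0"
        using that p by (simp add: S_def)
      then have "snd z = 0"
        using e by (simp add: mult_le_0_iff)
      then have "z = 0"
        using eq by (simp add: prod_eq_iff)
      then show False
        using that by (simp add: S_def)
    qed
  qed
  have "\<exists>m>0. \<forall>z\<in>S. m \<le> mid_gap p (fst z) (snd z)"
  proof (cases "S = {}")
    case False
    then show ?thesis
      using continuous_attains_inf[OF S False cG] pos by blast
  qed (auto intro: exI[of _ 1])
  then obtain m where m: "0 < m" "\<And>z. z \<in> S \<Longrightarrow> m \<le> mid_gap p (fst z) (snd z)"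
    by blast
  show ?thesis
  proof (rule that)
    \<comment> \<open>For a pair of norm 1 the difference has norm at most 2, which gives the
      numerator.\<close>
    show "0 < 2 powr p / m"
      using m by simp
    fix a b :: 'a
    define c where "c = norm (a, b)"
    show "norm (a - b) powr p \<le> \<epsilon> * norm b powr p + 2 powr p / m * mid_gap p a b"
    proof (cases "c = 0 \<or> norm (a - b) powr p \<le> \<epsilon> * norm b powr p")
      case True
      moreover have "0 \<le> 2 powr p / m * mid_gap p a b"
        using m mid_gap_nonneg[OF p] by (intro mult_nonneg_nonneg) auto
      moreover have "norm (a - b) powr p = 0" if "c = 0"
        using that p by (simp add: c_def norm_prod_def)
      ultimately show ?thesis
        using e by auto
    next
      case False
      then have c: "0 < c"
        by (auto simp: c_def)
      define a' b' where "a' = (1 / c) *\<^sub>R a" and "b' = (1 / c) *\<^sub>R b"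
      have ab: "a = c *\<^sub>R a'" "b = c *\<^sub>R b'"
        using c by (auto simp: a'_def b'_def)
      have n: "norm (a', b') = 1"
      proof -
        have "(a', b') = (1 / c) *\<^sub>R (a, b)"
          by (simp add: a'_def b'_def)
        then have "norm (a', b') = \<bar>1 / c\<bar> * c"
          unfolding c_def by (simp only: norm_scaleR)
        then show ?thesis
          using c by simp
      qed
      have d: "norm (a - b) = c * norm (a' - b')"
        using c by (simp add: ab scaleR_diff_right[symmetric])
      have "\<epsilon> * norm b powr p < norm (a - b) powr p"
        using False by auto
      then have "(a', b') \<in> S"
        using n c unfolding d by (simp add: S_def ab powr_mult)
      then have "m \<le> mid_gap p a' b'"
        using m by force
      moreover have "norm (a' - b') \<le> 2"
        using norm_triangle_ineq4[of a' b'] norm_fst_le[of a' b'] norm_snd_le[of b' a'] n by linarith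
      then have "norm (a' - b') powr p \<le> 2 powr p"
        using p by (intro powr_mono2) auto
      ultimately have "norm (a' - b') powr p * m \<le> 2 powr p * mid_gap p a' b'"
        using m by (intro mult_mono) auto
      then have "norm (a' - b') powr p \<le> 2 powr p / m * mid_gap p a' b'"
        using m by (simp add: field_simps)
      then have "c powr p * norm (a' - b') powr p \<le> c powr p * (2 powr p / m * mid_gap p a' b')"
        by (intro mult_left_mono) auto
      then have "norm (a - b) powr p \<le> 2 powr p / m * mid_gap p a b"
        unfolding d using c by (simp add: ab mid_gap_scaleR powr_mult mult_ac)
      then show ?thesis
        using e by (simp add: add_increasing)
    qed
  qed
qed

section \<open>The Riesz potential estimate\<close>

lemma nn_integral_lborel_affine:
  fixes f :: "'a::euclidean_space \<Rightarrow> ennreal"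
  assumes [measurable]: "f \<in> borel_measurable borel" and c: "c \<noteq> 0"
  shows "(\<integral>\<^sup>+y. f y \<partial>lborel) = ennreal (\<bar>c\<bar> ^ DIM('a)) * (\<integral>\<^sup>+z. f (t + c *\<^sub>R z) \<partial>lborel)"
  by (subst lborel_affine[OF c, of t]) (simp add: nn_integral_density nn_integral_distr nn_integral_cmult)

lemma nn_integral_lborel_translate:
  fixes f :: "'a::euclidean_space \<Rightarrow> ennreal"
  assumes "f \<in> borel_measurable borel"
  shows "(\<integral>\<^sup>+z. f (t + z) \<partial>lborel) = (\<integral>\<^sup>+y. f y \<partial>lborel)"
  using nn_integral_lborel_affine[OF assms, of 1 t] by simp

lemma nn_integral_lborel_reflect:
  fixes f :: "'a::euclidean_space \<Rightarrow> ennreal"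
  assumes "f \<in> borel_measurable borel"
  shows "(\<integral>\<^sup>+z. f (t - z) \<partial>lborel) = (\<integral>\<^sup>+y. f y \<partial>lborel)"
  using nn_integral_lborel_affine[OF assms, of "-1" t] by simp

lemma nn_integral_lborel_swap:
  fixes f :: "'a::euclidean_space \<Rightarrow> 'b::euclidean_space \<Rightarrow> ennreal"
  assumes "case_prod f \<in> borel_measurable (lborel \<Otimes>\<^sub>M lborel)"
  shows "(\<integral>\<^sup>+y. \<integral>\<^sup>+x. f x y \<partial>lborel \<partial>lborel) = (\<integral>\<^sup>+x. \<integral>\<^sup>+y. f x y \<partial>lborel \<partial>lborel)"
  using pair_sigma_finite.Fubini'[OF _ assms] by (simp add: pair_sigma_finite_def lborel.sigma_finite_measure_axioms)

text \<open>The fundamental theorem of calculus along the ray from \<open>x\<close> in direction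
  \<open>z\<close>, followed to a point where \<open>h\<close> vanishes. It is stated for a general
  \<open>h\<close> because it is applied both to a test function and to a power of its modulus; in
  \<open>norm (G y)\<close> the sign of the function has dropped out.\<close>

lemma le_ray_integral:
  fixes h :: "'a::euclidean_space \<Rightarrow> real"
  assumes h: "\<And>y. (h has_derivative (\<lambda>v. G y \<bullet> v)) (at y)"
    and G: "continuous_on UNIV (\<lambda>y. norm (G y))"
    and supp: "bounded {y. h y \<noteq> 0}" and z: "z \<noteq> 0"
  shows "ennreal \<bar>h x\<bar> \<le> (\<integral>\<^sup>+t. indicator {0<..} t * ennreal (norm (G (x + t *\<^sub>R z)) * norm z) \<partial>lborel)"
proof -
  obtain R where R: "0 < R" "\<And>y. h y \<noteq> 0 \<Longrightarrow> norm y \<le> R"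
    using supp by (auto simp: bounded_pos)
  \<comment> \<open>Long enough for \<open>x + T *\<^sub>R z\<close> to lie outside the ball of
    radius \<open>R\<close> around 0, by the triangle inequality.\<close>
  define T where "T = (R + norm x + 1) / norm z"
  have T: "0 \<le> T"
    using R by (simp add: T_def)
  have hT: "h (x + T *\<^sub>R z) = 0"
  proof (rule ccontr)
    assume "h (x + T *\<^sub>R z) \<noteq> 0"
    then have "norm (x + T *\<^sub>R z) \<le> R"
      by (rule R(2))
    moreover have "norm (T *\<^sub>R z) = R + norm x + 1"
      using z R by (simp add: T_def)
    ultimately show False
      using norm_triangle_ineq4[of "x + T *\<^sub>R z" x] by simp
  qed
  let ?g = "\<lambda>t. norm (G (x + t *\<^sub>R z)) * norm z"
  have "((\<lambda>t. G (x + t *\<^sub>R z) \<bullet> z) has_integral (h (x + T *\<^sub>R z) - h (x + 0 *\<^sub>R z))) {0..T}"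
  proof (rule fundamental_theorem_of_calculus[OF T])
    fix t
    have "((\<lambda>t. x + t *\<^sub>R z) has_derivative (\<lambda>v. v *\<^sub>R z)) (at t within {0..T})"
      by (auto intro!: derivative_eq_intros)
    from has_derivative_compose[OF this h]
    show "((\<lambda>t. h (x + t *\<^sub>R z)) has_vector_derivative G (x + t *\<^sub>R z) \<bullet> z) (at t within {0..T})"
      by (simp add: has_vector_derivative_def)
  qed
  then have i: "(\<lambda>t. G (x + t *\<^sub>R z) \<bullet> z) integrable_on {0..T}"
      "integral {0..T} (\<lambda>t. G (x + t *\<^sub>R z) \<bullet> z) = - h x"
    using hT by (auto simp: integral_unique intro: has_integral_integrable)
  have "continuous_on {0..T} (\<lambda>t. norm (G (x + t *\<^sub>R z)))"
    by (rule continuous_on_compose2[OF G]) (auto intro!: continuous_intros)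
  then have gi: "?g integrable_on {0..T}"
    by (intro integrable_continuous_interval continuous_on_mult[OF _ continuous_on_const])
  have "\<bar>h x\<bar> = norm (integral {0..T} (\<lambda>t. G (x + t *\<^sub>R z) \<bullet> z))"
    using i by simp
  also have "\<dots> \<le> integral {0..T} ?g"
    by (intro integral_norm_bound_integral gi i) (auto simp: Cauchy_Schwarz_ineq2)
  finally have "ennreal \<bar>h x\<bar> \<le> ennreal (integral {0..T} ?g)"
    by (rule ennreal_leI)
  also have "\<dots> = (\<integral>\<^sup>+t. indicator {0..T} t * ennreal (?g t) \<partial>lborel)"
    using nn_integral_has_integral_lebesgue[OF _ integrable_integral[OF gi]]
    by (simp add: mult.commute indicator_mult_ennreal)
  also have "\<dots> \<le> (\<integral>\<^sup>+t. indicator {0<..} t * ennreal (?g t) \<partial>lborel)"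
    by (rule nn_integral_mono_AE)
      (use AE_lborel_singleton[of "0::real"] in \<open>auto elim!: eventually_mono simp: indicator_def\<close>)
  finally show ?thesis .
qed

lemma test_fun_bounded_support: "test_fun U w \<Longrightarrow> bounded {x. w x \<noteq> 0}"
  unfolding test_fun_def by (meson bounded_subset closure_subset compact_imp_bounded)

lemma test_fun_le_ray_integral:
  assumes w: "test_fun U w" and z: "z \<noteq> 0"
  shows "ennreal \<bar>w x\<bar> \<le> (\<integral>\<^sup>+t. indicator {0<..} t * ennreal (norm (grad w (x + t *\<^sub>R z)) * norm z) \<partial>lborel)"
  by (intro le_ray_integral test_fun_has_derivative[OF w] continuous_on_norm test_fun_grad_continuous[OF w]
      test_fun_bounded_support[OF w] z)

text \<open>The reciprocal is taken in \<^typ>\<open>ennreal\<close> so that the value at \<open>0\<close> is \<open>top\<close> and not the junk value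
  \<open>0 powr (- s) = 0\<close>; the comparison with products of one-dimensional kernels then holds everywhere.\<close>

definition riesz :: "real \<Rightarrow> 'a::real_normed_vector \<Rightarrow> ennreal" where
  "riesz s z = inverse (ennreal (norm z powr s))"

lemma measurable_riesz [measurable]: "riesz s \<in> borel_measurable borel"
  unfolding riesz_def by measurable

lemma epow_riesz:
  assumes "0 < a"
  shows "epow (riesz s z) a = riesz (s * a) z"
proof (cases "norm z powr s = 0")
  case True
  then show ?thesis
    using assms by (auto simp: riesz_def)
next
  case False
  then show ?thesis
    by (simp add: riesz_def inverse_ennreal epow_ennreal powr_powr inverse_powr)
qed

lemma annulus_measure:
  shows "0 < emeasure lborel {z::'a::euclidean_space. 1 \<le> norm z \<and> norm z \<le> 2}"
    and "emeasure lborel {z::'a::euclidean_space. 1 \<le> norm z \<and> norm z \<le> 2} < \<infinity>"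
proof -
  let ?A = "{z::'a. 1 \<le> norm z \<and> norm z \<le> 2}"
  have "open {z::'a. 1 < norm z \<and> norm z < 2}"
    by (intro open_Collect_conj open_Collect_less continuous_intros)
  moreover obtain b :: 'a where "b \<in> Basis"
    using nonempty_Basis by blast
  then have "(3 / 2) *\<^sub>R b \<in> {z::'a. 1 < norm z \<and> norm z < 2}"
    by simp
  then have "{z::'a. 1 < norm z \<and> norm z < 2} \<noteq> {}"
    by blast
  ultimately have "{z::'a. 1 < norm z \<and> norm z < 2} \<notin> null_sets lebesgue"
    using open_not_negligible by (auto simp: negligible_iff_null_sets)
  then have "emeasure lborel {z::'a. 1 < norm z \<and> norm z < 2} \<noteq> 0"
    using \<open>open _\<close> by (auto simp: null_sets_def)
  moreover have m: "?A \<in> sets borel"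
    by measurable
  then have "emeasure lborel {z::'a. 1 < norm z \<and> norm z < 2} \<le> emeasure lborel ?A"
    by (intro emeasure_mono) auto
  ultimately show "0 < emeasure lborel ?A"
    by (metis gr_zeroI le_zero_eq)
  have "bounded ?A"
    unfolding bounded_iff by blast
  then show "emeasure lborel ?A < \<infinity>"
    by (rule emeasure_bounded_finite)
qed

text \<open>Averaging the ray estimate over directions in an annulus, instead of over the sphere, makes
  polar coordinates unnecessary.\<close>

lemma test_fun_le_riesz_potential:
  obtains C where "0 < C"
    "\<And>U (w :: 'a::euclidean_space \<Rightarrow> real) x. test_fun U w \<Longrightarrow>
      ennreal \<bar>w x\<bar> \<le> ennreal C * (\<integral>\<^sup>+y. ennreal (norm (grad w y)) * riesz (real DIM('a) - 1) (y - x) \<partial>lborel)"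
proof -
  let ?N = "DIM('a)"
  define A where "A = {z::'a. 1 \<le> norm z \<and> norm z \<le> 2}"
  define m where "m = measure lborel A"
  have m: "0 < m" "emeasure lborel A = ennreal m"
    using annulus_measure[where 'a='a] unfolding m_def A_def measure_def
    by (auto simp: enn2real_positive_iff)
  have [measurable]: "A \<in> sets borel"
    unfolding A_def by measurable
  show ?thesis
  proof (rule that)
    show "0 < 2 ^ ?N / m"
      using m by simp
    fix U and w :: "'a \<Rightarrow> real" and x
    assume w: "test_fun U w"
    define G where "G y = ennreal (norm (grad w y))" for y
    have [measurable]: "grad w \<in> borel_measurable borel"
      using w by (rule test_fun_grad_measurable)
    have [measurable]: "G \<in> borel_measurable borel"
      unfolding G_def by measurable
    \<comment> \<open>What remains for fixed \<open>y\<close> after the substitution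
      \<open>y = x + t *\<^sub>R z\<close>: the 2 bounds \<open>norm z\<close> on the annulus, and
      the division by \<open>t ^ ?N\<close> is the Jacobian.\<close>
    let ?K = "\<lambda>y. \<integral>\<^sup>+t. indicator {0<..} t * (ennreal (2 / t ^ ?N) * indicator A ((1 / t) *\<^sub>R (y - x))) \<partial>lborel"
    have ray: "indicator A z * ennreal \<bar>w x\<bar> \<le> (\<integral>\<^sup>+t. indicator A z * (indicator {0<..} t * (2 * G (x + t *\<^sub>R z))) \<partial>lborel)" for z
    proof (cases "z \<in> A")
      case True
      then have "z \<noteq> 0" by (auto simp: A_def)
      from test_fun_le_ray_integral[OF w this, of x]
      have "ennreal \<bar>w x\<bar> \<le> (\<integral>\<^sup>+t. indicator {0<..} t * ennreal (norm (grad w (x + t *\<^sub>R z)) * norm z) \<partial>lborel)" .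
      also have "\<dots> \<le> (\<integral>\<^sup>+t. indicator {0<..} t * (2 * G (x + t *\<^sub>R z)) \<partial>lborel)"
      proof (intro nn_integral_mono mult_left_mono)
        fix t
        have "ennreal (norm (grad w (x + t *\<^sub>R z)) * norm z) \<le> ennreal (norm (grad w (x + t *\<^sub>R z)) * 2)"
          using True by (intro ennreal_leI mult_left_mono) (auto simp: A_def)
        also have "\<dots> = 2 * G (x + t *\<^sub>R z)"
          unfolding G_def by (simp add: ennreal_mult'' mult.commute)
        finally show "ennreal (norm (grad w (x + t *\<^sub>R z)) * norm z) \<le> 2 * G (x + t *\<^sub>R z)" .
      qed auto
      finally show ?thesis
        using True by simp
    qed simp
    have "ennreal m * ennreal \<bar>w x\<bar> = (\<integral>\<^sup>+z. indicator A z * ennreal \<bar>w x\<bar> \<partial>lborel)"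
      by (simp add: nn_integral_multc m(2))
    also have "\<dots> \<le> (\<integral>\<^sup>+z. \<integral>\<^sup>+t. indicator A z * (indicator {0<..} t * (2 * G (x + t *\<^sub>R z))) \<partial>lborel \<partial>lborel)"
      by (intro nn_integral_mono ray)
    also have "\<dots> = (\<integral>\<^sup>+t. \<integral>\<^sup>+z. indicator A z * (indicator {0<..} t * (2 * G (x + t *\<^sub>R z))) \<partial>lborel \<partial>lborel)"
      by (rule nn_integral_lborel_swap) measurable
    also have "\<dots> = (\<integral>\<^sup>+t. \<integral>\<^sup>+y. indicator {0<..} t * (ennreal (2 / t ^ ?N) * indicator A ((1 / t) *\<^sub>R (y - x))) * G y \<partial>lborel \<partial>lborel)"
    proof (rule nn_integral_cong)
      fix t :: real
      show "(\<integral>\<^sup>+z. indicator A z * (indicator {0<..} t * (2 * G (x + t *\<^sub>R z))) \<partial>lborel)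
          = (\<integral>\<^sup>+y. indicator {0<..} t * (ennreal (2 / t ^ ?N) * indicator A ((1 / t) *\<^sub>R (y - x))) * G y \<partial>lborel)"
      proof (cases "0 < t")
        case True
        have eq: "ennreal (t ^ ?N) * ennreal (2 / t ^ ?N) = 2"
          using True by (simp flip: ennreal_mult)
        have "(\<integral>\<^sup>+y. ennreal (2 / t ^ ?N) * indicator A ((1 / t) *\<^sub>R (y - x)) * G y \<partial>lborel)
          = ennreal (\<bar>t\<bar> ^ ?N) * (\<integral>\<^sup>+z. ennreal (2 / t ^ ?N) * indicator A ((1 / t) *\<^sub>R ((x + t *\<^sub>R z) - x)) * G (x + t *\<^sub>R z) \<partial>lborel)"
          using True by (intro nn_integral_lborel_affine) auto
        also have "\<dots> = (ennreal (t ^ ?N) * ennreal (2 / t ^ ?N)) * (\<integral>\<^sup>+z. indicator A z * G (x + t *\<^sub>R z) \<partial>lborel)"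
          using True by (simp add: nn_integral_cmult mult.assoc)
        also have "\<dots> = (\<integral>\<^sup>+z. indicator A z * (2 * G (x + t *\<^sub>R z)) \<partial>lborel)"
          unfolding eq by (simp add: nn_integral_cmult[symmetric] mult_ac)
        finally show ?thesis
          using True by simp
      qed simp
    qed
    also have "\<dots> = (\<integral>\<^sup>+y. \<integral>\<^sup>+t. indicator {0<..} t * (ennreal (2 / t ^ ?N) * indicator A ((1 / t) *\<^sub>R (y - x))) * G y \<partial>lborel \<partial>lborel)"
      by (rule nn_integral_lborel_swap) measurable
    also have "\<dots> = (\<integral>\<^sup>+y. ?K y * G y \<partial>lborel)"
      by (simp add: nn_integral_multc)
    also have "\<dots> \<le> (\<integral>\<^sup>+y. (2 ^ ?N * riesz (real ?N - 1) (y - x)) * G y \<partial>lborel)"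
    proof (intro nn_integral_mono mult_right_mono)
      fix y
      define d where "d = norm (y - x)"
      show "?K y \<le> 2 ^ ?N * riesz (real ?N - 1) (y - x)"
      proof (cases "d = 0")
        case True
        then have "?K y = 0"
          by (simp add: d_def A_def)
        then show ?thesis by simp
      next
        case False
        then have d: "0 < d"
          by (simp add: d_def)
        \<comment> \<open>The point \<open>y\<close> lies in \<open>x\<close> plus \<open>t\<close>
          times the annulus only for \<open>d / 2 \<le> t \<le> d\<close>. So the integral over
          \<open>t\<close> is at most the largest integrand times \<open>d / 2\<close>, which has
          the order of the kernel.\<close>
        have "?K y \<le> (\<integral>\<^sup>+t. ennreal (2 / (d / 2) ^ ?N) * indicator {d / 2..d} t \<partial>lborel)"
        proof (intro nn_integral_mono)
          fix t :: real
          show "indicator {0<..} t * (ennreal (2 / t ^ ?N) * indicator A ((1 / t) *\<^sub>R (y - x)))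
            \<le> ennreal (2 / (d / 2) ^ ?N) * indicator {d / 2..d} t"
          proof (cases "0 < t \<and> (1 / t) *\<^sub>R (y - x) \<in> A")
            case True
            moreover from True have "norm ((1 / t) *\<^sub>R (y - x)) = d / t"
              unfolding d_def norm_scaleR by simp
            ultimately have t: "0 < t" "d / 2 \<le> t" "t \<le> d"
              by (auto simp: A_def field_simps simp del: scaleR_right_diff_distrib)
            then have "2 / t ^ ?N \<le> 2 / (d / 2) ^ ?N"
              using d by (intro divide_left_mono power_mono mult_pos_pos zero_less_power) auto
            then show ?thesis
              using t by (auto simp: indicator_def intro: ennreal_leI)
          qed (auto simp: indicator_def)
        qed
        also have "\<dots> = ennreal (2 / (d / 2) ^ ?N * (d / 2))"
          using d by (simp add: nn_integral_cmult_indicator ennreal_mult' flip: ennreal_mult)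
        also have "2 / (d / 2) ^ ?N * (d / 2) = 2 ^ ?N * inverse (d powr (real ?N - 1))"
        proof -
          have "d powr (real ?N - 1) = d ^ ?N / d"
            using d by (simp add: powr_diff powr_realpow)
          then show ?thesis
            using d by (simp add: power_divide field_simps)
        qed
        also have "ennreal (2 ^ ?N * inverse (d powr (real ?N - 1))) = 2 ^ ?N * riesz (real ?N - 1) (y - x)"
          using d by (simp add: riesz_def d_def inverse_ennreal ennreal_mult' ennreal_power[symmetric])
        finally show ?thesis .
      qed
    qed simp
    also have "\<dots> = 2 ^ ?N * (\<integral>\<^sup>+y. G y * riesz (real ?N - 1) (y - x) \<partial>lborel)"
      by (simp add: nn_integral_cmult mult.assoc mult.commute[of "G _"])
    finally have *: "ennreal m * ennreal \<bar>w x\<bar> \<le> 2 ^ ?N * (\<integral>\<^sup>+y. G y * riesz (real ?N - 1) (y - x) \<partial>lborel)" .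
    have "ennreal \<bar>w x\<bar> = ennreal (1 / m) * (ennreal m * ennreal \<bar>w x\<bar>)"
      using m(1) by (simp flip: ennreal_mult)
    also have "\<dots> \<le> ennreal (1 / m) * (2 ^ ?N * (\<integral>\<^sup>+y. G y * riesz (real ?N - 1) (y - x) \<partial>lborel))"
      using * by (rule mult_left_mono) simp
    also have "\<dots> = ennreal (2 ^ ?N / m) * (\<integral>\<^sup>+y. G y * riesz (real ?N - 1) (y - x) \<partial>lborel)"
    proof -
      have "ennreal (2 ^ ?N / m) = ennreal (1 / m) * 2 ^ ?N"
        using m(1) by (simp add: divide_inverse mult.commute[of _ "inverse m"] ennreal_mult' ennreal_power flip: ennreal_numeral)
      then show ?thesis
        by (simp add: mult.assoc)
    qed
    finally show "ennreal \<bar>w x\<bar> \<le> ennreal (2 ^ ?N / m) * (\<integral>\<^sup>+y. ennreal (norm (grad w y)) * riesz (real ?N - 1) (y - x) \<partial>lborel)"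
      by (simp add: G_def)
  qed
qed

section \<open>Integrals of Riesz kernels over cubes and segments\<close>

lemma epow_prod: "0 < a \<Longrightarrow> epow (\<Prod>i\<in>I. f i) a = (\<Prod>i\<in>I. epow (f i) a)"
  by (induction I rule: infinite_finite_induct) (simp_all add: epow_mult, simp_all add: epow_def)

lemma epow_add: "0 < a \<Longrightarrow> 0 < b \<Longrightarrow> epow x (a + b) = epow x a * epow x b"
  by (cases x) (auto simp: epow_ennreal powr_add simp flip: ennreal_mult)

lemma riesz_neq_0: "riesz s z \<noteq> 0"
  by (simp add: riesz_def)

lemma riesz_0 [simp]: "riesz s 0 = top"
  by (simp add: riesz_def)

lemma riesz_minus [simp]: "riesz s (- z) = riesz s z"
  by (simp add: riesz_def)

lemma riesz_eq_ennreal: "z \<noteq> 0 \<Longrightarrow> riesz s z = ennreal (norm z powr - s)"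
  by (simp add: riesz_def inverse_ennreal powr_minus)

text \<open>The modulus of every coordinate is at most \<open>norm z\<close>, so the exponent may be
  distributed over the coordinates at will. Integrals of Riesz kernels over cubes thereby split into
  one-dimensional ones, in which each exponent has to be below 1.\<close>

lemma riesz_le_prod:
  fixes z :: "'a::euclidean_space"
  assumes "\<And>b. b \<in> Basis \<Longrightarrow> 0 \<le> c b"
  shows "riesz (sum c (Basis :: 'a set)) z \<le> (\<Prod>b\<in>Basis. riesz (c b) (z \<bullet> b))"
proof (cases "\<exists>b\<in>Basis. z \<bullet> b = 0")
  case True
  then obtain b where b: "b \<in> Basis" "z \<bullet> b = 0"
    by blast
  have "(\<Prod>i\<in>Basis - {b}. riesz (c i) (z \<bullet> i)) \<noteq> 0"
    by (auto simp: prod_zero_iff riesz_neq_0)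
  then have "(\<Prod>i\<in>Basis. riesz (c i) (z \<bullet> i)) = top"
    using b by (simp add: prod.remove[of Basis b] ennreal_top_mult)
  then show ?thesis by simp
next
  case False
  then have nz: "z \<noteq> 0"
    using nonempty_Basis by auto
  have "norm z powr (- sum c Basis) = (\<Prod>b\<in>Basis. norm z powr - c b)"
    using nz by (simp add: powr_sum[symmetric] sum_negf)
  also have "\<dots> \<le> (\<Prod>b\<in>Basis. \<bar>z \<bullet> b\<bar> powr - c b)"
    using assms False by (intro prod_mono conjI powr_mono2') (auto simp: Basis_le_norm)
  finally show ?thesis
    using False nz by (simp add: riesz_eq_ennreal prod_ennreal ennreal_leI cong: prod.cong)
qed

lemma nn_integral_riesz_interval:
  assumes "0 \<le> R" "a < 1"
  shows "(\<integral>\<^sup>+s. indicator {-R..R} s * riesz a (s::real) \<partial>lborel) \<le> ennreal (2 * R powr (1 - a) / (1 - a))"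
proof -
  let ?F = "\<lambda>s::real. indicator {0..R} s * riesz a s"
  have half: "(\<integral>\<^sup>+s. ?F s \<partial>lborel) = ennreal (R powr (1 - a) / (1 - a))"
  proof -
    have "(\<integral>\<^sup>+s. ?F s \<partial>lborel) = (\<integral>\<^sup>+s. ennreal (indicator {0..R} s * s powr - a) \<partial>lborel)"
      by (rule nn_integral_cong_AE)
        (use AE_lborel_singleton[of "0::real"] in \<open>auto elim!: eventually_mono simp: indicator_def riesz_eq_ennreal\<close>)
    also have "\<dots> = ennreal (R powr (- a + 1) / (- a + 1))"
      using assms by (intro nn_integral_has_integral_lebesgue has_integral_powr_from_0) auto
    finally show ?thesis by simp
  qed
  have "(\<integral>\<^sup>+s. indicator {-R..R} s * riesz a (s::real) \<partial>lborel) \<le> (\<integral>\<^sup>+s. ?F s + ?F (0 - s) \<partial>lborel)"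
    by (intro nn_integral_mono) (auto simp: indicator_def)
  also have "\<dots> = (\<integral>\<^sup>+s. ?F s \<partial>lborel) + (\<integral>\<^sup>+s. ?F (0 - s) \<partial>lborel)"
    by (intro nn_integral_add) measurable
  also have "(\<integral>\<^sup>+s. ?F (0 - s) \<partial>lborel) = (\<integral>\<^sup>+s. ?F s \<partial>lborel)"
    by (rule nn_integral_lborel_reflect) measurable
  finally show ?thesis
    using assms unfolding half by (simp flip: ennreal_plus)
qed

text \<open>A ball of the maximum norm, so that its indicator is a product of indicators of
  intervals, matching the product bound for \<open>riesz\<close>.\<close>

definition cube :: "real \<Rightarrow> 'a::euclidean_space set" where
  "cube R = {z. \<forall>b\<in>Basis. \<bar>z \<bullet> b\<bar> \<le> R}"

lemma indicator_cube: "(indicator (cube R) z :: ennreal) = (\<Prod>b\<in>Basis. indicator {-R..R} (z \<bullet> b))"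
proof (cases "z \<in> cube R")
  case True
  then have "\<And>b. b \<in> Basis \<Longrightarrow> z \<bullet> b \<in> {-R..R}"
    by (auto simp: cube_def abs_le_iff)
  then show ?thesis
    using True by simp
next
  case False
  then obtain b where "b \<in> Basis" "z \<bullet> b \<notin> {-R..R}"
    by (auto simp: cube_def abs_le_iff)
  then have "(\<Prod>b\<in>Basis. indicator {-R..R} (z \<bullet> b)) = (0::ennreal)"
    by (auto simp: prod_zero_iff indicator_def)
  then show ?thesis
    using False by simp
qed

lemma cube_measurable [measurable]: "cube R \<in> sets borel"
  unfolding cube_def by measurable

lemma cube_diff:
  assumes "x \<in> cube R" "y \<in> cube S"
  shows "x - y \<in> cube (R + S)"
proof -
  have "\<bar>(x - y) \<bullet> b\<bar> \<le> R + S" if "b \<in> Basis" for b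
    using assms that unfolding cube_def by (smt (verit) inner_diff_left mem_Collect_eq)
  then show ?thesis
    by (auto simp: cube_def)
qed

lemma cube_mono: "R \<le> S \<Longrightarrow> cube R \<subseteq> cube S"
  unfolding cube_def by force

lemma bounded_subset_cube:
  fixes S :: "'a::euclidean_space set"
  assumes "bounded S"
  obtains R where "0 < R" "S \<subseteq> cube R"
proof -
  obtain R where "0 < R" "\<And>x. x \<in> S \<Longrightarrow> norm x \<le> R"
    using assms by (auto simp: bounded_pos)
  then show ?thesis
    using that[of R] unfolding cube_def by (auto intro: order_trans[OF Basis_le_norm])
qed

lemma emeasure_cube_finite: "emeasure lborel (cube R :: 'a::euclidean_space set) < \<infinity>"
proof -
  have "cube R \<subseteq> cbox (- (R *\<^sub>R One)) (R *\<^sub>R One :: 'a)"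
    unfolding cube_def cbox_def by (auto simp: abs_le_iff)
  then have "emeasure lborel (cube R :: 'a set) \<le> emeasure lborel (cbox (- (R *\<^sub>R One)) (R *\<^sub>R One :: 'a))"
    by (intro emeasure_mono) auto
  then show ?thesis
    using emeasure_lborel_cbox_finite order_le_less_trans by (metis infinity_ennreal_def)
qed

text \<open>The exponent is spread evenly: \<open>s / real DIM('a)\<close> on each coordinate is
  below 1 exactly when \<open>s < real DIM('a)\<close>.\<close>

lemma nn_integral_riesz_cube:
  assumes "0 \<le> R" "0 \<le> s" "s < real DIM('a)"
  obtains K where "0 \<le> K" "(\<integral>\<^sup>+z. indicator (cube R) (z::'a::euclidean_space) * riesz s z \<partial>lborel) \<le> ennreal K"
proof -
  define a where "a = s / real DIM('a)"
  have a: "0 \<le> a" "a < 1"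
    using assms by (auto simp: a_def)
  have s: "s = (\<Sum>b\<in>(Basis::'a set). a)"
    by (simp add: a_def)
  let ?k = "2 * R powr (1 - a) / (1 - a)"
  have "(\<integral>\<^sup>+z. indicator (cube R) (z::'a) * riesz s z \<partial>lborel)
      \<le> (\<integral>\<^sup>+z. (\<Prod>b\<in>(Basis::'a set). indicator {-R..R} (z \<bullet> b) * riesz a (z \<bullet> b)) \<partial>lborel)"
    unfolding indicator_cube prod.distrib using a
    by (subst s) (intro nn_integral_mono mult_left_mono riesz_le_prod; simp)
  also have "\<dots> = (\<Prod>b\<in>(Basis::'a set). \<integral>\<^sup>+s. indicator {-R..R} s * riesz a s \<partial>lborel)"
    by (rule nn_integral_lborel_prod) auto
  also have "\<dots> \<le> (\<Prod>b\<in>(Basis::'a set). ennreal ?k)"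
    using assms a by (intro prod_mono_ennreal nn_integral_riesz_interval) auto
  also have "\<dots> = ennreal (\<Prod>b\<in>(Basis::'a set). ?k)"
    using a by (intro prod_ennreal) auto
  finally show ?thesis
    using a by (intro that[of "\<Prod>b\<in>(Basis::'a set). ?k"]) (auto intro!: prod_nonneg)
qed

text \<open>The bound is uniform in the position \<open>s\<close>: where \<open>s - t\<close> has
  modulus at most \<open>r\<close> the kernel integrates like one centred at 0, elsewhere it is at
  most \<open>r powr - \<beta>\<close> on an interval of length \<open>r\<close>.\<close>

lemma nn_integral_riesz_sliding:
  assumes "0 < \<beta>" "\<beta> < 1" "0 < r"
  shows "(\<integral>\<^sup>+t. indicator {0..r} t * riesz \<beta> (s - t) \<partial>lborel) \<le> ennreal ((2 / (1 - \<beta>) + 1) * r powr (1 - \<beta>))"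
proof -
  let ?F = "\<lambda>s::real. indicator {-r..r} s * riesz \<beta> s"
  have *: "indicator {0..r} t * riesz \<beta> (s - t) \<le> ?F (s - t) + ennreal (r powr - \<beta>) * indicator {0..r} t" for t
  proof (cases "\<bar>s - t\<bar> \<le> r")
    case False
    then have "riesz \<beta> (s - t) \<le> ennreal (r powr - \<beta>)"
      using assms by (subst riesz_eq_ennreal) (auto intro!: ennreal_leI powr_mono2')
    then show ?thesis
      by (auto simp: indicator_def intro: add_increasing)
  qed (auto simp: indicator_def abs_le_iff)
  have "(\<integral>\<^sup>+t. indicator {0..r} t * riesz \<beta> (s - t) \<partial>lborel)
      \<le> (\<integral>\<^sup>+t. ?F (s - t) + ennreal (r powr - \<beta>) * indicator {0..r} t \<partial>lborel)"
    by (intro nn_integral_mono *)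
  also have "\<dots> = (\<integral>\<^sup>+t. ?F (s - t) \<partial>lborel) + (\<integral>\<^sup>+t. ennreal (r powr - \<beta>) * indicator {0..r} t \<partial>lborel)"
    by (intro nn_integral_add) measurable
  also have "(\<integral>\<^sup>+t. ?F (s - t) \<partial>lborel) = (\<integral>\<^sup>+t. ?F t \<partial>lborel)"
    by (rule nn_integral_lborel_reflect) measurable
  also have "\<dots> \<le> ennreal (2 * r powr (1 - \<beta>) / (1 - \<beta>))"
    using assms by (intro nn_integral_riesz_interval) auto
  also have "(\<integral>\<^sup>+t. ennreal (r powr - \<beta>) * indicator {0..r} t \<partial>lborel) = ennreal (r powr (1 - \<beta>))"
    using assms by (simp add: nn_integral_cmult_indicator powr_diff powr_minus divide_inverse mult.commute flip: ennreal_mult)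
  also have "ennreal (2 * r powr (1 - \<beta>) / (1 - \<beta>)) + ennreal (r powr (1 - \<beta>)) = ennreal ((2 / (1 - \<beta>) + 1) * r powr (1 - \<beta>))"
    using assms by (simp add: distrib_right flip: ennreal_plus)
  finally show ?thesis
    by (simp add: add_right_mono)
qed

text \<open>For a unit vector \<open>e\<close>, the Riesz potential of arc length on the segment
  from 0 to \<open>r *\<^sub>R e\<close>, with the exponent of the potential estimate for
  gradients.\<close>

definition seg_riesz :: "'a::euclidean_space \<Rightarrow> real \<Rightarrow> 'a \<Rightarrow> ennreal" where
  "seg_riesz e r z = (\<integral>\<^sup>+t. indicator {0..r} t * riesz (real DIM('a) - 1) (z - t *\<^sub>R e) \<partial>lborel)"

lemma measurable_seg_riesz [measurable]: "seg_riesz e r \<in> borel_measurable borel"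
proof -
  have "(\<lambda>z. seg_riesz e r z) \<in> borel_measurable lborel"
    unfolding seg_riesz_def by measurable
  then show ?thesis by simp
qed

text \<open>By Tonelli each point of the segment contributes at most the integral of one kernel over
  a slightly larger cube, finite because its exponent is one less than the dimension. This rate is
  for the relative error between gradients.\<close>

lemma nn_integral_seg_riesz_cube:
  fixes e :: "'a::euclidean_space"
  assumes R: "0 \<le> R" and e: "e \<in> Basis"
  obtains K where "0 \<le> K"
    "\<And>r. 0 < r \<Longrightarrow> r \<le> 1 \<Longrightarrow> (\<integral>\<^sup>+z. indicator (cube R) z * seg_riesz e r z \<partial>lborel) \<le> ennreal (K * r)"
proof -
  let ?s = "real DIM('a) - 1"
  let ?F = "\<lambda>z::'a. indicator (cube (R + 1)) z * riesz ?s z"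
  obtain K where K: "0 \<le> K" "(\<integral>\<^sup>+z. ?F z \<partial>lborel) \<le> ennreal K"
    using nn_integral_riesz_cube[of "R + 1" ?s, where 'a='a] R by (auto simp: DIM_ge_Suc0)
  show ?thesis
  proof (rule that[OF K(1)])
    fix r :: real assume r: "0 < r" "r \<le> 1"
    have "(\<integral>\<^sup>+z. indicator (cube R) z * seg_riesz e r z \<partial>lborel)
      = (\<integral>\<^sup>+z. \<integral>\<^sup>+t. indicator (cube R) z * (indicator {0..r} t * riesz ?s (z - t *\<^sub>R e)) \<partial>lborel \<partial>lborel)"
      unfolding seg_riesz_def by (simp add: nn_integral_cmult)
    also have "\<dots> = (\<integral>\<^sup>+t. \<integral>\<^sup>+z. indicator (cube R) z * (indicator {0..r} t * riesz ?s (z - t *\<^sub>R e)) \<partial>lborel \<partial>lborel)"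
      by (rule nn_integral_lborel_swap) measurable
    also have "\<dots> \<le> (\<integral>\<^sup>+t. \<integral>\<^sup>+z. indicator {0..r} t * ?F (- (t *\<^sub>R e) + z) \<partial>lborel \<partial>lborel)"
    proof (intro nn_integral_mono)
      fix t and z :: 'a
      have "z - t *\<^sub>R e \<in> cube (R + 1)" if "z \<in> cube R" "t \<in> {0..r}"
        using that r e by (intro cube_diff) (auto simp: cube_def inner_Basis)
      then show "indicator (cube R) z * (indicator {0..r} t * riesz ?s (z - t *\<^sub>R e)) \<le> indicator {0..r} t * ?F (- (t *\<^sub>R e) + z)"
        by (auto simp: indicator_def)
    qed
    also have "\<dots> = (\<integral>\<^sup>+t. indicator {0..r} t * (\<integral>\<^sup>+z. ?F (- (t *\<^sub>R e) + z) \<partial>lborel) \<partial>lborel)"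
      by (intro nn_integral_cong nn_integral_cmult) measurable
    also have "\<dots> = (\<integral>\<^sup>+t. indicator {0..r} t * (\<integral>\<^sup>+z. ?F z \<partial>lborel) \<partial>lborel)"
      by (subst nn_integral_lborel_translate) auto
    also have "\<dots> = ennreal r * (\<integral>\<^sup>+z. ?F z \<partial>lborel)"
      using r by (simp add: nn_integral_multc)
    also have "\<dots> \<le> ennreal r * ennreal K"
      using K by (intro mult_left_mono) auto
    also have "\<dots> = ennreal (K * r)"
      using K r by (simp add: mult.commute flip: ennreal_mult)
    finally show "(\<integral>\<^sup>+z. indicator (cube R) z * seg_riesz e r z \<partial>lborel) \<le> ennreal (K * r)" .
  qed
qed

text \<open>The exponent \<open>\<beta>\<close> put on the direction of the segment must exceed \<open>(N - 1) / p\<close> for the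
  transversal factors to be \<open>q\<close>-integrable, and be below \<open>1\<close> for a gain over the trivial rate
  \<open>r powr (1 / q)\<close>. This is where \<open>p > N - 1\<close> enters.\<close>

lemma seg_riesz_Lq_cube:
  fixes e :: "'a::euclidean_space"
  assumes N: "2 \<le> DIM('a)" and p: "real DIM('a) - 1 < p" and pq: "1 / p + 1 / q = 1"
    and R: "0 \<le> R" and e: "e \<in> Basis"
  obtains K \<theta> where "0 \<le> K" "0 < \<theta>"
    "\<And>r. 0 < r \<Longrightarrow> r \<le> 1 \<Longrightarrow>
      epow (\<integral>\<^sup>+z. indicator (cube R) z * epow (seg_riesz e r z) q \<partial>lborel) (1 / q) \<le> ennreal (K * r powr (1 / q + \<theta>))"
proof -
  define n where "n = real DIM('a) - 1"
  have n: "1 \<le> n" "n < p"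
    using N p by (auto simp: n_def)
  have p1: "1 < p"
    using n by simp
  have "q \<noteq> 0"
    using pq p1 by auto
  then have q: "q = p / (p - 1)"
    using pq p1 by (auto simp: field_simps)
  have q1: "1 < q" "0 < q - 1" "(q - 1) / q = 1 / p"
    using p1 by (auto simp: q field_simps)
  \<comment> \<open>\<open>\<beta>\<close> is the midpoint of the admissible range from
    \<open>n / p\<close> to 1; \<open>\<gamma>\<close> is then forced by
    \<open>\<beta> + n * \<gamma> = n\<close>, the total exponent of the kernel.\<close>
  define \<beta> where "\<beta> = (n / p + 1) / 2"
  define \<gamma> where "\<gamma> = 1 - \<beta> / n"
  have np: "n / p < 1" "0 < n / p"
    using n by auto
  have \<beta>: "0 < \<beta>" "\<beta> < 1" "n / p < \<beta>"
  proof -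
    have "0 < (x + 1) / 2 \<and> (x + 1) / 2 < 1 \<and> x < (x + 1) / 2" if "0 < x" "x < 1" for x :: real
      using that by simp
    from this[OF np(2,1)] show "0 < \<beta>" "\<beta> < 1" "n / p < \<beta>"
      unfolding \<beta>_def by blast+
  qed
  have \<gamma>: "0 \<le> \<gamma>" "\<gamma> * q < 1"
  proof -
    show "0 \<le> \<gamma>"
      using \<beta> n by (auto simp: \<gamma>_def field_simps)
    have "1 / p < \<beta> / n"
      using \<beta>(3) n by (simp add: field_simps)
    then have "\<gamma> < 1 / q"
      using pq by (simp add: \<gamma>_def)
    then show "\<gamma> * q < 1"
      using q1 by (simp add: field_simps)
  qed
  define c where "c b = (if b = e then \<beta> else \<gamma>)" for b
  have sum_c: "sum c (Basis :: 'a set) = real DIM('a) - 1"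
  proof -
    have "sum c (Basis :: 'a set) = \<beta> + (\<Sum>b\<in>Basis - {e}. \<gamma>)"
      using e by (simp add: sum.remove[of Basis e] c_def)
    also have "\<dots> = \<beta> + n * \<gamma>"
      using e by (simp add: n_def of_nat_diff DIM_ge_Suc0)
    also have "n * \<gamma> = n - \<beta>"
      using n(1) by (simp add: \<gamma>_def right_diff_distrib)
    finally show ?thesis
      by (simp add: n_def)
  qed
  define M where "M r s = (\<integral>\<^sup>+t. indicator {0..r} t * riesz \<beta> (s - t) \<partial>lborel)" for r s :: real
  have [measurable]: "M r \<in> borel_measurable borel" for r
  proof -
    have "M r \<in> borel_measurable lborel"
      unfolding M_def by measurable
    then show ?thesis by simp
  qed
  \<comment> \<open>The parameter \<open>t\<close> moves only the coordinate along \<open>e\<close>,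
    so the transversal factors come out of the integral over \<open>t\<close>.\<close>
  have seg: "seg_riesz e r z \<le> M r (z \<bullet> e) * (\<Prod>b\<in>Basis - {e}. riesz \<gamma> (z \<bullet> b))" for r and z :: 'a
  proof -
    have "seg_riesz e r z \<le> (\<integral>\<^sup>+t. indicator {0..r} t * (riesz \<beta> (z \<bullet> e - t) * (\<Prod>b\<in>Basis - {e}. riesz \<gamma> (z \<bullet> b))) \<partial>lborel)"
      unfolding seg_riesz_def
    proof (intro nn_integral_mono mult_left_mono)
      fix t
      have "riesz (real DIM('a) - 1) (z - t *\<^sub>R e) \<le> (\<Prod>b\<in>Basis. riesz (c b) ((z - t *\<^sub>R e) \<bullet> b))"
        unfolding sum_c[symmetric] using \<beta> \<gamma> by (intro riesz_le_prod) (auto simp: c_def)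
      also have "\<dots> = riesz (c e) ((z - t *\<^sub>R e) \<bullet> e) * (\<Prod>b\<in>Basis - {e}. riesz (c b) ((z - t *\<^sub>R e) \<bullet> b))"
        using e by (intro prod.remove) auto
      also have "(\<Prod>b\<in>Basis - {e}. riesz (c b) ((z - t *\<^sub>R e) \<bullet> b)) = (\<Prod>b\<in>Basis - {e}. riesz \<gamma> (z \<bullet> b))"
        using e by (intro prod.cong) (auto simp: c_def inner_diff_left inner_Basis)
      finally show "riesz (real DIM('a) - 1) (z - t *\<^sub>R e) \<le> riesz \<beta> (z \<bullet> e - t) * (\<Prod>b\<in>Basis - {e}. riesz \<gamma> (z \<bullet> b))"
        using e by (simp add: c_def inner_diff_left)
    qed simp
    also have "\<dots> = M r (z \<bullet> e) * (\<Prod>b\<in>Basis - {e}. riesz \<gamma> (z \<bullet> b))"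
      unfolding M_def by (simp add: nn_integral_multc mult.assoc[symmetric])
    finally show ?thesis .
  qed
  define k where "k = 2 / (1 - \<beta>) + 1"
  have k: "0 < k"
    using \<beta> by (simp add: k_def add_pos_pos)
  have M_sup: "M r s \<le> ennreal (k * r powr (1 - \<beta>))" if "0 < r" for r s
    unfolding M_def k_def using \<beta> that by (intro nn_integral_riesz_sliding)
  define I where "I = 2 * (R + 1) powr (1 - \<beta>) / (1 - \<beta>)"
  have I: "0 \<le> I"
    using \<beta> by (simp add: I_def)
  have M_int: "(\<integral>\<^sup>+s. indicator {-R..R} s * M r s \<partial>lborel) \<le> ennreal (I * r)" if r: "0 < r" "r \<le> 1" for r
  proof -
    let ?F = "\<lambda>s::real. indicator {-(R+1)..R+1} s * riesz \<beta> s"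
    have "(\<integral>\<^sup>+s. indicator {-R..R} s * M r s \<partial>lborel)
      = (\<integral>\<^sup>+s. \<integral>\<^sup>+t. indicator {-R..R} s * (indicator {0..r} t * riesz \<beta> (s - t)) \<partial>lborel \<partial>lborel)"
      unfolding M_def by (simp add: nn_integral_cmult)
    also have "\<dots> = (\<integral>\<^sup>+t. \<integral>\<^sup>+s. indicator {-R..R} s * (indicator {0..r} t * riesz \<beta> (s - t)) \<partial>lborel \<partial>lborel)"
      by (rule nn_integral_lborel_swap) measurable
    also have "\<dots> \<le> (\<integral>\<^sup>+t. \<integral>\<^sup>+s. indicator {0..r} t * ?F (- t + s) \<partial>lborel \<partial>lborel)"
      using r by (intro nn_integral_mono) (auto simp: indicator_def)
    also have "\<dots> = (\<integral>\<^sup>+t. indicator {0..r} t * (\<integral>\<^sup>+s. ?F (- t + s) \<partial>lborel) \<partial>lborel)"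
      by (intro nn_integral_cong nn_integral_cmult) measurable
    also have "\<dots> = (\<integral>\<^sup>+t. indicator {0..r} t * (\<integral>\<^sup>+s. ?F s \<partial>lborel) \<partial>lborel)"
      by (subst nn_integral_lborel_translate) auto
    also have "\<dots> = ennreal r * (\<integral>\<^sup>+s. ?F s \<partial>lborel)"
      using r by (simp add: nn_integral_multc)
    also have "\<dots> \<le> ennreal r * ennreal I"
      unfolding I_def using R \<beta> by (intro mult_left_mono nn_integral_riesz_interval) auto
    also have "\<dots> = ennreal (I * r)"
      using I r by (simp add: mult.commute flip: ennreal_mult)
    finally show ?thesis .
  qed
  define J where "J = 2 * R powr (1 - \<gamma> * q) / (1 - \<gamma> * q)"
  have J: "0 \<le> J"
    using \<gamma> by (simp add: J_def)
  define L where "L = k powr (q - 1) * I * J ^ card (Basis - {e})"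
  have L: "0 \<le> L"
    using I J by (simp add: L_def)
  show ?thesis
  proof (rule that)
    show "0 \<le> L powr (1 / q)" "0 < (1 - \<beta>) / p"
      using \<beta> p1 by auto
    fix r :: real assume r: "0 < r" "r \<le> 1"
    define f where "f b s = indicator {-R..R} s * (if b = e then epow (M r s) q else riesz (\<gamma> * q) s)" for b s
    have [measurable]: "f b \<in> borel_measurable borel" for b
      unfolding f_def by measurable
    \<comment> \<open>Interpolation: in the \<open>q\<close>-th power of \<open>M\<close>, the power
      \<open>q - 1\<close> is estimated by the supremum, of order
      \<open>r powr (1 - \<beta>)\<close>, and the remaining factor by the integral, of order
      \<open>r\<close>.\<close>
    have fe: "(\<integral>\<^sup>+s. f e s \<partial>lborel) \<le> ennreal ((k * r powr (1 - \<beta>)) powr (q - 1) * (I * r))"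
    proof -
      have "(\<integral>\<^sup>+s. f e s \<partial>lborel) \<le> (\<integral>\<^sup>+s. ennreal ((k * r powr (1 - \<beta>)) powr (q - 1)) * (indicator {-R..R} s * M r s) \<partial>lborel)"
      proof (intro nn_integral_mono)
        fix s
        have "epow (M r s) q = epow (M r s) (q - 1) * M r s"
          using epow_add[of "q - 1" 1 "M r s"] q1 by simp
        also have "\<dots> \<le> epow (ennreal (k * r powr (1 - \<beta>))) (q - 1) * M r s"
          using q1 M_sup[OF r(1)] by (intro mult_right_mono epow_mono) auto
        also have "epow (ennreal (k * r powr (1 - \<beta>))) (q - 1) = ennreal ((k * r powr (1 - \<beta>)) powr (q - 1))"
          using k by (intro epow_ennreal) simp
        finally show "f e s \<le> ennreal ((k * r powr (1 - \<beta>)) powr (q - 1)) * (indicator {-R..R} s * M r s)"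
          by (auto simp: f_def indicator_def)
      qed
      also have "\<dots> = ennreal ((k * r powr (1 - \<beta>)) powr (q - 1)) * (\<integral>\<^sup>+s. indicator {-R..R} s * M r s \<partial>lborel)"
        by (intro nn_integral_cmult) measurable
      also have "\<dots> \<le> ennreal ((k * r powr (1 - \<beta>)) powr (q - 1)) * ennreal (I * r)"
        using r by (intro mult_left_mono M_int) auto
      finally show ?thesis
        using I r by (simp flip: ennreal_mult)
    qed
    have fb: "(\<integral>\<^sup>+s. f b s \<partial>lborel) \<le> ennreal J" if "b \<noteq> e" for b
      unfolding f_def J_def using that R \<gamma> nn_integral_riesz_interval[of R "\<gamma> * q"] by simp
    have "(\<integral>\<^sup>+z. indicator (cube R) z * epow (seg_riesz e r z) q \<partial>lborel) \<le> (\<integral>\<^sup>+z. (\<Prod>b\<in>Basis. f b (z \<bullet> b)) \<partial>lborel)"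
    proof (intro nn_integral_mono)
      fix z :: 'a
      have "epow (seg_riesz e r z) q \<le> epow (M r (z \<bullet> e) * (\<Prod>b\<in>Basis - {e}. riesz \<gamma> (z \<bullet> b))) q"
        using q1 by (intro epow_mono seg) auto
      also have "\<dots> = epow (M r (z \<bullet> e)) q * (\<Prod>b\<in>Basis - {e}. riesz (\<gamma> * q) (z \<bullet> b))"
        using q1 by (simp add: epow_mult epow_prod epow_riesz)
      also have "\<dots> = (\<Prod>b\<in>Basis. if b = e then epow (M r (z \<bullet> b)) q else riesz (\<gamma> * q) (z \<bullet> b))"
        using e by (simp add: prod.remove[of Basis e])
      finally show "indicator (cube R) z * epow (seg_riesz e r z) q \<le> (\<Prod>b\<in>Basis. f b (z \<bullet> b))"
        unfolding f_def indicator_cube prod.distrib by (intro mult_left_mono) auto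
    qed
    also have "\<dots> = (\<Prod>b\<in>Basis. \<integral>\<^sup>+s. f b s \<partial>lborel)"
      by (rule nn_integral_lborel_prod) auto
    also have "\<dots> = (\<integral>\<^sup>+s. f e s \<partial>lborel) * (\<Prod>b\<in>Basis - {e}. \<integral>\<^sup>+s. f b s \<partial>lborel)"
      using e by (intro prod.remove) auto
    also have "\<dots> \<le> ennreal ((k * r powr (1 - \<beta>)) powr (q - 1) * (I * r)) * (\<Prod>b\<in>Basis - {e}. ennreal J)"
      by (intro mult_mono fe prod_mono_ennreal fb) auto
    also have "\<dots> = ennreal ((k * r powr (1 - \<beta>)) powr (q - 1) * (I * r) * J ^ card (Basis - {e}))"
      using I J r by (simp add: ennreal_power flip: ennreal_mult)
    also have "(k * r powr (1 - \<beta>)) powr (q - 1) * (I * r) * J ^ card (Basis - {e}) = L * r powr ((1 - \<beta>) * (q - 1) + 1)"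
      using k r by (simp add: L_def powr_mult powr_powr powr_add)
    finally have "epow (\<integral>\<^sup>+z. indicator (cube R) z * epow (seg_riesz e r z) q \<partial>lborel) (1 / q) \<le> epow (ennreal (L * r powr ((1 - \<beta>) * (q - 1) + 1))) (1 / q)"
      using q1 by (intro epow_mono) auto
    also have "\<dots> = ennreal ((L * r powr ((1 - \<beta>) * (q - 1) + 1)) powr (1 / q))"
      using L by (intro epow_ennreal) auto
    also have "(L * r powr ((1 - \<beta>) * (q - 1) + 1)) powr (1 / q) = L powr (1 / q) * r powr (((1 - \<beta>) * (q - 1) + 1) * (1 / q))"
      using L by (simp add: powr_mult powr_powr)
    \<comment> \<open>Division by \<open>q\<close> leaves \<open>1 / q\<close> from the integral and
      the gain \<open>(1 - \<beta>) / p\<close>, which is \<open>\<theta>\<close>, from the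
      supremum.\<close>
    also have "((1 - \<beta>) * (q - 1) + 1) * (1 / q) = (1 - \<beta>) * ((q - 1) / q) + 1 / q"
      by (simp add: add_divide_distrib)
    also have "\<dots> = 1 / q + (1 - \<beta>) / p"
      unfolding q1(3) by simp
    finally show "epow (\<integral>\<^sup>+z. indicator (cube R) z * epow (seg_riesz e r z) q \<partial>lborel) (1 / q)
      \<le> ennreal (L powr (1 / q) * r powr (1 / q + (1 - \<beta>) / p))" .
  qed
qed

section \<open>The Gagliardo-Nirenberg-Sobolev inequality\<close>

text \<open>Gagliardo's argument as an induction over the set \<open>I\<close> of coordinates: the number of factors
  (and with it the exponent \<open>w\<close>) is fixed by \<open>K\<close>, and the factors with index in \<open>K - I\<close> are the ones
  whose own coordinate has already been integrated out.\<close>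

lemma nn_integral_PiM_Gagliardo:
  fixes g :: "'i \<Rightarrow> ('i \<Rightarrow> real) \<Rightarrow> ennreal"
  assumes K: "finite K" "2 \<le> card K" and w: "w = 1 / (real (card K) - 1)"
    and I: "I \<subseteq> K"
    and g: "\<And>k. k \<in> K \<Longrightarrow> g k \<in> borel_measurable (PiM I (\<lambda>_. lborel))"
  shows "(\<integral>\<^sup>+x. (\<Prod>k\<in>I. epow (\<integral>\<^sup>+s. g k (x(k := s)) \<partial>lborel) w) * (\<Prod>k\<in>K - I. epow (g k x) w) \<partial>PiM I (\<lambda>_. lborel))
    \<le> (\<Prod>k\<in>K. epow (\<integral>\<^sup>+x. g k x \<partial>PiM I (\<lambda>_. lborel)) w)"
  using finite_subset[OF I K(1)] I g
proof (induction I arbitrary: g rule: finite_induct)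
  case empty
  interpret product_sigma_finite "\<lambda>_. lborel :: real measure" ..
  show ?case
    by (simp add: PiM_empty nn_integral_count_space_finite)
next
  case (insert j I)
  interpret product_sigma_finite "\<lambda>_. lborel :: real measure" ..
  let ?L = "\<lambda>_. lborel :: real measure"
  have j: "j \<in> K" "I \<subseteq> K" "K - I = insert j (K - insert j I)"
    using insert by auto
  have fin: "finite (K - insert j I)"
    using K by auto
  note [measurable] = insert.prems(2)
  have add_dim: "(\<lambda>(x, s). x(j := s)) \<in> PiM I ?L \<Otimes>\<^sub>M lborel \<rightarrow>\<^sub>M PiM (insert j I) ?L"
    by (rule measurable_add_dim)
  have upd [measurable]: "(\<lambda>(x, s). x(k := s)) \<in> PiM I ?L \<Otimes>\<^sub>M lborel \<rightarrow>\<^sub>M PiM I ?L" if "k \<in> I" for k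
    using measurable_add_dim[of k I ?L] that by (simp add: insert_absorb)
  have upd': "(\<lambda>(x, s). x(k := s)) \<in> PiM (insert j I) ?L \<Otimes>\<^sub>M lborel \<rightarrow>\<^sub>M PiM (insert j I) ?L" if "k \<in> I" for k
    using measurable_add_dim[of k "insert j I" ?L] that by (simp add: insert_absorb)
  \<comment> \<open>The family for the induction hypothesis: coordinate \<open>j\<close> is
    integrated out of every member.\<close>
  define h where "h k x = (\<integral>\<^sup>+s. g k (x(j := s)) \<partial>lborel)" for k x
  have gj: "(\<lambda>(x, s). g k (x(j := s))) \<in> borel_measurable (PiM I ?L \<Otimes>\<^sub>M lborel)" if "k \<in> K" for k
    using measurable_compose[OF add_dim insert.prems(2)[OF that]] by (simp add: case_prod_beta' fun_upd_def)
  have h [measurable]: "h k \<in> borel_measurable (PiM I ?L)" if "k \<in> K" for k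
    unfolding h_def by (rule lborel.borel_measurable_nn_integral[OF gj[OF that]])
  have T: "(\<lambda>x. \<integral>\<^sup>+s. g k (x(k := s)) \<partial>lborel) \<in> borel_measurable (PiM (insert j I) ?L)" if "k \<in> I" for k
  proof -
    have "k \<in> K" using that j by auto
    have "(\<lambda>(x, s). g k (x(k := s))) \<in> borel_measurable (PiM (insert j I) ?L \<Otimes>\<^sub>M lborel)"
      using measurable_compose[OF upd'[OF that] insert.prems(2)[OF \<open>k \<in> K\<close>]] by (simp add: case_prod_beta' fun_upd_def)
    then show ?thesis
      by (rule lborel.borel_measurable_nn_integral)
  qed
  have Tj: "(\<lambda>x. \<integral>\<^sup>+s. g j (x(j := s)) \<partial>lborel) \<in> borel_measurable (PiM (insert j I) ?L)"
  proof -
    have "(\<lambda>(x, s). x(j := s)) \<in> PiM (insert j I) ?L \<Otimes>\<^sub>M lborel \<rightarrow>\<^sub>M PiM (insert j I) ?L"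
      using measurable_add_dim[of j "insert j I" ?L] by simp
    from measurable_compose[OF this insert.prems(2)[OF j(1)]]
    have "(\<lambda>(x, s). g j (x(j := s))) \<in> borel_measurable (PiM (insert j I) ?L \<Otimes>\<^sub>M lborel)"
      by (simp add: case_prod_beta' fun_upd_def)
    then show ?thesis
      by (rule lborel.borel_measurable_nn_integral)
  qed
  \<comment> \<open>For \<open>k \<noteq> j\<close>, the base of the \<open>k\<close>-th factor in
    the integrand for \<open>insert j I\<close>.\<close>
  define G where "G k x = (if k \<in> I then \<integral>\<^sup>+s. g k (x(k := s)) \<partial>lborel else g k x)" for k x
  have G: "G k \<in> borel_measurable (PiM (insert j I) ?L)" if "k \<in> K" for k
    using T[of k] insert.prems(2)[OF that] unfolding G_def by (cases "k \<in> I") auto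
  have Gj: "(\<lambda>s. G k (x(j := s))) \<in> borel_measurable lborel" if "k \<in> K" "x \<in> space (PiM I ?L)" for k x
  proof -
    have "(\<lambda>(x, s). G k (x(j := s))) \<in> borel_measurable (PiM I ?L \<Otimes>\<^sub>M lborel)"
      using measurable_compose[OF add_dim G[OF that(1)]] by (simp add: case_prod_beta' fun_upd_def)
    from measurable_Pair2[OF this that(2)] show ?thesis
      by simp
  qed
  have Gint: "(\<integral>\<^sup>+s. G k (x(j := s)) \<partial>lborel) = (if k \<in> I then \<integral>\<^sup>+s. h k (x(k := s)) \<partial>lborel else h k x)"
    if "k \<in> K" "x \<in> space (PiM I ?L)" for k x
  proof (cases "k \<in> I")
    case True
    then have kj: "k \<noteq> j" using insert by auto
    have m: "(\<lambda>(t, s). g k ((x(k := t))(j := s))) \<in> borel_measurable (lborel \<Otimes>\<^sub>M lborel)"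
    proof -
      have "(\<lambda>t. x(k := t)) \<in> lborel \<rightarrow>\<^sub>M PiM I ?L"
        using measurable_Pair2[OF upd[OF True] that(2)] by simp
      then have "(\<lambda>(t, s). (x(k := t), s)) \<in> lborel \<Otimes>\<^sub>M lborel \<rightarrow>\<^sub>M PiM I ?L \<Otimes>\<^sub>M lborel"
        by measurable
      from measurable_compose[OF this gj[OF that(1)]]
      have "(\<lambda>p. (\<lambda>(x, s). g k (x(j := s))) ((\<lambda>(t, s). (x(k := t), s)) p)) \<in> borel_measurable (lborel \<Otimes>\<^sub>M lborel)" .
      also have "(\<lambda>p. (\<lambda>(x, s). g k (x(j := s))) ((\<lambda>(t, s). (x(k := t), s)) p)) = (\<lambda>(t, s). g k ((x(k := t))(j := s)))"
        by auto
      finally show ?thesis .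
    qed
    have "(\<integral>\<^sup>+s. G k (x(j := s)) \<partial>lborel) = (\<integral>\<^sup>+s. \<integral>\<^sup>+t. g k ((x(k := t))(j := s)) \<partial>lborel \<partial>lborel)"
      using True kj by (simp add: G_def fun_upd_twist)
    also have "\<dots> = (\<integral>\<^sup>+t. \<integral>\<^sup>+s. g k ((x(k := t))(j := s)) \<partial>lborel \<partial>lborel)"
      by (rule nn_integral_lborel_swap[OF m])
    finally show ?thesis
      using True by (simp add: h_def)
  qed (simp add: G_def h_def)
  have cK: "0 < real (card K) - 1" and w0: "0 < w"
    using K w by auto
  have F_eq: "(\<Prod>k\<in>insert j I. epow (\<integral>\<^sup>+s. g k (x(k := s)) \<partial>lborel) w) * (\<Prod>k\<in>K - insert j I. epow (g k x) w)
      = epow (\<integral>\<^sup>+s. g j (x(j := s)) \<partial>lborel) w * (\<Prod>k\<in>K - {j}. epow (G k x) w)" for x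
  proof -
    have "K - {j} = I \<union> (K - insert j I)"
      using j(1,2) insert.hyps(2) by blast
    then have "(\<Prod>k\<in>K - {j}. epow (G k x) w) = (\<Prod>k\<in>I. epow (G k x) w) * (\<Prod>k\<in>K - insert j I. epow (G k x) w)"
      using insert.hyps fin by (simp only:) (rule prod.union_disjoint, auto)
    also have "\<dots> = (\<Prod>k\<in>I. epow (\<integral>\<^sup>+s. g k (x(k := s)) \<partial>lborel) w) * (\<Prod>k\<in>K - insert j I. epow (g k x) w)"
      by (simp add: G_def)
    finally show ?thesis
      using insert by (simp add: mult.assoc)
  qed
  have "(\<integral>\<^sup>+x. (\<Prod>k\<in>insert j I. epow (\<integral>\<^sup>+s. g k (x(k := s)) \<partial>lborel) w) * (\<Prod>k\<in>K - insert j I. epow (g k x) w) \<partial>PiM (insert j I) ?L)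
     = (\<integral>\<^sup>+x. epow (\<integral>\<^sup>+s. g j (x(j := s)) \<partial>lborel) w * (\<Prod>k\<in>K - {j}. epow (G k x) w) \<partial>PiM (insert j I) ?L)"
    unfolding F_eq ..
  also have "\<dots> = (\<integral>\<^sup>+x. (\<integral>\<^sup>+t. epow (h j x) w * (\<Prod>k\<in>K - {j}. epow (G k (x(j := t))) w) \<partial>lborel) \<partial>PiM I ?L)"
  proof (subst product_nn_integral_insert)
    show "(\<lambda>x. epow (\<integral>\<^sup>+s. g j (x(j := s)) \<partial>lborel) w * (\<Prod>k\<in>K - {j}. epow (G k x) w)) \<in> borel_measurable (PiM (insert j I) ?L)"
      using Tj G by (intro borel_measurable_times_ennreal borel_measurable_prod_ennreal measurable_epow) auto
  qed (use insert in \<open>simp_all add: h_def\<close>)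
  also have "\<dots> \<le> (\<integral>\<^sup>+x. (\<Prod>k\<in>I. epow (\<integral>\<^sup>+s. h k (x(k := s)) \<partial>lborel) w) * (\<Prod>k\<in>K - I. epow (h k x) w) \<partial>PiM I ?L)"
  proof (intro nn_integral_mono)
    fix x assume x: "x \<in> space (PiM I ?L)"
    have "(\<integral>\<^sup>+t. epow (h j x) w * (\<Prod>k\<in>K - {j}. epow (G k (x(j := t))) w) \<partial>lborel)
        = epow (h j x) w * (\<integral>\<^sup>+t. (\<Prod>k\<in>K - {j}. epow (G k (x(j := t))) w) \<partial>lborel)"
      using Gj x by (intro nn_integral_cmult borel_measurable_prod_ennreal measurable_epow) auto
    \<comment> \<open>The factor with index \<open>j\<close> does not depend on coordinate
      \<open>j\<close> and has been taken out of the integral. This leaves \<open>card K - 1\<close>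
      factors whose exponents \<open>w\<close> add up to 1.\<close>
    also have "\<dots> \<le> epow (h j x) w * (\<Prod>k\<in>K - {j}. epow (\<integral>\<^sup>+t. G k (x(j := t)) \<partial>lborel) w)"
    proof (intro mult_left_mono Holder_nn_integral_prod)
      show "(\<Sum>k\<in>K - {j}. w) = 1"
        using j K cK by (simp add: w of_nat_diff)
    qed (use K w0 Gj x in auto)
    also have "\<dots> = (\<Prod>k\<in>I. epow (\<integral>\<^sup>+s. h k (x(k := s)) \<partial>lborel) w) * (\<Prod>k\<in>K - I. epow (h k x) w)"
    proof -
      have eq: "K - {j} = I \<union> (K - insert j I)"
        using j(1,2) insert.hyps(2) by blast
      have "(\<Prod>k\<in>K - {j}. epow (\<integral>\<^sup>+t. G k (x(j := t)) \<partial>lborel) w)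
        = (\<Prod>k\<in>K - {j}. epow (if k \<in> I then \<integral>\<^sup>+s. h k (x(k := s)) \<partial>lborel else h k x) w)"
        using Gint[OF _ x] by (intro prod.cong) auto
      also have "\<dots> = (\<Prod>k\<in>I. epow (\<integral>\<^sup>+s. h k (x(k := s)) \<partial>lborel) w) * (\<Prod>k\<in>K - insert j I. epow (h k x) w)"
        unfolding eq using insert.hyps fin by (subst prod.union_disjoint) auto
      finally show ?thesis
        unfolding j(3) using fin by (simp add: mult_ac)
    qed
    finally show "(\<integral>\<^sup>+t. epow (h j x) w * (\<Prod>k\<in>K - {j}. epow (G k (x(j := t))) w) \<partial>lborel)
      \<le> (\<Prod>k\<in>I. epow (\<integral>\<^sup>+s. h k (x(k := s)) \<partial>lborel) w) * (\<Prod>k\<in>K - I. epow (h k x) w)" .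
  qed
  also have "\<dots> \<le> (\<Prod>k\<in>K. epow (\<integral>\<^sup>+x. h k x \<partial>PiM I ?L) w)"
    by (rule insert.IH) (use j h in auto)
  also have "\<dots> = (\<Prod>k\<in>K. epow (\<integral>\<^sup>+x. g k x \<partial>PiM (insert j I) ?L) w)"
    using insert by (intro prod.cong refl) (simp add: product_nn_integral_insert h_def)
  finally show ?case .
qed

text \<open>The preceding induction with the whole basis as index set and the same function for
  every index, carried over from the product space; moving along the line in direction
  \<open>b\<close> is varying coordinate \<open>b\<close>.\<close>

lemma nn_integral_lborel_Gagliardo:
  fixes g :: "'a::euclidean_space \<Rightarrow> ennreal"
  assumes N: "2 \<le> DIM('a)" and [measurable]: "g \<in> borel_measurable borel"
  shows "(\<integral>\<^sup>+x. (\<Prod>b\<in>Basis. epow (\<integral>\<^sup>+s. g (x + s *\<^sub>R b) \<partial>lborel) (1 / (real DIM('a) - 1))) \<partial>lborel)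
    \<le> epow (\<integral>\<^sup>+x. g x \<partial>lborel) (real DIM('a) / (real DIM('a) - 1))"
proof -
  let ?P = "PiM (Basis :: 'a set) (\<lambda>_. lborel :: real measure)"
  let ?w = "1 / (real DIM('a) - 1)"
  define \<iota> where "\<iota> f = (\<Sum>b\<in>Basis. f b *\<^sub>R b)" for f :: "'a \<Rightarrow> real"
  have lb: "lborel = distr ?P borel \<iota>"
    unfolding \<iota>_def by (rule lborel_eq)
  have \<iota> [measurable]: "\<iota> \<in> ?P \<rightarrow>\<^sub>M borel"
    unfolding \<iota>_def by measurable
  have tr: "(\<integral>\<^sup>+x. F x \<partial>lborel) = (\<integral>\<^sup>+f. F (\<iota> f) \<partial>?P)" if "F \<in> borel_measurable borel" for F
    using that by (subst lb) (simp add: nn_integral_distr)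
  have m: "(\<lambda>x. \<Prod>b\<in>Basis. epow (\<integral>\<^sup>+s. g (x + s *\<^sub>R b) \<partial>lborel) ?w) \<in> borel_measurable borel"
  proof -
    have "(\<lambda>x. \<Prod>b\<in>Basis. epow (\<integral>\<^sup>+s. g (x + s *\<^sub>R b) \<partial>lborel) ?w) \<in> borel_measurable lborel"
      by measurable
    then show ?thesis by simp
  qed
  have line: "(\<integral>\<^sup>+s. g (\<iota> f + s *\<^sub>R b) \<partial>lborel) = (\<integral>\<^sup>+s. g (\<iota> (f(b := s))) \<partial>lborel)" if b: "b \<in> Basis" for f b
  proof -
    have "\<iota> (f(b := s)) = \<iota> f + (- f b + s) *\<^sub>R b" for s
      unfolding \<iota>_def using b by (simp add: sum.remove[of Basis b] algebra_simps)
    then show ?thesis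
      using nn_integral_lborel_translate[of "\<lambda>s. g (\<iota> f + s *\<^sub>R b)" "- f b"] by simp
  qed
  have "(\<integral>\<^sup>+x. (\<Prod>b\<in>Basis. epow (\<integral>\<^sup>+s. g (x + s *\<^sub>R b) \<partial>lborel) ?w) \<partial>lborel)
    = (\<integral>\<^sup>+f. (\<Prod>b\<in>Basis. epow (\<integral>\<^sup>+s. g (\<iota> f + s *\<^sub>R b) \<partial>lborel) ?w) \<partial>?P)"
    by (rule tr[OF m])
  also have "\<dots> = (\<integral>\<^sup>+f. (\<Prod>b\<in>Basis. epow (\<integral>\<^sup>+s. g (\<iota> (f(b := s))) \<partial>lborel) ?w) * (\<Prod>b\<in>(Basis::'a set) - Basis. epow (g (\<iota> f)) ?w) \<partial>?P)"
    using line by simp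
  also have "\<dots> \<le> (\<Prod>b\<in>(Basis::'a set). epow (\<integral>\<^sup>+f. g (\<iota> f) \<partial>?P) ?w)"
    by (rule nn_integral_PiM_Gagliardo[where g="\<lambda>_ f. g (\<iota> f)"]) (use N in auto)
  also have "(\<integral>\<^sup>+f. g (\<iota> f) \<partial>?P) = (\<integral>\<^sup>+x. g x \<partial>lborel)"
    by (rule tr[symmetric]) measurable
  also have "(\<Prod>b\<in>(Basis::'a set). epow (\<integral>\<^sup>+x. g x \<partial>lborel) ?w) = epow (\<integral>\<^sup>+x. g x \<partial>lborel) (real DIM('a) / (real DIM('a) - 1))"
  proof (cases "\<integral>\<^sup>+x. g x \<partial>lborel")
    case (real r)
    then show ?thesis
      using N by (cases "r = 0") (auto simp: epow_ennreal prod_constant ennreal_power powr_realpow[symmetric] powr_powr power_0_left)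
  next
    case top
    then show ?thesis
      using N by (auto simp: prod_constant power_eq_top_ennreal)
  qed
  finally show ?thesis .
qed

text \<open>For \<open>\<gamma> > 1\<close> the difference quotient at 0 has modulus
  \<open>\<bar>h\<bar> powr (\<gamma> - 1)\<close>, which tends to 0, so the kink of the modulus
  disappears.\<close>

lemma has_real_derivative_abs_powr:
  fixes s :: real
  assumes "1 < \<gamma>"
  shows "((\<lambda>s. \<bar>s\<bar> powr \<gamma>) has_real_derivative (\<gamma> * \<bar>s\<bar> powr (\<gamma> - 1) * sgn s)) (at s)"
proof (cases s "0::real" rule: linorder_cases)
  case less
  have "((\<lambda>s. (- s) powr \<gamma>) has_real_derivative (\<gamma> * (- s) powr (\<gamma> - 1) * (- 1))) (at s)"
    using less by (auto intro!: derivative_eq_intros)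
  then have "((\<lambda>s. \<bar>s\<bar> powr \<gamma>) has_real_derivative (\<gamma> * (- s) powr (\<gamma> - 1) * (- 1))) (at s)"
    by (rule has_field_derivative_transform_within_open[where S="{..<0}"]) (use less in auto)
  then show ?thesis
    using less by simp
next
  case greater
  have "((\<lambda>s. s powr \<gamma>) has_real_derivative (\<gamma> * s powr (\<gamma> - 1))) (at s)"
    using greater by (rule has_real_derivative_powr)
  then have "((\<lambda>s. \<bar>s\<bar> powr \<gamma>) has_real_derivative (\<gamma> * s powr (\<gamma> - 1))) (at s)"
    by (rule has_field_derivative_transform_within_open[where S="{0<..}"]) (use greater in auto)
  then show ?thesis
    using greater by simp
next
  case equal
  have "((\<lambda>h::real. \<bar>h\<bar> powr (\<gamma> - 1)) \<longlongrightarrow> 0) (at 0)"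
  proof -
    have "continuous_on UNIV (\<lambda>h::real. \<bar>h\<bar> powr (\<gamma> - 1))"
      using assms by (intro continuous_on_powr' continuous_on_rabs continuous_on_id continuous_on_const) auto
    then have "isCont (\<lambda>h::real. \<bar>h\<bar> powr (\<gamma> - 1)) 0"
      by (simp add: continuous_on_eq_continuous_at)
    then show ?thesis
      using assms by (simp add: isCont_def)
  qed
  then have "((\<lambda>h::real. \<bar>h\<bar> powr \<gamma> / h) \<longlongrightarrow> 0) (at 0)"
  proof (rule Lim_null_comparison[rotated])
    show "\<forall>\<^sub>F h::real in at 0. norm (\<bar>h\<bar> powr \<gamma> / h) \<le> \<bar>h\<bar> powr (\<gamma> - 1)"
      by (auto simp: eventually_at_filter powr_diff abs_mult)
  qed
  then show ?thesis
    using equal by (simp add: has_field_derivative_iff)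
qed

text \<open>The ray estimate for the power of the modulus. Passing to the full line makes the bound
  independent of coordinate \<open>b\<close> of \<open>x\<close>, as Gagliardo's argument
  requires.\<close>

lemma test_fun_abs_powr_le_line_integral:
  fixes w :: "'a::euclidean_space \<Rightarrow> real"
  assumes w: "test_fun U w" and \<gamma>: "1 < \<gamma>" and b: "b \<in> Basis"
  shows "ennreal (\<bar>w x\<bar> powr \<gamma>)
    \<le> (\<integral>\<^sup>+s. ennreal (\<gamma> * \<bar>w (x + s *\<^sub>R b)\<bar> powr (\<gamma> - 1) * norm (grad w (x + s *\<^sub>R b))) \<partial>lborel)"
proof -
  define G where "G y = (\<gamma> * \<bar>w y\<bar> powr (\<gamma> - 1) * sgn (w y)) *\<^sub>R grad w y" for y
  have nG: "norm (G y) = \<gamma> * \<bar>w y\<bar> powr (\<gamma> - 1) * norm (grad w y)" for y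
    using \<gamma> by (cases "w y = 0") (auto simp: G_def abs_mult abs_sgn_eq)
  have "ennreal \<bar>\<bar>w x\<bar> powr \<gamma>\<bar> \<le> (\<integral>\<^sup>+t. indicator {0<..} t * ennreal (norm (G (x + t *\<^sub>R b)) * norm b) \<partial>lborel)"
  proof (rule le_ray_integral)
    fix y
    have "((\<lambda>s. \<bar>s\<bar> powr \<gamma>) has_derivative (\<lambda>h. (\<gamma> * \<bar>w y\<bar> powr (\<gamma> - 1) * sgn (w y)) * h)) (at (w y))"
      using has_real_derivative_abs_powr[OF \<gamma>, of "w y"] by (simp add: has_field_derivative_def)
    from has_derivative_compose[OF test_fun_has_derivative[OF w] this]
    show "((\<lambda>y. \<bar>w y\<bar> powr \<gamma>) has_derivative (\<lambda>v. G y \<bullet> v)) (at y)"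
      by (simp add: G_def mult.assoc)
  next
    have "continuous_on UNIV (\<lambda>y. \<bar>w y\<bar> powr (\<gamma> - 1))"
      using \<gamma> by (intro continuous_on_powr' continuous_on_rabs test_fun_continuous[OF w] continuous_on_const) auto
    then show "continuous_on UNIV (\<lambda>y. norm (G y))"
      unfolding nG by (intro continuous_on_mult continuous_on_const continuous_on_norm test_fun_grad_continuous[OF w])
  next
    show "bounded {y. \<bar>w y\<bar> powr \<gamma> \<noteq> 0}"
      using test_fun_bounded_support[OF w] by simp
  qed (use b in auto)
  also have "\<dots> \<le> (\<integral>\<^sup>+s. ennreal (norm (G (x + s *\<^sub>R b))) \<partial>lborel)"
    using b by (intro nn_integral_mono) (auto simp: indicator_def)
  finally show ?thesis
    by (simp add: nG)
qed

abbreviation Dp :: "real \<Rightarrow> ('a::euclidean_space \<Rightarrow> real) \<Rightarrow> ennreal" where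
  "Dp p \<phi> \<equiv> \<integral>\<^sup>+x. ennreal (norm (grad \<phi> x) powr p) \<partial>lborel"

text \<open>Finiteness is what permits cancelling a power of one side against the other in the
  Sobolev inequality.\<close>

lemma test_fun_abs_powr_integral_finite:
  fixes \<phi> :: "'a::euclidean_space \<Rightarrow> real"
  assumes "test_fun U \<phi>" "0 < s"
  shows "(\<integral>\<^sup>+x. ennreal (\<bar>\<phi> x\<bar> powr s) \<partial>lborel) < \<infinity>" "Dp s \<phi> < \<infinity>"
proof -
  obtain B where B: "\<And>x. \<bar>\<phi> x\<bar> \<le> B" "\<And>x. norm (grad \<phi> x) \<le> B"
    using test_fun_bounded[OF assms(1)] by metis
  define K where "K = closure {x. \<phi> x \<noteq> 0}"
  have "test_fun K \<phi>"
    using assms by (simp add: test_fun_def K_def)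
  then have z: "x \<notin> K \<Longrightarrow> \<phi> x = 0" "x \<notin> K \<Longrightarrow> grad \<phi> x = 0" for x
    using test_fun_eq_0 test_fun_grad_eq_0 by blast+
  have K: "compact K"
    using assms by (simp add: test_fun_def K_def)
  then have fin: "(\<integral>\<^sup>+x. ennreal (B powr s) * indicator K x \<partial>lborel) < \<infinity>"
    using emeasure_bounded_finite[OF compact_imp_bounded[OF K]]
    by (simp add: nn_integral_cmult_indicator compact_imp_closed borel_closed ennreal_mult_less_top)
  have "(\<integral>\<^sup>+x. ennreal (\<bar>\<phi> x\<bar> powr s) \<partial>lborel) \<le> (\<integral>\<^sup>+x. ennreal (B powr s) * indicator K x \<partial>lborel)"
    using z B assms(2) by (intro nn_integral_mono) (auto simp: indicator_def intro!: ennreal_leI powr_mono2)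
  with fin show "(\<integral>\<^sup>+x. ennreal (\<bar>\<phi> x\<bar> powr s) \<partial>lborel) < \<infinity>"
    by (rule order_le_less_trans[rotated])
  have "Dp s \<phi> \<le> (\<integral>\<^sup>+x. ennreal (B powr s) * indicator K x \<partial>lborel)"
    using z B assms(2) by (intro nn_integral_mono) (auto simp: indicator_def intro!: ennreal_leI powr_mono2)
  with fin show "Dp s \<phi> < \<infinity>"
    by (rule order_le_less_trans[rotated])
qed

text \<open>The power \<open>\<gamma>\<close> is chosen so that both
  \<open>\<gamma> * (n / (n - 1))\<close> and, after Hoelder, \<open>(\<gamma> - 1) * q\<close>
  equal \<open>r\<close>. The same integral \<open>A\<close> then stands on both sides of
  Gagliardo's inequality, and its lower power on the right is absorbed.\<close>

lemma Gagliardo_Nirenberg_Sobolev: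
  fixes \<phi> :: "'a::euclidean_space \<Rightarrow> real"
  assumes \<phi>: "test_fun U \<phi>" and N: "2 \<le> DIM('a)" and p: "1 < p" "p < real DIM('a)"
    and r: "1 / r = 1 / p - 1 / real DIM('a)"
  shows "epow (\<integral>\<^sup>+x. ennreal (\<bar>\<phi> x\<bar> powr r) \<partial>lborel) (1 / r)
    \<le> ennreal (p * (real DIM('a) - 1) / (real DIM('a) - p)) * epow (Dp p \<phi>) (1 / p)"
proof -
  define n where "n = real DIM('a)"
  have n: "2 \<le> n" "p < n"
    using N p by (auto simp: n_def)
  have "0 < 1 / p - 1 / n"
    using n p by (auto simp: field_simps)
  then have r0: "0 < r"
    using r unfolding n_def[symmetric] by (metis zero_less_divide_1_iff)
  have r': "r = n * p / (n - p)"
  proof -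
    have "1 / r = (n - p) / (n * p)"
      using r n p unfolding n_def[symmetric] by (auto simp: field_simps)
    then have "r = 1 / ((n - p) / (n * p))"
      using r0 by (metis divide_divide_eq_right div_by_1 mult_1)
    then show ?thesis by simp
  qed
  define \<gamma> where "\<gamma> = p * (n - 1) / (n - p)"
  have "n < p * n"
    using n p by simp
  then have \<gamma>: "1 < \<gamma>"
    using n p by (simp add: \<gamma>_def field_simps)
  define q where "q = p / (p - 1)"
  have q: "1 / p + 1 / q = 1" "0 < q"
    using p by (auto simp: q_def field_simps)
  have gq: "(\<gamma> - 1) * q = r"
  proof -
    have "\<gamma> - 1 = n * (p - 1) / (n - p)"
      using n by (simp add: \<gamma>_def field_simps)
    then show ?thesis
      using p by (simp add: q_def r')
  qed
  have gn: "\<gamma> * (n / (n - 1)) = r"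
  proof -
    have "n - 1 \<noteq> 0" "n - p \<noteq> 0"
      using n by auto
    then show ?thesis
      by (simp add: \<gamma>_def r')
  qed
  have [measurable]: "\<phi> \<in> borel_measurable borel" "grad \<phi> \<in> borel_measurable borel"
    using \<phi> test_fun_measurable test_fun_grad_measurable by blast+
  define g where "g y = ennreal (\<gamma> * \<bar>\<phi> y\<bar> powr (\<gamma> - 1) * norm (grad \<phi> y))" for y
  have [measurable]: "g \<in> borel_measurable borel"
    unfolding g_def by measurable
  define A where "A = enn2real (\<integral>\<^sup>+x. ennreal (\<bar>\<phi> x\<bar> powr r) \<partial>lborel)"
  have A: "(\<integral>\<^sup>+x. ennreal (\<bar>\<phi> x\<bar> powr r) \<partial>lborel) = ennreal A" "0 \<le> A"
    using test_fun_abs_powr_integral_finite(1)[OF \<phi> r0] unfolding A_def by (auto simp: less_top)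
  define D where "D = enn2real (Dp p \<phi>)"
  have D: "Dp p \<phi> = ennreal D" "0 \<le> D"
    using test_fun_abs_powr_integral_finite(2)[OF \<phi>, of p] p unfolding D_def by (auto simp: less_top)
  have "ennreal A \<le> (\<integral>\<^sup>+x. (\<Prod>b\<in>Basis. epow (\<integral>\<^sup>+s. g (x + s *\<^sub>R b) \<partial>lborel) (1 / (real DIM('a) - 1))) \<partial>lborel)"
    unfolding A(1)[symmetric]
  proof (intro nn_integral_mono)
    fix x
    have "ennreal (\<bar>\<phi> x\<bar> powr r) = (\<Prod>b\<in>(Basis::'a set). epow (ennreal (\<bar>\<phi> x\<bar> powr \<gamma>)) (1 / (n - 1)))"
      using n unfolding gn[symmetric]
      by (cases "\<phi> x = 0") (auto simp: epow_ennreal powr_powr ennreal_power powr_realpow[symmetric] n_def power_0_left)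
    also have "\<dots> \<le> (\<Prod>b\<in>Basis. epow (\<integral>\<^sup>+s. g (x + s *\<^sub>R b) \<partial>lborel) (1 / (n - 1)))"
      unfolding g_def using n
      by (intro prod_mono_ennreal epow_mono test_fun_abs_powr_le_line_integral[OF \<phi> \<gamma>]) auto
    finally show "ennreal (\<bar>\<phi> x\<bar> powr r) \<le> (\<Prod>b\<in>Basis. epow (\<integral>\<^sup>+s. g (x + s *\<^sub>R b) \<partial>lborel) (1 / (real DIM('a) - 1)))"
      by (simp add: n_def)
  qed
  also have "\<dots> \<le> epow (\<integral>\<^sup>+x. g x \<partial>lborel) (n / (n - 1))"
    unfolding n_def using N by (intro nn_integral_lborel_Gagliardo) measurable
  also have "\<dots> \<le> epow (ennreal (\<gamma> * (A powr (1 / q) * D powr (1 / p)))) (n / (n - 1))"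
  proof (intro epow_mono)
    have "(\<integral>\<^sup>+x. g x \<partial>lborel) = ennreal \<gamma> * (\<integral>\<^sup>+x. ennreal (norm (grad \<phi> x)) * ennreal (\<bar>\<phi> x\<bar> powr (\<gamma> - 1)) \<partial>lborel)"
      unfolding g_def using \<gamma> by (subst nn_integral_cmult[symmetric]) (auto simp: ennreal_mult' mult_ac)
    also have "\<dots> \<le> ennreal \<gamma> * (epow (\<integral>\<^sup>+x. epow (ennreal (norm (grad \<phi> x))) p \<partial>lborel) (1 / p)
        * epow (\<integral>\<^sup>+x. epow (ennreal (\<bar>\<phi> x\<bar> powr (\<gamma> - 1))) q \<partial>lborel) (1 / q))"
      using p q by (intro mult_left_mono Holder_nn_integral) auto
    also have "\<dots> = ennreal \<gamma> * (epow (ennreal D) (1 / p) * epow (ennreal A) (1 / q))"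
      by (simp add: epow_ennreal powr_powr gq A D)
    also have "\<dots> = ennreal (\<gamma> * (A powr (1 / q) * D powr (1 / p)))"
      using A D \<gamma> by (simp add: epow_ennreal mult.commute flip: ennreal_mult)
    finally show "(\<integral>\<^sup>+x. g x \<partial>lborel) \<le> ennreal (\<gamma> * (A powr (1 / q) * D powr (1 / p)))" .
  qed (use n in auto)
  also have "\<dots> = ennreal ((\<gamma> * (A powr (1 / q) * D powr (1 / p))) powr (n / (n - 1)))"
    using \<gamma> by (intro epow_ennreal) auto
  finally have main: "A \<le> (\<gamma> * (A powr (1 / q) * D powr (1 / p))) powr (n / (n - 1))"
    by (simp add: ennreal_le_iff)
  have "A powr (1 / r) \<le> \<gamma> * D powr (1 / p)"
  proof (cases "A = 0")
    case False
    then have A0: "0 < A"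
      using A by simp
    have "A powr ((n - 1) / n) \<le> ((\<gamma> * (A powr (1 / q) * D powr (1 / p))) powr (n / (n - 1))) powr ((n - 1) / n)"
      using main n A by (intro powr_mono2) auto
    also have "\<dots> = \<gamma> * D powr (1 / p) * A powr (1 / q)"
      using n \<gamma> by (simp add: powr_powr mult_ac)
    finally have "A powr ((n - 1) / n) * A powr (- (1 / q)) \<le> \<gamma> * D powr (1 / p) * A powr (1 / q) * A powr (- (1 / q))"
      by (rule mult_right_mono) simp
    also have "\<dots> = \<gamma> * D powr (1 / p)"
      using A0 by (simp add: mult.assoc flip: powr_add)
    also have "A powr ((n - 1) / n) * A powr (- (1 / q)) = A powr (1 / r)"
    proof -
      have "(n - 1) / n + - (1 / q) = 1 / r"
        using q(1) r n unfolding n_def[symmetric] by (simp add: diff_divide_distrib)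
      then show ?thesis
        using A0 by (simp flip: powr_add)
    qed
    finally show ?thesis .
  qed (use \<gamma> in simp)
  then have "ennreal (A powr (1 / r)) \<le> ennreal \<gamma> * ennreal (D powr (1 / p))"
    using \<gamma> by (subst ennreal_mult'[symmetric]) (auto intro: ennreal_leI)
  then show ?thesis
    unfolding n_def[symmetric] \<gamma>_def[symmetric] A(1) D(1) using A D by (simp add: epow_ennreal)
qed

text \<open>Hoelder against the indicator of the cube. It lowers the exponent below the dimension in
  the critical case, and later bounds the integral of the gradient norm itself.\<close>

lemma Dp_le_Dp_cube:
  fixes \<phi> :: "'a::euclidean_space \<Rightarrow> real"
  assumes \<phi>: "test_fun (cube R) \<phi>" and s: "0 < s" "s < p"
  shows "epow (Dp s \<phi>) (1 / s) \<le> epow (emeasure lborel (cube R :: 'a set)) ((1 / s) - (1 / p)) * epow (Dp p \<phi>) (1 / p)"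
proof -
  have [measurable]: "grad \<phi> \<in> borel_measurable borel"
    using \<phi> by (rule test_fun_grad_measurable)
  define a where "a = p / s"
  define a' where "a' = p / (p - s)"
  have a: "1 < a" "1 / a + 1 / a' = 1" "0 < a'"
    using s by (auto simp: a_def a'_def field_simps)
  have "Dp s \<phi> = (\<integral>\<^sup>+x. ennreal (norm (grad \<phi> x) powr s) * indicator (cube R) x \<partial>lborel)"
    using test_fun_grad_eq_0[OF \<phi>] by (intro nn_integral_cong) (auto simp: indicator_def)
  also have "\<dots> \<le> epow (\<integral>\<^sup>+x. epow (ennreal (norm (grad \<phi> x) powr s)) a \<partial>lborel) (1 / a)
      * epow (\<integral>\<^sup>+x. epow (indicator (cube R :: 'a set) x) a' \<partial>lborel) (1 / a')"
    using a by (intro Holder_nn_integral) auto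
  also have "(\<integral>\<^sup>+x. epow (ennreal (norm (grad \<phi> x) powr s)) a \<partial>lborel) = Dp p \<phi>"
    using s by (simp add: epow_ennreal powr_powr a_def)
  also have "(\<lambda>x. epow (indicator (cube R) x) a') = (indicator (cube R) :: 'a \<Rightarrow> ennreal)"
    using epow_ennreal[of 1 a'] by (auto simp: indicator_def fun_eq_iff)
  finally have "epow (Dp s \<phi>) (1 / s)
      \<le> epow (epow (Dp p \<phi>) (1 / a) * epow (emeasure lborel (cube R :: 'a set)) (1 / a')) (1 / s)"
    using s by (intro epow_mono) auto
  also have "\<dots> = epow (Dp p \<phi>) (1 / a * (1 / s)) * epow (emeasure lborel (cube R :: 'a set)) (1 / a' * (1 / s))"
    using s by (simp add: epow_mult epow_epow)
  also have "1 / a * (1 / s) = 1 / p"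
    using s by (simp add: a_def)
  also have "1 / a' * (1 / s) = 1 / s - 1 / p"
    using s by (simp add: a'_def field_simps)
  finally show ?thesis
    by (simp add: mult.commute)
qed

text \<open>For \<open>p\<close> above the dimension \<open>n\<close>, the kernel
  \<open>riesz (n - 1)\<close> is \<open>q\<close>-integrable near its singularity since
  \<open>(n - 1) * q < n\<close>; Hoelder in the potential estimate then bounds values.\<close>

lemma Morrey_sup_bound:
  assumes p: "real DIM('a) < p" "1 < p"
  obtains C where "0 \<le> C"
    "\<And>(\<phi> :: 'a::euclidean_space \<Rightarrow> real) x. test_fun (cube R) \<phi> \<Longrightarrow> ennreal \<bar>\<phi> x\<bar> \<le> ennreal C * epow (Dp p \<phi>) (1 / p)"
proof -
  define n where "n = real DIM('a)"
  have n: "1 \<le> n"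
    by (simp add: n_def DIM_ge_Suc0)
  define q where "q = p / (p - 1)"
  have q: "1 / p + 1 / q = 1" "0 < q"
    using p by (auto simp: q_def field_simps)
  have sq: "0 \<le> (n - 1) * q" "(n - 1) * q < n"
    using n p q by (auto simp: q_def field_simps n_def)
  obtain C where C: "0 < C"
    "\<And>U (w :: 'a \<Rightarrow> real) x. test_fun U w \<Longrightarrow>
      ennreal \<bar>w x\<bar> \<le> ennreal C * (\<integral>\<^sup>+y. ennreal (norm (grad w y)) * riesz (n - 1) (y - x) \<partial>lborel)"
    using test_fun_le_riesz_potential[where 'a='a] unfolding n_def by metis
  define S where "S = 2 * \<bar>R\<bar>"
  obtain K where K: "0 \<le> K" "(\<integral>\<^sup>+z. indicator (cube S) (z::'a) * riesz ((n - 1) * q) z \<partial>lborel) \<le> ennreal K"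
    using nn_integral_riesz_cube[of S "(n - 1) * q", where 'a='a] sq unfolding n_def S_def by auto
  show ?thesis
  proof (rule that)
    show "0 \<le> C * K powr (1 / q)"
      using C by simp
    fix \<phi> :: "'a \<Rightarrow> real" and x
    assume \<phi>: "test_fun (cube R) \<phi>"
    have [measurable]: "grad \<phi> \<in> borel_measurable borel"
      using \<phi> by (rule test_fun_grad_measurable)
    show "ennreal \<bar>\<phi> x\<bar> \<le> ennreal (C * K powr (1 / q)) * epow (Dp p \<phi>) (1 / p)"
    proof (cases "x \<in> cube R")
      case False
      then show ?thesis
        using test_fun_eq_0[OF \<phi>] by simp
    next
      case True
      let ?k = "\<lambda>z::'a. indicator (cube S) z * riesz ((n - 1) * q) z"
      have sub: "y - x \<in> cube S" if "y \<in> cube R" for y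
        using cube_diff[OF that True] cube_mono[of "R + R" S] abs_ge_self[of R] by (auto simp: S_def)
      have "(\<integral>\<^sup>+y. ennreal (norm (grad \<phi> y)) * riesz (n - 1) (y - x) \<partial>lborel)
          = (\<integral>\<^sup>+y. ennreal (norm (grad \<phi> y)) * (indicator (cube S) (- x + y) * riesz (n - 1) (- x + y)) \<partial>lborel)"
        using test_fun_grad_eq_0[OF \<phi>] sub by (intro nn_integral_cong) (auto simp: indicator_def)
      also have "\<dots> \<le> epow (\<integral>\<^sup>+y. epow (ennreal (norm (grad \<phi> y))) p \<partial>lborel) (1 / p)
          * epow (\<integral>\<^sup>+y. epow (indicator (cube S) (- x + y) * riesz (n - 1) (- x + y)) q \<partial>lborel) (1 / q)"
        using p q by (intro Holder_nn_integral) auto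
      also have "(\<integral>\<^sup>+y. epow (ennreal (norm (grad \<phi> y))) p \<partial>lborel) = Dp p \<phi>"
        by (simp add: epow_ennreal)
      also have "(\<integral>\<^sup>+y. epow (indicator (cube S) (- x + y) * riesz (n - 1) (- x + y)) q \<partial>lborel) = (\<integral>\<^sup>+y. ?k (- x + y) \<partial>lborel)"
        using q by (intro nn_integral_cong) (auto simp: indicator_def epow_riesz)
      also have "\<dots> = (\<integral>\<^sup>+y. ?k y \<partial>lborel)"
        by (rule nn_integral_lborel_translate) measurable
      also have "epow (Dp p \<phi>) (1 / p) * epow (\<integral>\<^sup>+y. ?k y \<partial>lborel) (1 / q) \<le> epow (Dp p \<phi>) (1 / p) * epow (ennreal K) (1 / q)"
        using K q by (intro mult_left_mono epow_mono) auto
      also have "epow (ennreal K) (1 / q) = ennreal (K powr (1 / q))"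
        using K by (simp add: epow_ennreal)
      finally have "ennreal C * (\<integral>\<^sup>+y. ennreal (norm (grad \<phi> y)) * riesz (n - 1) (y - x) \<partial>lborel)
          \<le> ennreal C * (epow (Dp p \<phi>) (1 / p) * ennreal (K powr (1 / q)))"
        by (rule mult_left_mono) simp
      also have "\<dots> = ennreal (C * K powr (1 / q)) * epow (Dp p \<phi>) (1 / p)"
        using C by (simp add: ennreal_mult mult_ac)
      finally show ?thesis
        using C(2)[OF \<phi>, of x] by (rule order_trans[rotated])
    qed
  qed
qed

text \<open>A ray in a coordinate direction stays in the cube for a length of at most
  \<open>2 * R\<close>, so Hoelder on it brings in the \<open>p\<close>-th power of the gradient.
  The result lets the Cauchy property pass from gradients to functions.\<close>

lemma test_fun_Poincare:
  assumes p: "1 < p" and R: "0 < R"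
  obtains C where "0 \<le> C"
    "\<And>\<phi> :: 'a::euclidean_space \<Rightarrow> real. test_fun (cube R) \<phi> \<Longrightarrow>
      (\<integral>\<^sup>+x. ennreal (\<bar>\<phi> x\<bar> powr p) \<partial>lborel) \<le> ennreal C * Dp p \<phi>"
proof -
  obtain b :: 'a where b: "b \<in> Basis"
    using nonempty_Basis by blast
  define q where "q = p / (p - 1)"
  have q: "1 / p + 1 / q = 1" "0 < q"
    using p by (auto simp: q_def field_simps)
  define L where "L = 2 * R"
  have L: "0 < L"
    using R by (simp add: L_def)
  show ?thesis
  proof (rule that)
    show "0 \<le> L powr (p / q) * L"
      using L by simp
    fix \<phi> :: "'a \<Rightarrow> real"
    assume \<phi>: "test_fun (cube R) \<phi>"
    have [measurable]: "grad \<phi> \<in> borel_measurable borel" "\<phi> \<in> borel_measurable borel"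
      using \<phi> test_fun_measurable test_fun_grad_measurable by blast+
    define G where "G y = ennreal (norm (grad \<phi> y))" for y
    have [measurable]: "G \<in> borel_measurable borel"
      unfolding G_def by measurable
    have I: "epow (indicator {0..L} t) q = indicator {0..L} t" for t :: real
      using epow_ennreal[of 1 q] by (auto simp: indicator_def)
    have ptw: "ennreal (\<bar>\<phi> x\<bar> powr p) \<le> ennreal (L powr (p / q)) * (\<integral>\<^sup>+t. indicator {0..L} t * epow (G (x + t *\<^sub>R b)) p \<partial>lborel)" for x
    proof (cases "x \<in> cube R")
      case False
      then show ?thesis
        using test_fun_eq_0[OF \<phi>] by simp
    next
      case True
      have "ennreal \<bar>\<phi> x\<bar> \<le> (\<integral>\<^sup>+t. indicator {0<..} t * ennreal (norm (grad \<phi> (x + t *\<^sub>R b)) * norm b) \<partial>lborel)"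
        using b by (intro test_fun_le_ray_integral[OF \<phi>]) auto
      also have "\<dots> \<le> (\<integral>\<^sup>+t. (indicator {0..L} t * G (x + t *\<^sub>R b)) * indicator {0..L} t \<partial>lborel)"
      proof (intro nn_integral_mono)
        fix t :: real
        have "t \<le> L" if "x + t *\<^sub>R b \<in> cube R"
        proof -
          have "\<bar>x \<bullet> b\<bar> \<le> R" "\<bar>x \<bullet> b + t\<bar> \<le> R"
            using True that b by (auto simp: cube_def inner_add_left)
          then show ?thesis
            by (simp add: L_def)
        qed
        then show "indicator {0<..} t * ennreal (norm (grad \<phi> (x + t *\<^sub>R b)) * norm b) \<le> (indicator {0..L} t * G (x + t *\<^sub>R b)) * indicator {0..L} t"
          using b test_fun_grad_eq_0[OF \<phi>, of "x + t *\<^sub>R b"]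
          by (cases "x + t *\<^sub>R b \<in> cube R") (auto simp: indicator_def G_def)
      qed
      also have "\<dots> \<le> epow (\<integral>\<^sup>+t. epow (indicator {0..L} t * G (x + t *\<^sub>R b)) p \<partial>lborel) (1 / p)
          * epow (\<integral>\<^sup>+t. epow (indicator {0..L} t) q \<partial>lborel) (1 / q)"
        using p q by (intro Holder_nn_integral) auto
      also have "(\<integral>\<^sup>+t. epow (indicator {0..L} t) q \<partial>lborel) = ennreal L"
        unfolding I using L by simp
      also have "(\<integral>\<^sup>+t. epow (indicator {0..L} t * G (x + t *\<^sub>R b)) p \<partial>lborel) = (\<integral>\<^sup>+t. indicator {0..L} t * epow (G (x + t *\<^sub>R b)) p \<partial>lborel)"
        by (intro nn_integral_cong) (auto simp: indicator_def)
      finally have "epow (ennreal \<bar>\<phi> x\<bar>) p \<le> epow (epow (\<integral>\<^sup>+t. indicator {0..L} t * epow (G (x + t *\<^sub>R b)) p \<partial>lborel) (1 / p) * epow (ennreal L) (1 / q)) p"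
        using p by (intro epow_mono) auto
      then show ?thesis
        using p L by (simp add: epow_mult epow_epow epow_ennreal mult.commute powr_powr)
    qed
    have "(\<integral>\<^sup>+x. ennreal (\<bar>\<phi> x\<bar> powr p) \<partial>lborel)
        \<le> (\<integral>\<^sup>+x. ennreal (L powr (p / q)) * (\<integral>\<^sup>+t. indicator {0..L} t * epow (G (x + t *\<^sub>R b)) p \<partial>lborel) \<partial>lborel)"
      by (intro nn_integral_mono ptw)
    also have "\<dots> = ennreal (L powr (p / q)) * (\<integral>\<^sup>+x. \<integral>\<^sup>+t. indicator {0..L} t * epow (G (x + t *\<^sub>R b)) p \<partial>lborel \<partial>lborel)"
      by (intro nn_integral_cmult) measurable
    also have "(\<integral>\<^sup>+x. \<integral>\<^sup>+t. indicator {0..L} t * epow (G (x + t *\<^sub>R b)) p \<partial>lborel \<partial>lborel)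
        = (\<integral>\<^sup>+t. \<integral>\<^sup>+x. indicator {0..L} t * epow (G (t *\<^sub>R b + x)) p \<partial>lborel \<partial>lborel)"
      by (subst nn_integral_lborel_swap) (auto simp: add.commute)
    also have "\<dots> = (\<integral>\<^sup>+t. indicator {0..L} t * (\<integral>\<^sup>+x. epow (G (t *\<^sub>R b + x)) p \<partial>lborel) \<partial>lborel)"
      by (intro nn_integral_cong nn_integral_cmult) measurable
    also have "\<dots> = (\<integral>\<^sup>+t. indicator {0..L} t * (\<integral>\<^sup>+x. epow (G x) p \<partial>lborel) \<partial>lborel)"
      by (subst nn_integral_lborel_translate[where f="\<lambda>x. epow (G x) p"]) auto
    also have "\<dots> = ennreal L * Dp p \<phi>"
      using L by (simp add: nn_integral_multc G_def epow_ennreal)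
    finally show "(\<integral>\<^sup>+x. ennreal (\<bar>\<phi> x\<bar> powr p) \<partial>lborel) \<le> ennreal (L powr (p / q) * L) * Dp p \<phi>"
      using L by (simp add: ennreal_mult mult.assoc)
  qed
qed

text \<open>Hoelder with \<open>q\<close> conjugate to the Sobolev exponent of \<open>s\<close>. The
  letter \<open>s\<close> is kept apart from \<open>p\<close> because the critical case uses some
  \<open>s < p\<close>.\<close>

lemma Sobolev_functional_subcritical:
  fixes F :: "'a::euclidean_space \<Rightarrow> real"
  assumes N: "2 \<le> DIM('a)" and s: "1 < s" "s < real DIM('a)" and q: "1 / q = 1 - (1 / s - 1 / real DIM('a))"
    and [measurable]: "F \<in> borel_measurable lebesgue" and F: "(\<integral>\<^sup>+x. ennreal (\<bar>F x\<bar> powr q) \<partial>lebesgue) < \<infinity>"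
  obtains C where "0 \<le> C"
    "\<And>U \<phi>. test_fun U \<phi> \<Longrightarrow> (\<integral>\<^sup>+x. ennreal (\<bar>F x\<bar> * \<bar>\<phi> x\<bar>) \<partial>lebesgue) \<le> ennreal C * epow (Dp s \<phi>) (1 / s)"
proof -
  define r where "r = 1 / (1 / s - 1 / real DIM('a))"
  have r: "1 / r = 1 / s - 1 / real DIM('a)"
    by (simp add: r_def)
  have qpos: "0 < 1 / q" "1 / q < 1"
  proof -
    have "1 / s < 1" "1 / real DIM('a) < 1 / s" "0 < 1 / real DIM('a)"
      using s by (auto simp: field_simps)
    then show "0 < 1 / q" "1 / q < 1"
      unfolding q by linarith+
  qed
  then have q1: "1 < q"
    by (simp add: divide_less_eq_1)
  have qr: "1 / q + 1 / r = 1"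
    using q r by simp
  define B where "B = enn2real (\<integral>\<^sup>+x. ennreal (\<bar>F x\<bar> powr q) \<partial>lebesgue)"
  have B: "(\<integral>\<^sup>+x. ennreal (\<bar>F x\<bar> powr q) \<partial>lebesgue) = ennreal B" "0 \<le> B"
    using F unfolding B_def by (auto simp: less_top)
  define C where "C = s * (real DIM('a) - 1) / (real DIM('a) - s)"
  have C: "0 \<le> C"
    using s by (simp add: C_def)
  show ?thesis
  proof (rule that)
    show "0 \<le> B powr (1 / q) * C"
      using C by simp
    fix U and \<phi> :: "'a \<Rightarrow> real"
    assume \<phi>: "test_fun U \<phi>"
    have [measurable]: "\<phi> \<in> borel_measurable lebesgue"
      using test_fun_measurable[OF \<phi>] by (auto intro: measurable_completion)
    have "(\<integral>\<^sup>+x. ennreal (\<bar>F x\<bar> * \<bar>\<phi> x\<bar>) \<partial>lebesgue) = (\<integral>\<^sup>+x. ennreal \<bar>F x\<bar> * ennreal \<bar>\<phi> x\<bar> \<partial>lebesgue)"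
      by (simp add: ennreal_mult)
    also have "\<dots> \<le> epow (\<integral>\<^sup>+x. epow (ennreal \<bar>F x\<bar>) q \<partial>lebesgue) (1 / q) * epow (\<integral>\<^sup>+x. epow (ennreal \<bar>\<phi> x\<bar>) r \<partial>lebesgue) (1 / r)"
      using q1 qr by (intro Holder_nn_integral) measurable
    also have "\<dots> = ennreal (B powr (1 / q)) * epow (\<integral>\<^sup>+x. ennreal (\<bar>\<phi> x\<bar> powr r) \<partial>lborel) (1 / r)"
      by (simp add: epow_ennreal B(2) nn_integral_completion B(1)[simplified nn_integral_completion])
    also have "\<dots> \<le> ennreal (B powr (1 / q)) * (ennreal C * epow (Dp s \<phi>) (1 / s))"
      unfolding C_def by (intro mult_left_mono Gagliardo_Nirenberg_Sobolev[OF \<phi> N s r]) auto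
    finally show "(\<integral>\<^sup>+x. ennreal (\<bar>F x\<bar> * \<bar>\<phi> x\<bar>) \<partial>lebesgue) \<le> ennreal (B powr (1 / q) * C) * epow (Dp s \<phi>) (1 / s)"
      using C by (simp add: ennreal_mult mult.assoc)
  qed
qed

text \<open>Inside the bounded set the smaller power is at most 1 or at most the larger
  power.\<close>

lemma nn_integral_powr_finite_mono:
  fixes F :: "'a::euclidean_space \<Rightarrow> real"
  assumes \<Omega>: "bounded \<Omega>" and [measurable]: "F \<in> borel_measurable lebesgue"
    and zero: "\<And>x. x \<notin> \<Omega> \<Longrightarrow> F x = 0" and q: "0 < q'" "q' \<le> q"
    and F: "(\<integral>\<^sup>+x. ennreal (\<bar>F x\<bar> powr q) \<partial>lebesgue) < \<infinity>"
  shows "(\<integral>\<^sup>+x. ennreal (\<bar>F x\<bar> powr q') \<partial>lebesgue) < \<infinity>"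
proof -
  obtain R where R: "0 < R" "\<Omega> \<subseteq> cube R"
    using bounded_subset_cube[OF \<Omega>] by blast
  have "(\<integral>\<^sup>+x. ennreal (\<bar>F x\<bar> powr q') \<partial>lebesgue) \<le> (\<integral>\<^sup>+x. indicator (cube R) x + ennreal (\<bar>F x\<bar> powr q) \<partial>lebesgue)"
  proof (intro nn_integral_mono)
    fix x
    consider "x \<notin> \<Omega>" | "x \<in> \<Omega>" "\<bar>F x\<bar> \<le> 1" | "1 \<le> \<bar>F x\<bar>"
      by linarith
    then show "ennreal (\<bar>F x\<bar> powr q') \<le> indicator (cube R) x + ennreal (\<bar>F x\<bar> powr q)"
    proof cases
      case 1
      then show ?thesis
        by (simp add: zero)
    next
      case 2
      then have "ennreal (\<bar>F x\<bar> powr q') \<le> ennreal 1"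
        using q by (intro ennreal_leI powr_le1) auto
      then show ?thesis
        using 2 R by (auto simp: indicator_def intro: add_increasing2)
    next
      case 3
      then have "ennreal (\<bar>F x\<bar> powr q') \<le> ennreal (\<bar>F x\<bar> powr q)"
        using q by (intro ennreal_leI powr_mono) auto
      then show ?thesis
        by (rule add_increasing[rotated]) simp
    qed
  qed
  also have "\<dots> = emeasure lborel (cube R :: 'a set) + (\<integral>\<^sup>+x. ennreal (\<bar>F x\<bar> powr q) \<partial>lebesgue)"
  proof -
    have "(cube R :: 'a set) \<in> sets lebesgue"
      by (rule sets_completionI_sets) simp
    then have "(indicator (cube R) :: 'a \<Rightarrow> ennreal) \<in> borel_measurable lebesgue"
      by (rule borel_measurable_indicator)
    then show ?thesis
      by (subst nn_integral_add) auto
  qed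
  also have "\<dots> < \<infinity>"
    using F emeasure_cube_finite[of R, where 'a='a] by simp
  finally show ?thesis .
qed

lemma Lq_on_nn_integral_finite:
  assumes "Lq_on q \<Omega> f"
  shows "(\<integral>\<^sup>+x. ennreal (\<bar>indicator \<Omega> x * f x\<bar> powr q) \<partial>lebesgue) < \<infinity>"
proof -
  have "(\<integral>\<^sup>+x. ennreal (\<bar>indicator \<Omega> x * f x\<bar> powr q) \<partial>lebesgue) = (\<integral>\<^sup>+x. indicator \<Omega> x * ennreal (\<bar>f x\<bar> powr q) \<partial>lebesgue)"
    by (intro nn_integral_cong) (auto simp: indicator_def)
  then show ?thesis
    using assms by (simp add: Lq_on_def)
qed

lemma Lq_on_integrable:
  assumes "bounded \<Omega>" "1 \<le> q" "Lq_on q \<Omega> f"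
  shows "integrable lebesgue (\<lambda>x. indicator \<Omega> x * f x)"
proof (rule integrableI_bounded)
  show m: "(\<lambda>x. indicator \<Omega> x * f x) \<in> borel_measurable lebesgue"
    using assms(3) by (simp add: Lq_on_def)
  have "(\<integral>\<^sup>+x. ennreal (\<bar>indicator \<Omega> x * f x\<bar> powr 1) \<partial>lebesgue) < \<infinity>"
    by (rule nn_integral_powr_finite_mono[OF assms(1) m _ _ assms(2) Lq_on_nn_integral_finite[OF assms(3)]]) auto
  then show "(\<integral>\<^sup>+x. ennreal (norm (indicator \<Omega> x * f x)) \<partial>lebesgue) < \<infinity>"
    by simp
qed

lemma q0_adm_cases:
  assumes "q0_adm n p q" "1 < p"
  obtains (sub) "p < real n" "1 / q = 1 - (1 / p - 1 / real n)" "1 < q"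
    | (crit) "p = real n" "1 < q" | (super) "real n < p" "q = 1"
proof -
  have "p < real n \<and> 1 / (real n * p / (real n - p)) + 1 / q = 1
      \<or> p = real n \<and> 1 < q \<or> real n < p \<and> q = 1"
    using assms(1) unfolding q0_adm_def Let_def by blast
  then show ?thesis
  proof (elim disjE conjE)
    assume pn: "p < real n" and "1 / (real n * p / (real n - p)) + 1 / q = 1"
    moreover have "1 / (real n * p / (real n - p)) = 1 / p - 1 / real n"
      using pn assms(2) by (simp add: diff_divide_distrib)
    ultimately have q: "1 / q = 1 - (1 / p - 1 / real n)"
      by linarith
    have "1 / p < 1" "1 / real n < 1 / p" "0 < 1 / real n"
      using pn assms(2) by (auto simp: field_simps)
    then have "0 < 1 / q" "1 / q < 1"
      unfolding q by linarith+
    then have "1 < q"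
      by (simp add: divide_less_eq_1)
    with pn q show ?thesis
      by (rule that(1))
  qed (rule that(2,3); assumption)+
qed

text \<open>The clauses of \<open>q0_adm\<close> are the regimes of the Sobolev embedding. At
  \<open>p\<close> equal to the dimension, a little of the integrability of \<open>f\<close> beyond
  1 is spent on working with a slightly smaller exponent.\<close>

lemma Sobolev_functional_bounded:
  fixes f :: "'a::euclidean_space \<Rightarrow> real"
  assumes N: "2 \<le> DIM('a)" and p: "1 < p" and \<Omega>: "bounded \<Omega>"
    and q: "q0_adm DIM('a) p q" and f: "Lq_on q \<Omega> f"
  obtains C where "0 \<le> C"
    "\<And>\<phi>. test_fun \<Omega> \<phi> \<Longrightarrow> (\<integral>\<^sup>+x. ennreal (\<bar>indicator \<Omega> x * f x\<bar> * \<bar>\<phi> x\<bar>) \<partial>lebesgue) \<le> ennreal C * epow (Dp p \<phi>) (1 / p)"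
proof -
  obtain R where R: "0 < R" "\<Omega> \<subseteq> cube R"
    using bounded_subset_cube[OF \<Omega>] by blast
  define F where "F x = indicator \<Omega> x * f x" for x
  have F [measurable]: "F \<in> borel_measurable lebesgue"
    using f unfolding Lq_on_def F_def[abs_def] by blast
  have Fq: "(\<integral>\<^sup>+x. ennreal (\<bar>F x\<bar> powr q) \<partial>lebesgue) < \<infinity>"
    using Lq_on_nn_integral_finite[OF f] unfolding F_def .
  have cube: "test_fun (cube R) \<phi>" if "test_fun \<Omega> \<phi>" for \<phi>
    using test_fun_mono[OF that R(2)] .
  from q p show ?thesis
  proof (cases rule: q0_adm_cases)
    case sub
    show ?thesis
    proof (rule Sobolev_functional_subcritical[OF N p sub(1,2) F Fq])
      fix C
      assume C: "0 \<le> C" "\<And>U \<phi>. test_fun U \<phi> \<Longrightarrow> (\<integral>\<^sup>+x. ennreal (\<bar>F x\<bar> * \<bar>\<phi> x\<bar>) \<partial>lebesgue) \<le> ennreal C * epow (Dp p \<phi>) (1 / p)"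
      show ?thesis
        by (rule that[OF C(1)], rule C(2)[unfolded F_def])
    qed
  next
    case crit
    \<comment> \<open>How far \<open>1 / s\<close> is moved above \<open>1 / p\<close>. The bound
      \<open>1 - 1 / q\<close> keeps the new exponent \<open>q'\<close> at most \<open>q\<close>,
      and \<open>1 / 4\<close> keeps \<open>s > 1\<close> in every dimension from 2 on.\<close>
    define \<delta> where "\<delta> = min (1 - 1 / q) (1 / 4)"
    define s where "s = 1 / (1 / real DIM('a) + \<delta>)"
    have \<delta>: "0 < \<delta>" "\<delta> \<le> 1 - 1 / q" "\<delta> \<le> 1 / 4"
    proof -
      show "0 < \<delta>"
        using crit by (simp add: \<delta>_def)
    qed (simp_all only: \<delta>_def min.cobounded1 min.cobounded2)
    have N': "0 < 1 / real DIM('a)" "1 / real DIM('a) \<le> 1 / 2"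
      using N by (auto simp: field_simps)
    define v where "v = 1 / real DIM('a) + \<delta>"
    have v: "0 < v" "v < 1" "1 / real DIM('a) < v"
      using N' \<delta> unfolding v_def by linarith+
    then have "1 < 1 / v"
      by simp
    moreover have "1 / v < 1 / (1 / real DIM('a))"
      by (rule divide_strict_left_mono[OF v(3) zero_less_one mult_pos_pos[OF v(1) N'(1)]])
    ultimately have s1: "1 < s" "s < real DIM('a)" "1 / s = 1 / real DIM('a) + \<delta>"
      by (simp_all add: s_def flip: v_def)
    define q' where "q' = 1 / (1 - \<delta>)"
    have q': "1 / q' = 1 - (1 / s - 1 / real DIM('a))"
      using s1 by (simp add: q'_def)
    have "1 / q \<le> 1 - \<delta>"
      using \<delta> by simp
    then have qq: "0 < q'" "q' \<le> q"
      using \<delta> crit by (auto simp: q'_def field_simps)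
    have Fq': "(\<integral>\<^sup>+x. ennreal (\<bar>F x\<bar> powr q') \<partial>lebesgue) < \<infinity>"
      by (rule nn_integral_powr_finite_mono[OF \<Omega> F _ qq Fq]) (simp add: F_def)
    obtain C where C: "0 \<le> C"
      "\<And>U \<phi>. test_fun U \<phi> \<Longrightarrow> (\<integral>\<^sup>+x. ennreal (\<bar>F x\<bar> * \<bar>\<phi> x\<bar>) \<partial>lebesgue) \<le> ennreal C * epow (Dp s \<phi>) (1 / s)"
      using Sobolev_functional_subcritical[OF N s1(1,2) q' F Fq'] by metis
    define M where "M = enn2real (epow (emeasure lborel (cube R :: 'a set)) (1 / s - 1 / p))"
    have M: "epow (emeasure lborel (cube R :: 'a set)) (1 / s - 1 / p) = ennreal M"
  proof -
    have "epow (emeasure lborel (cube R :: 'a set)) (1 / s - 1 / p) \<noteq> top"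
      using emeasure_cube_finite[of R, where 'a='a] by (simp add: epow_eq_top_iff less_top)
    then show ?thesis
      unfolding M_def by (simp add: less_top)
  qed
    show ?thesis
    proof (rule that)
      show "0 \<le> C * M"
        using C by (simp add: M_def)
      fix \<phi> :: "'a \<Rightarrow> real"
      assume \<phi>: "test_fun \<Omega> \<phi>"
      have "(\<integral>\<^sup>+x. ennreal (\<bar>F x\<bar> * \<bar>\<phi> x\<bar>) \<partial>lebesgue) \<le> ennreal C * epow (Dp s \<phi>) (1 / s)"
        by (rule C(2)[OF \<phi>])
      also have "\<dots> \<le> ennreal C * (ennreal M * epow (Dp p \<phi>) (1 / p))"
        unfolding M[symmetric] using s1 crit by (intro mult_left_mono Dp_le_Dp_cube[OF cube[OF \<phi>]]) auto
      finally show "(\<integral>\<^sup>+x. ennreal (\<bar>indicator \<Omega> x * f x\<bar> * \<bar>\<phi> x\<bar>) \<partial>lebesgue) \<le> ennreal (C * M) * epow (Dp p \<phi>) (1 / p)"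
        using C by (simp add: F_def ennreal_mult' mult.assoc)
    qed
  next
    case super
    obtain C where C: "0 \<le> C"
      "\<And>(\<phi> :: 'a \<Rightarrow> real) x. test_fun (cube R) \<phi> \<Longrightarrow> ennreal \<bar>\<phi> x\<bar> \<le> ennreal C * epow (Dp p \<phi>) (1 / p)"
      using Morrey_sup_bound[OF super(1) p] by metis
    define B where "B = enn2real (\<integral>\<^sup>+x. ennreal \<bar>F x\<bar> \<partial>lebesgue)"
    have B: "(\<integral>\<^sup>+x. ennreal \<bar>F x\<bar> \<partial>lebesgue) = ennreal B" "0 \<le> B"
      using Fq super unfolding B_def by (auto simp: less_top)
    show ?thesis
    proof (rule that)
      show "0 \<le> B * C"
        using B C by simp
      fix \<phi> :: "'a \<Rightarrow> real"
      assume \<phi>: "test_fun \<Omega> \<phi>"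
      have "(\<integral>\<^sup>+x. ennreal (\<bar>F x\<bar> * \<bar>\<phi> x\<bar>) \<partial>lebesgue) \<le> (\<integral>\<^sup>+x. ennreal \<bar>F x\<bar> * (ennreal C * epow (Dp p \<phi>) (1 / p)) \<partial>lebesgue)"
        using C(2)[OF cube[OF \<phi>]] by (intro nn_integral_mono) (auto simp: ennreal_mult intro: mult_left_mono)
      also have "\<dots> = ennreal B * (ennreal C * epow (Dp p \<phi>) (1 / p))"
        by (simp add: nn_integral_multc B)
      finally show "(\<integral>\<^sup>+x. ennreal (\<bar>indicator \<Omega> x * f x\<bar> * \<bar>\<phi> x\<bar>) \<partial>lebesgue) \<le> ennreal (B * C) * epow (Dp p \<phi>) (1 / p)"
        using B C by (simp add: F_def ennreal_mult mult.assoc)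
    qed
  qed
qed

section \<open>Minkowski inequality and completeness of Lp spaces\<close>

text \<open>The constant is crude, but it shows that the left side of Minkowski's inequality is
  finite before it is divided by one of its own powers.\<close>

lemma epow_add_le:
  assumes "0 \<le> p"
  shows "epow (x + y) p \<le> ennreal (2 powr p) * (epow x p + epow y p)"
proof -
  have *: "epow (x + y) p \<le> ennreal (2 powr p) * (epow x p + epow y p)" if "x \<le> y" for x y
  proof -
    have "epow (x + y) p \<le> epow (2 * y) p"
      using that assms by (intro epow_mono) (auto simp: mult_2 intro: add_mono)
    also have "\<dots> = ennreal (2 powr p) * epow y p"
      using assms by (cases "p = 0"; cases y) (auto simp: epow_ennreal powr_mult ennreal_mult_top simp flip: ennreal_mult ennreal_numeral)
    also have "\<dots> \<le> ennreal (2 powr p) * (epow x p + epow y p)"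
      by (intro mult_left_mono) auto
    finally show ?thesis .
  qed
  show ?thesis
    using *[of x y] *[of y x] by (cases "x \<le> y") (auto simp: add.commute)
qed

lemma Minkowski_nn_integral:
  assumes p: "1 < p" and [measurable]: "f \<in> borel_measurable M" "g \<in> borel_measurable M"
  shows "epow (\<integral>\<^sup>+x. epow (f x + g x) p \<partial>M) (1 / p)
    \<le> epow (\<integral>\<^sup>+x. epow (f x) p \<partial>M) (1 / p) + epow (\<integral>\<^sup>+x. epow (g x) p \<partial>M) (1 / p)"
proof -
  define q where "q = p / (p - 1)"
  have q: "1 / p + 1 / q = 1" "0 < q" "(p - 1) * q = p"
    using p by (auto simp: q_def field_simps)
  let ?F = "\<integral>\<^sup>+x. epow (f x) p \<partial>M" and ?G = "\<integral>\<^sup>+x. epow (g x) p \<partial>M"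
    and ?S = "\<integral>\<^sup>+x. epow (f x + g x) p \<partial>M"
  show ?thesis
  proof (cases "?F = top \<or> ?G = top \<or> ?S = 0")
    case True
    then show ?thesis
      by auto
  next
    case False
    have "?S \<le> (\<integral>\<^sup>+x. ennreal (2 powr p) * (epow (f x) p + epow (g x) p) \<partial>M)"
      using p by (intro nn_integral_mono epow_add_le) auto
    also have "\<dots> = ennreal (2 powr p) * (?F + ?G)"
      by (simp add: nn_integral_cmult nn_integral_add)
    also have "\<dots> < top"
      using False by (simp add: ennreal_mult_less_top less_top)
    finally obtain s where s: "?S = ennreal s" "0 < s"
      using False by (cases ?S) (auto simp: order.order_iff_strict)
    \<comment> \<open>One factor is split off the \<open>p\<close>-th power and Hoelder is applied
      to both parts; \<open>(p - 1) * q = p\<close> brings back a power of \<open>?S\<close>, which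
      is then cancelled.\<close>
    have "?S = (\<integral>\<^sup>+x. f x * epow (f x + g x) (p - 1) + g x * epow (f x + g x) (p - 1) \<partial>M)"
      using p epow_add[of 1 "p - 1"] by (simp add: distrib_right[symmetric])
    also have "\<dots> = (\<integral>\<^sup>+x. f x * epow (f x + g x) (p - 1) \<partial>M) + (\<integral>\<^sup>+x. g x * epow (f x + g x) (p - 1) \<partial>M)"
      by (intro nn_integral_add) measurable
    also have "\<dots> \<le> epow ?F (1 / p) * epow (\<integral>\<^sup>+x. epow (epow (f x + g x) (p - 1)) q \<partial>M) (1 / q)
        + epow ?G (1 / p) * epow (\<integral>\<^sup>+x. epow (epow (f x + g x) (p - 1)) q \<partial>M) (1 / q)"
      using p q by (intro add_mono Holder_nn_integral) auto
    also have "\<dots> = (epow ?F (1 / p) + epow ?G (1 / p)) * epow ?S (1 / q)"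
      by (simp add: epow_epow q distrib_right)
    also have "epow ?S (1 / q) = ennreal (s powr (1 / q))"
      using s by (simp add: epow_ennreal)
    finally have "?S * ennreal (s powr - (1 / q)) \<le> (epow ?F (1 / p) + epow ?G (1 / p)) * ennreal (s powr (1 / q)) * ennreal (s powr - (1 / q))"
      by (rule mult_right_mono) simp
    also have "\<dots> = epow ?F (1 / p) + epow ?G (1 / p)"
      using s by (simp add: mult.assoc flip: ennreal_mult powr_add)
    also have "?S * ennreal (s powr - (1 / q)) = epow ?S (1 / p)"
    proof -
      have "s * s powr - (1 / q) = s powr (1 + - (1 / q))"
        unfolding powr_add using s by simp
      also have "1 + - (1 / q) = 1 / p"
        using q by simp
      finally show ?thesis
        using s by (simp add: epow_ennreal flip: ennreal_mult)
    qed
    finally show ?thesis .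
  qed
qed

lemma AE_suminf_finite:
  fixes z :: "nat \<Rightarrow> 'a \<Rightarrow> ennreal"
  assumes [measurable]: "\<And>k. z k \<in> borel_measurable M"
    and "(\<Sum>k. \<integral>\<^sup>+x. z k x \<partial>M) < top"
  shows "AE x in M. (\<Sum>k. z k x) < top"
proof -
  have "(\<integral>\<^sup>+x. (\<Sum>k. z k x) \<partial>M) < top"
    using assms by (subst nn_integral_suminf) auto
  then have "AE x in M. (\<Sum>k. z k x) \<noteq> \<infinity>"
    by (intro nn_integral_PInf_AE) auto
  then show ?thesis
    by (auto simp: less_top)
qed

lemma Lp_AE_subseq:
  fixes h :: "nat \<Rightarrow> 'a \<Rightarrow> 'b::euclidean_space"
  assumes p: "0 < p" and [measurable]: "\<And>n. h n \<in> borel_measurable M" "u \<in> borel_measurable M"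
    and lim: "(\<lambda>n. \<integral>\<^sup>+x. ennreal (norm (h n x - u x) powr p) \<partial>M) \<longlonglongrightarrow> 0"
  obtains r where "strict_mono r" "AE x in M. (\<lambda>k. h (r k) x) \<longlonglongrightarrow> u x"
proof -
  have ev: "\<exists>N. \<forall>n\<ge>N. (\<integral>\<^sup>+x. ennreal (norm (h n x - u x) powr p) \<partial>M) \<le> ennreal ((1/2)^k)" for k
  proof -
    have "\<forall>\<^sub>F n in sequentially. (\<integral>\<^sup>+x. ennreal (norm (h n x - u x) powr p) \<partial>M) < ennreal ((1/2)^k)"
      by (rule order_tendstoD(2)[OF lim]) simp
    then show ?thesis
      by (auto simp: eventually_sequentially intro: less_imp_le)
  qed
  then obtain N where N: "\<And>k n. N k \<le> n \<Longrightarrow> (\<integral>\<^sup>+x. ennreal (norm (h n x - u x) powr p) \<partial>M) \<le> ennreal ((1/2)^k)"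
    by metis
  \<comment> \<open>A strictly increasing choice of indices with errors at most
    \<open>(1/2) ^ k\<close>: the errors are summable, so their pointwise sum is finite almost
    everywhere.\<close>
  define r where "r = rec_nat (N 0) (\<lambda>k rk. max (Suc rk) (N (Suc k)))"
  have r_Suc: "r (Suc k) = max (Suc (r k)) (N (Suc k))" for k
    by (simp add: r_def)
  have r: "strict_mono r"
    unfolding strict_mono_Suc_iff r_Suc by (simp add: less_max_iff_disj)
  have rN: "N k \<le> r k" for k
    by (cases k) (auto simp: r_Suc, simp add: r_def)
  have "(\<Sum>k. \<integral>\<^sup>+x. ennreal (norm (h (r k) x - u x) powr p) \<partial>M) \<le> (\<Sum>k. ennreal ((1/2)^k))"
    by (intro suminf_le N rN) auto
  also have "\<dots> < top"
    by (subst suminf_ennreal2) (auto intro: summable_geometric)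
  finally have "AE x in M. (\<Sum>k. ennreal (norm (h (r k) x - u x) powr p)) < top"
    by (intro AE_suminf_finite) auto
  then have "AE x in M. (\<lambda>k. h (r k) x) \<longlonglongrightarrow> u x"
  proof (rule eventually_mono)
    fix x assume "(\<Sum>k. ennreal (norm (h (r k) x - u x) powr p)) < top"
    then have "summable (\<lambda>k. norm (h (r k) x - u x) powr p)"
      by (intro summable_suminf_not_top) auto
    then have "(\<lambda>k. norm (h (r k) x - u x) powr p) \<longlonglongrightarrow> 0"
      by (rule summable_LIMSEQ_zero)
    then have "(\<lambda>k. (norm (h (r k) x - u x) powr p) powr (1 / p)) \<longlonglongrightarrow> 0 powr (1 / p)"
      by (rule tendsto_powr'[OF _ tendsto_const]) (use p in auto)
    then have "(\<lambda>k. norm (h (r k) x - u x)) \<longlonglongrightarrow> 0"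
      using p by (simp add: powr_powr)
    then show "(\<lambda>k. h (r k) x) \<longlonglongrightarrow> u x"
      using Lim_null[of "\<lambda>k. h (r k) x" "u x" sequentially]
        tendsto_norm_zero_iff[of "\<lambda>k. h (r k) x - u x" sequentially] by simp
  qed
  with r show ?thesis
    by (rule that)
qed

lemma Lp_complete:
  fixes h :: "nat \<Rightarrow> 'a \<Rightarrow> 'b::euclidean_space"
  assumes p: "0 < p" and [measurable]: "\<And>n. h n \<in> borel_measurable M"
    and Cauchy: "\<And>\<epsilon>. 0 < \<epsilon> \<Longrightarrow> \<exists>N. \<forall>m\<ge>N. \<forall>n\<ge>N. (\<integral>\<^sup>+x. ennreal (norm (h m x - h n x) powr p) \<partial>M) \<le> ennreal \<epsilon>"
  obtains u where "u \<in> borel_measurable M" "(\<lambda>n. \<integral>\<^sup>+x. ennreal (norm (h n x - u x) powr p) \<partial>M) \<longlonglongrightarrow> 0"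
proof -
  \<comment> \<open>The increments of the subsequence will carry the weight \<open>2 ^ k\<close>
    inside the \<open>p\<close>-th power, and the factor \<open>1 / (2 ^ k) powr p\<close>
    compensates it. Almost everywhere the increments are then eventually at most
    \<open>(1/2) ^ k\<close>, so the telescoping series converges for every
    \<open>p > 0\<close>.\<close>
  define e where "e k = (1/2) ^ k * (1 / (2 ^ k) powr p)" for k :: nat
  have epos: "0 < e k" for k
    by (simp add: e_def)
  have "\<forall>k. \<exists>K. \<forall>m\<ge>K. \<forall>n\<ge>K. (\<integral>\<^sup>+x. ennreal (norm (h m x - h n x) powr p) \<partial>M) \<le> ennreal (e k)"
    using Cauchy[OF epos] by (rule allI)
  from choice[OF this] obtain N where N: "\<And>k m n. N k \<le> m \<Longrightarrow> N k \<le> n \<Longrightarrow> (\<integral>\<^sup>+x. ennreal (norm (h m x - h n x) powr p) \<partial>M) \<le> ennreal (e k)"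
    by blast
  define r where "r = rec_nat (N 0) (\<lambda>k rk. max (Suc rk) (N (Suc k)))"
  have r_Suc: "r (Suc k) = max (Suc (r k)) (N (Suc k))" for k
    by (simp add: r_def)
  have r: "strict_mono r"
    unfolding strict_mono_Suc_iff r_Suc by (simp add: less_max_iff_disj)
  have rN: "N k \<le> r k" for k
    by (cases k) (auto simp: r_Suc, simp add: r_def)
  have rN': "N k \<le> r (Suc k)" for k
    using rN[of k] r by (meson le_trans less_imp_le_nat lessI strict_monoD)
  let ?z = "\<lambda>k x. ennreal ((2 ^ k * norm (h (r (Suc k)) x - h (r k) x)) powr p)"
  have "(\<integral>\<^sup>+x. ?z k x \<partial>M) \<le> ennreal ((1/2)^k)" for k
  proof -
    have "(\<integral>\<^sup>+x. ?z k x \<partial>M) = ennreal ((2 ^ k) powr p) * (\<integral>\<^sup>+x. ennreal (norm (h (r (Suc k)) x - h (r k) x) powr p) \<partial>M)"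
      by (simp add: powr_mult ennreal_mult nn_integral_cmult)
    also have "\<dots> \<le> ennreal ((2 ^ k) powr p) * ennreal (e k)"
      by (intro mult_left_mono N rN rN') auto
    also have "\<dots> = ennreal ((1/2)^k)"
      by (simp add: e_def flip: ennreal_mult)
    finally show ?thesis .
  qed
  then have "(\<Sum>k. \<integral>\<^sup>+x. ?z k x \<partial>M) \<le> (\<Sum>k. ennreal ((1/2)^k))"
    by (intro suminf_le) auto
  also have "\<dots> < top"
    by (subst suminf_ennreal2) (auto intro: summable_geometric)
  finally have "AE x in M. (\<Sum>k. ?z k x) < top"
    by (intro AE_suminf_finite) auto
  then have conv: "AE x in M. convergent (\<lambda>k. h (r k) x)"
  proof (rule eventually_mono)
    fix x assume "(\<Sum>k. ?z k x) < top"
    then have "summable (\<lambda>k. (2 ^ k * norm (h (r (Suc k)) x - h (r k) x)) powr p)"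
      by (intro summable_suminf_not_top) auto
    then have "(\<lambda>k. (2 ^ k * norm (h (r (Suc k)) x - h (r k) x)) powr p) \<longlonglongrightarrow> 0"
      by (rule summable_LIMSEQ_zero)
    then have "\<forall>\<^sub>F k in sequentially. (2 ^ k * norm (h (r (Suc k)) x - h (r k) x)) powr p < 1"
      by (rule order_tendstoD) simp
    then have "\<forall>\<^sub>F k in sequentially. norm (h (r (Suc k)) x - h (r k) x) \<le> (1/2) ^ k"
    proof (rule eventually_mono)
      fix k assume "(2 ^ k * norm (h (r (Suc k)) x - h (r k) x)) powr p < 1"
      then have "2 ^ k * norm (h (r (Suc k)) x - h (r k) x) < 1"
        using p ge_one_powr_ge_zero[of "2 ^ k * norm (h (r (Suc k)) x - h (r k) x)" p] by (meson linorder_not_le less_imp_le)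
      then show "norm (h (r (Suc k)) x - h (r k) x) \<le> (1/2) ^ k"
        by (simp add: power_one_over field_simps)
    qed
    then have "summable (\<lambda>k. h (r (Suc k)) x - h (r k) x)"
      by (rule summable_comparison_test_ev) (auto intro: summable_geometric)
    then have "convergent (\<lambda>n. \<Sum>k<n. h (r (Suc k)) x - h (r k) x)"
      by (simp add: summable_iff_convergent)
    then have "convergent (\<lambda>n. h (r n) x - h (r 0) x)"
      by (simp only: sum_lessThan_telescope[of "\<lambda>k. h (r k) x"])
    then have "convergent (\<lambda>n. (h (r n) x - h (r 0) x) + h (r 0) x)"
      by (intro convergent_add convergent_const)
    then show "convergent (\<lambda>k. h (r k) x)"
      by simp
  qed
  define u where "u x = lim (\<lambda>k. h (r k) x)" for x
  have u [measurable]: "u \<in> borel_measurable M"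
    unfolding u_def by (rule borel_measurable_lim_metric) measurable
  show ?thesis
  proof (rule that[OF u])
    have lim: "AE x in M. (\<lambda>k. h (r k) x) \<longlonglongrightarrow> u x"
      using conv by (auto elim!: eventually_mono simp: u_def convergent_LIMSEQ_iff)
    \<comment> \<open>Fatou's lemma along the subsequence replaces the second index of the Cauchy
      condition by the limit.\<close>
    have bound: "(\<integral>\<^sup>+x. ennreal (norm (h n x - u x) powr p) \<partial>M) \<le> ennreal \<epsilon>"
      if K: "\<forall>m\<ge>K. \<forall>n\<ge>K. (\<integral>\<^sup>+x. ennreal (norm (h m x - h n x) powr p) \<partial>M) \<le> ennreal \<epsilon>" and n: "K \<le> n" for n K \<epsilon>
    proof -
      have "(\<integral>\<^sup>+x. ennreal (norm (h n x - u x) powr p) \<partial>M) = (\<integral>\<^sup>+x. liminf (\<lambda>k. ennreal (norm (h n x - h (r k) x) powr p)) \<partial>M)"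
      proof (rule nn_integral_cong_AE)
        show "AE x in M. ennreal (norm (h n x - u x) powr p) = liminf (\<lambda>k. ennreal (norm (h n x - h (r k) x) powr p))"
          using lim
        proof (rule eventually_mono)
          fix x assume "(\<lambda>k. h (r k) x) \<longlonglongrightarrow> u x"
          then have "(\<lambda>k. norm (h n x - h (r k) x) powr p) \<longlonglongrightarrow> norm (h n x - u x) powr p"
            by (intro tendsto_powr' tendsto_intros) (use p in auto)
          then have "(\<lambda>k. ennreal (norm (h n x - h (r k) x) powr p)) \<longlonglongrightarrow> ennreal (norm (h n x - u x) powr p)"
            by (rule tendsto_ennrealI)
          then show "ennreal (norm (h n x - u x) powr p) = liminf (\<lambda>k. ennreal (norm (h n x - h (r k) x) powr p))"
            by (intro lim_imp_Liminf[symmetric]) auto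
        qed
      qed
      also have "\<dots> \<le> liminf (\<lambda>k. \<integral>\<^sup>+x. ennreal (norm (h n x - h (r k) x) powr p) \<partial>M)"
        by (rule nn_integral_liminf) measurable
      also have "\<dots> \<le> ennreal \<epsilon>"
      proof -
        have "\<forall>\<^sub>F k in sequentially. (\<integral>\<^sup>+x. ennreal (norm (h n x - h (r k) x) powr p) \<partial>M) \<le> ennreal \<epsilon>"
          using K n seq_suble[OF r] by (intro eventually_sequentiallyI[of K]) (meson le_trans)
        then have "liminf (\<lambda>k. \<integral>\<^sup>+x. ennreal (norm (h n x - h (r k) x) powr p) \<partial>M) \<le> liminf (\<lambda>k::nat. ennreal \<epsilon>)"
          by (rule Liminf_mono)
        then show ?thesis
          by (simp add: Liminf_const)
      qed
      finally show ?thesis .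
    qed
    show "(\<lambda>n. \<integral>\<^sup>+x. ennreal (norm (h n x - u x) powr p) \<partial>M) \<longlonglongrightarrow> 0"
    proof (rule order_tendstoI)
      fix a :: ennreal assume "0 < a"
      then obtain \<epsilon> where \<epsilon>: "0 < \<epsilon>" "ennreal \<epsilon> < a"
      proof -
        obtain b where b: "0 < b" "b < a"
          using dense[OF \<open>0 < a\<close>] by blast
        then obtain e where "b = ennreal e" "0 \<le> e"
          by (cases b) auto
        with b that[of e] show ?thesis
          by auto
      qed
      obtain K where K: "\<forall>m\<ge>K. \<forall>n\<ge>K. (\<integral>\<^sup>+x. ennreal (norm (h m x - h n x) powr p) \<partial>M) \<le> ennreal \<epsilon>"
        using Cauchy[OF \<epsilon>(1)] by blast
      show "\<forall>\<^sub>F n in sequentially. (\<integral>\<^sup>+x. ennreal (norm (h n x - u x) powr p) \<partial>M) < a"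
        by (rule eventually_sequentiallyI[of K]) (rule order_le_less_trans[OF bound[OF K] \<epsilon>(2)])
    qed simp
  qed
qed

lemma tendsto_epow_0:
  fixes X :: "'b \<Rightarrow> ennreal"
  assumes X: "(X \<longlongrightarrow> 0) F" and a: "0 < a"
  shows "((\<lambda>n. epow (X n) a) \<longlongrightarrow> 0) F"
proof -
  have "((\<lambda>n. enn2real (X n)) \<longlongrightarrow> 0) F"
    using X by (intro tendsto_enn2real) auto
  then have "((\<lambda>n. enn2real (X n) powr a) \<longlongrightarrow> 0 powr a) F"
    by (rule tendsto_powr'[OF _ tendsto_const]) (use a in auto)
  then have "((\<lambda>n. ennreal (enn2real (X n) powr a)) \<longlongrightarrow> ennreal (0 powr a)) F"
    by (rule tendsto_ennrealI)
  moreover have "\<forall>\<^sub>F n in F. X n < 1"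
    by (rule order_tendstoD(2)[OF X]) simp
  then have "\<forall>\<^sub>F n in F. ennreal (enn2real (X n) powr a) = epow (X n) a"
    by (auto elim!: eventually_mono simp: epow_def)
  ultimately show ?thesis
    by (simp add: tendsto_cong)
qed

lemma Minkowski_norm_diff:
  fixes a b :: "'a \<Rightarrow> 'b::euclidean_space"
  assumes p: "1 < p" and [measurable]: "a \<in> borel_measurable M" "b \<in> borel_measurable M"
  shows "epow (\<integral>\<^sup>+x. ennreal (norm (a x) powr p) \<partial>M) (1 / p)
    \<le> epow (\<integral>\<^sup>+x. ennreal (norm (b x) powr p) \<partial>M) (1 / p) + epow (\<integral>\<^sup>+x. ennreal (norm (a x - b x) powr p) \<partial>M) (1 / p)"
proof -
  have "(\<integral>\<^sup>+x. ennreal (norm (a x) powr p) \<partial>M) \<le> (\<integral>\<^sup>+x. epow (ennreal (norm (b x)) + ennreal (norm (a x - b x))) p \<partial>M)"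
  proof (intro nn_integral_mono)
    fix x
    have "norm (a x) \<le> norm (b x) + norm (a x - b x)"
      using norm_triangle_ineq[of "b x" "a x - b x"] by simp
    then show "ennreal (norm (a x) powr p) \<le> epow (ennreal (norm (b x)) + ennreal (norm (a x - b x))) p"
      using p by (auto simp: epow_ennreal simp flip: ennreal_plus intro!: ennreal_leI powr_mono2)
  qed
  then have "epow (\<integral>\<^sup>+x. ennreal (norm (a x) powr p) \<partial>M) (1 / p)
      \<le> epow (\<integral>\<^sup>+x. epow (ennreal (norm (b x)) + ennreal (norm (a x - b x))) p \<partial>M) (1 / p)"
    using p by (intro epow_mono) auto
  also have "\<dots> \<le> epow (\<integral>\<^sup>+x. epow (ennreal (norm (b x))) p \<partial>M) (1 / p) + epow (\<integral>\<^sup>+x. epow (ennreal (norm (a x - b x))) p \<partial>M) (1 / p)"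
    by (rule Minkowski_nn_integral[OF p]) measurable
  finally show ?thesis
    by (simp add: epow_ennreal)
qed

section \<open>Existence of minimizers and compliance as an infimum over test functions\<close>

text \<open>Besides measurability, \<open>Sobolev\<close> is all that is kept of \<open>f\<close>;
  this makes the variational part uniform in the three regimes of \<open>p\<close>.\<close>

locale energy_setting =
  fixes \<Omega> :: "'a::euclidean_space set" and p :: real and f :: "'a \<Rightarrow> real" and S :: real
  assumes p: "1 < p" and open_domain: "open \<Omega>" and bounded_domain: "bounded \<Omega>"
    and F_measurable: "(\<lambda>x. indicator \<Omega> x * f x) \<in> borel_measurable lebesgue"
    and S: "0 \<le> S"
    and Sobolev: "\<And>\<phi>. test_fun \<Omega> \<phi> \<Longrightarrow>
      (\<integral>\<^sup>+x. ennreal (\<bar>indicator \<Omega> x * f x\<bar> * \<bar>\<phi> x\<bar>) \<partial>lebesgue) \<le> ennreal S * epow (Dp p \<phi>) (1 / p)"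
begin

definition D :: "('a \<Rightarrow> real) \<Rightarrow> real" where
  "D \<phi> = (\<integral>x. norm (grad \<phi> x) powr p \<partial>lborel)"

definition L :: "('a \<Rightarrow> real) \<Rightarrow> real" where
  "L \<phi> = (\<integral>x. indicator \<Omega> x * (f x * \<phi> x) \<partial>lebesgue)"

definition E :: "('a \<Rightarrow> real) \<Rightarrow> real" where
  "E \<phi> = energy p f \<Omega> (\<phi>, grad \<phi>)"

text \<open>Minus the compliance, by \<open>compliance_eq\<close> below; the infimum over smooth
  functions is the form in which enlarging \<open>\<Sigma>\<close> is studied.\<close>

definition mval :: "'a set \<Rightarrow> real" where
  "mval U = Inf (E ` {\<phi>. test_fun U \<phi>})"

section \<open>Energies of test functions: coercivity and convexity\<close>

lemma D_nonneg: "0 \<le> D \<phi>"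
  unfolding D_def by simp

lemma D_integrable:
  assumes "test_fun U \<phi>"
  shows "integrable lborel (\<lambda>x. norm (grad \<phi> x) powr p)"
proof (rule integrableI_nonneg)
  have [measurable]: "grad \<phi> \<in> borel_measurable borel"
    using assms by (rule test_fun_grad_measurable)
  show "(\<lambda>x. norm (grad \<phi> x) powr p) \<in> borel_measurable lborel"
    by measurable
  show "Dp p \<phi> < \<infinity>"
    using test_fun_abs_powr_integral_finite(2)[OF assms] p by auto
qed auto

lemma Dp_eq: "test_fun U \<phi> \<Longrightarrow> Dp p \<phi> = ennreal (D \<phi>)"
  unfolding D_def by (intro nn_integral_eq_integral D_integrable) auto

lemma L_integrable:
  assumes "test_fun \<Omega> \<phi>"
  shows "integrable lebesgue (\<lambda>x. indicator \<Omega> x * (f x * \<phi> x))"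
proof (rule integrableI_bounded)
  have m: "(\<lambda>x. (indicator \<Omega> x * f x) * \<phi> x) \<in> borel_measurable lebesgue"
    using test_fun_measurable[OF assms] by (intro borel_measurable_times F_measurable measurable_completion) auto
  then show "(\<lambda>x. indicator \<Omega> x * (f x * \<phi> x)) \<in> borel_measurable lebesgue"
    by (simp add: mult.assoc)
  have "(\<integral>\<^sup>+x. ennreal (norm (indicator \<Omega> x * (f x * \<phi> x))) \<partial>lebesgue) = (\<integral>\<^sup>+x. ennreal (\<bar>indicator \<Omega> x * f x\<bar> * \<bar>\<phi> x\<bar>) \<partial>lebesgue)"
    by (simp add: abs_mult mult.assoc)
  also have "\<dots> \<le> ennreal S * epow (ennreal (D \<phi>)) (1 / p)"
    using Sobolev[OF assms] unfolding Dp_eq[OF assms] .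
  also have "\<dots> < \<infinity>"
    by (simp add: epow_ennreal D_nonneg ennreal_mult_less_top)
  finally show "(\<integral>\<^sup>+x. ennreal (norm (indicator \<Omega> x * (f x * \<phi> x))) \<partial>lebesgue) < \<infinity>" .
qed

lemma L_bound:
  assumes "test_fun \<Omega> \<phi>"
  shows "\<bar>L \<phi>\<bar> \<le> S * D \<phi> powr (1 / p)"
proof -
  have "ennreal \<bar>L \<phi>\<bar> \<le> (\<integral>\<^sup>+x. ennreal (norm (indicator \<Omega> x * (f x * \<phi> x))) \<partial>lebesgue)"
    unfolding L_def using integral_norm_bound_ennreal[OF L_integrable[OF assms]] by simp
  also have "\<dots> = (\<integral>\<^sup>+x. ennreal (\<bar>indicator \<Omega> x * f x\<bar> * \<bar>\<phi> x\<bar>) \<partial>lebesgue)"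
    by (simp add: abs_mult mult.assoc)
  also have "\<dots> \<le> ennreal S * epow (ennreal (D \<phi>)) (1 / p)"
    using Sobolev[OF assms] unfolding Dp_eq[OF assms] .
  also have "\<dots> = ennreal (S * D \<phi> powr (1 / p))"
    using S by (simp add: epow_ennreal D_nonneg ennreal_mult)
  finally show ?thesis
    using S by (simp add: ennreal_le_iff)
qed

lemma E_eq:
  assumes "test_fun \<Omega> \<phi>"
  shows "E \<phi> = D \<phi> / p - L \<phi>"
proof -
  have [measurable]: "grad \<phi> \<in> borel_measurable borel"
    using assms by (rule test_fun_grad_measurable)
  have "(\<integral>x. indicator \<Omega> x * norm (grad \<phi> x) powr p \<partial>lebesgue) = (\<integral>x. norm (grad \<phi> x) powr p \<partial>lebesgue)"
    using test_fun_grad_eq_0[OF assms] by (intro Bochner_Integration.integral_cong) (auto simp: indicator_def)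
  also have "\<dots> = D \<phi>"
    unfolding D_def by (intro integral_completion) measurable
  finally show ?thesis
    by (simp add: E_def energy_def L_def)
qed

lemma L_add: "test_fun \<Omega> \<phi> \<Longrightarrow> test_fun \<Omega> \<psi> \<Longrightarrow> L (\<lambda>x. \<phi> x + \<psi> x) = L \<phi> + L \<psi>"
  unfolding L_def by (subst Bochner_Integration.integral_add[symmetric]) (auto intro: L_integrable simp: distrib_left)

lemma L_cmult: "L (\<lambda>x. c * \<phi> x) = c * L \<phi>"
  unfolding L_def by (subst integral_mult_right_zero[symmetric]) (simp add: mult_ac)

lemma D_cmult:
  assumes "test_fun U \<phi>"
  shows "D (\<lambda>x. c * \<phi> x) = \<bar>c\<bar> powr p * D \<phi>"
  unfolding D_def grad_cmult[OF assms] by (simp add: powr_mult)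

lemma mid_gap_integrable:
  assumes "test_fun U \<phi>" "test_fun U \<psi>"
  shows "integrable lborel (\<lambda>x. mid_gap p (grad \<phi> x) (grad \<psi> x))"
    and "(\<integral>x. mid_gap p (grad \<phi> x) (grad \<psi> x) \<partial>lborel) = (D \<phi> + D \<psi>) / 2 - D (\<lambda>x. 1 / 2 * (\<phi> x + \<psi> x))"
proof -
  have t: "test_fun U (\<lambda>x. \<phi> x + \<psi> x)" "test_fun U (\<lambda>x. 1 / 2 * (\<phi> x + \<psi> x))"
  proof -
    show "test_fun U (\<lambda>x. \<phi> x + \<psi> x)"
      using assms by (rule test_fun_add)
    then show "test_fun U (\<lambda>x. 1 / 2 * (\<phi> x + \<psi> x))"
      by (rule test_fun_cmult)
  qed
  have g: "grad (\<lambda>x. 1 / 2 * (\<phi> x + \<psi> x)) x = (1 / 2) *\<^sub>R (grad \<phi> x + grad \<psi> x)" for x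
    using grad_cmult[OF t(1), of "1 / 2" x] grad_add[OF assms, of x] by simp
  note i = D_integrable[OF assms(1)] D_integrable[OF assms(2)] D_integrable[OF t(2), unfolded g]
  show "integrable lborel (\<lambda>x. mid_gap p (grad \<phi> x) (grad \<psi> x))"
    unfolding mid_gap_def using i by simp
  show "(\<integral>x. mid_gap p (grad \<phi> x) (grad \<psi> x) \<partial>lborel) = (D \<phi> + D \<psi>) / 2 - D (\<lambda>x. 1 / 2 * (\<phi> x + \<psi> x))"
    unfolding mid_gap_def D_def g using i by simp
qed

lemma coercive:
  obtains B where "\<And>\<phi>. test_fun \<Omega> \<phi> \<Longrightarrow> D \<phi> \<le> 2 * p * (E \<phi> + B)"
proof -
  \<comment> \<open>The value of \<open>t\<close> at which \<open>S * t\<close> equals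
    \<open>t powr p / (2 * p)\<close>. Beyond it half of the gradient term absorbs the linear one,
    before it the constant \<open>S * T\<close> does.\<close>
  define T where "T = (2 * p * S) powr (1 / (p - 1))"
  show ?thesis
  proof (rule that)
    fix \<phi>
    assume \<phi>: "test_fun \<Omega> \<phi>"
    define t where "t = D \<phi> powr (1 / p)"
    have t: "0 \<le> t" "D \<phi> = t powr p"
      using p by (auto simp: t_def powr_powr D_nonneg)
    have "S * t \<le> t powr p / (2 * p) + S * T"
    proof (cases "t \<le> T")
      case True
      then have "S * t \<le> S * T"
        using S by (intro mult_left_mono) auto
      then show ?thesis
        using p by (simp add: add_increasing)
    next
      case False
      have "2 * p * S = T powr (p - 1)"
        using p S by (simp add: T_def powr_powr)
      also have "\<dots> \<le> t powr (p - 1)"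
        using False p by (intro powr_mono2) (auto simp: T_def)
      finally have "2 * p * S * t \<le> t powr (p - 1) * t"
        using t by (intro mult_right_mono) auto
      also have "\<dots> = t powr p"
        using t(1) powr_add[of t "p - 1" 1] by (cases "t = 0") auto
      finally have "S * t \<le> t powr p / (2 * p)"
        using p by (simp add: field_simps)
      moreover have "0 \<le> S * T"
        using S by (simp add: T_def)
      ultimately show ?thesis by simp
    qed
    moreover have "L \<phi> \<le> S * t"
      using L_bound[OF \<phi>] by (simp add: t_def)
    ultimately have "L \<phi> \<le> D \<phi> / (2 * p) + S * T"
      by (simp add: t)
    then have "D \<phi> / p - D \<phi> / (2 * p) \<le> E \<phi> + S * T"
      unfolding E_eq[OF \<phi>] by simp
    also have "D \<phi> / p - D \<phi> / (2 * p) = D \<phi> / (2 * p)"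
      by (simp add: field_simps)
    finally show "D \<phi> \<le> 2 * p * (E \<phi> + S * T)"
      using p by (simp add: field_simps)
  qed
qed

lemma E_bdd_below: "U \<subseteq> \<Omega> \<Longrightarrow> bdd_below (E ` {\<phi>. test_fun U \<phi>})"
proof -
  assume U: "U \<subseteq> \<Omega>"
  obtain B where B: "\<And>\<phi>. test_fun \<Omega> \<phi> \<Longrightarrow> D \<phi> \<le> 2 * p * (E \<phi> + B)"
    by (rule coercive) blast
  have "- B \<le> E \<phi>" if "test_fun U \<phi>" for \<phi>
  proof -
    have "0 \<le> 2 * p * (E \<phi> + B)"
      using B[OF test_fun_mono[OF that U]] D_nonneg[of \<phi>] by linarith
    then show ?thesis
      using p by (simp add: zero_le_mult_iff)
  qed
  then show ?thesis
    by (intro bdd_belowI2) auto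
qed

lemma mval_le: "U \<subseteq> \<Omega> \<Longrightarrow> test_fun U \<phi> \<Longrightarrow> mval U \<le> E \<phi>"
  unfolding mval_def by (intro cInf_lower E_bdd_below) auto

lemma mval_approx:
  assumes "U \<subseteq> \<Omega>" "0 < \<epsilon>"
  obtains \<phi> where "test_fun U \<phi>" "E \<phi> < mval U + \<epsilon>"
proof -
  have "\<exists>y\<in>E ` {\<phi>. test_fun U \<phi>}. y < mval U + \<epsilon>"
    using assms E_bdd_below test_fun_0 unfolding mval_def by (subst cInf_less_iff[symmetric]) auto
  then show ?thesis
    using that by auto
qed

text \<open>The linear part cancels in the midpoint defect, and the midpoint is again a test
  function on \<open>U\<close>, so its energy is at least \<open>mval U\<close>.\<close>

lemma mid_gap_integral_le:
  assumes "U \<subseteq> \<Omega>" "test_fun U \<phi>" "test_fun U \<psi>"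
  shows "(\<integral>x. mid_gap p (grad \<phi> x) (grad \<psi> x) \<partial>lborel) \<le> p * ((E \<phi> + E \<psi>) / 2 - mval U)"
proof -
  let ?\<mu> = "\<lambda>x. 1 / 2 * (\<phi> x + \<psi> x)"
  have t: "test_fun U ?\<mu>"
    using assms by (intro test_fun_cmult test_fun_add)
  note t\<Omega> = assms(2,3)[THEN test_fun_mono[OF _ assms(1)]] t[THEN test_fun_mono[OF _ assms(1)]]
  have "L ?\<mu> = (L \<phi> + L \<psi>) / 2"
    using L_cmult[of "1 / 2" "\<lambda>x. \<phi> x + \<psi> x"] L_add[OF t\<Omega>(1,2)] by simp
  then have "(D \<phi> + D \<psi>) / 2 - D ?\<mu> = p * ((E \<phi> + E \<psi>) / 2 - E ?\<mu>)"
    using p unfolding t\<Omega>[THEN E_eq] by (simp add: field_simps)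
  also have "\<dots> \<le> p * ((E \<phi> + E \<psi>) / 2 - mval U)"
    using p mval_le[OF assms(1) t] by (intro mult_left_mono) auto
  finally show ?thesis
    using mid_gap_integrable(2)[OF assms(2,3)] by simp
qed

text \<open>The pointwise gap estimate, integrated. The constant \<open>C\<close> depends on neither
  \<open>U\<close> nor the functions, so a small energy excess forces close gradients.\<close>

lemma D_diff_le:
  assumes "0 < \<epsilon>"
  obtains C where "0 < C" "\<And>U \<phi> \<psi>. U \<subseteq> \<Omega> \<Longrightarrow> test_fun U \<phi> \<Longrightarrow> test_fun U \<psi> \<Longrightarrow>
     D (\<lambda>x. \<phi> x - \<psi> x) \<le> \<epsilon> * D \<psi> + C * (p * ((E \<phi> + E \<psi>) / 2 - mval U))"
proof -
  obtain C where C: "0 < C"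
    "\<And>a b :: 'a. norm (a - b) powr p \<le> \<epsilon> * norm b powr p + C * mid_gap p a b"
    using norm_diff_powr_le_mid_gap[OF p assms, where 'a='a] by blast
  show ?thesis
  proof (rule that[OF C(1)])
    fix U \<phi> \<psi> assume t: "U \<subseteq> \<Omega>" "test_fun U \<phi>" "test_fun U \<psi>"
    have "D (\<lambda>x. \<phi> x - \<psi> x) = (\<integral>x. norm (grad \<phi> x - grad \<psi> x) powr p \<partial>lborel)"
      unfolding D_def grad_diff[OF t(2,3)] ..
    also have "\<dots> \<le> (\<integral>x. \<epsilon> * norm (grad \<psi> x) powr p + C * mid_gap p (grad \<phi> x) (grad \<psi> x) \<partial>lborel)"
      using C(2) D_integrable[OF t(3)] mid_gap_integrable(1)[OF t(2,3)]
        D_integrable[OF test_fun_diff[OF t(2,3)]]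
      by (intro integral_mono) (auto simp: grad_diff[OF t(2,3)])
    also have "\<dots> = \<epsilon> * D \<psi> + C * (\<integral>x. mid_gap p (grad \<phi> x) (grad \<psi> x) \<partial>lborel)"
      using D_integrable[OF t(3)] mid_gap_integrable(1)[OF t(2,3)] by (simp add: D_def)
    also have "\<dots> \<le> \<epsilon> * D \<psi> + C * (p * ((E \<phi> + E \<psi>) / 2 - mval U))"
      using C(1) mid_gap_integral_le[OF t] by simp
    finally show "D (\<lambda>x. \<phi> x - \<psi> x) \<le> \<epsilon> * D \<psi> + C * (p * ((E \<phi> + E \<psi>) / 2 - mval U))" .
  qed
qed

lemma minimizing_sequence_Cauchy:
  assumes U: "U \<subseteq> \<Omega>" and \<phi>: "\<And>n. test_fun U (\<phi> n)" and lim: "(\<lambda>n. E (\<phi> n)) \<longlonglongrightarrow> mval U"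
    and e: "0 < \<epsilon>"
  shows "\<exists>N. \<forall>m\<ge>N. \<forall>n\<ge>N. D (\<lambda>x. \<phi> m x - \<phi> n x) \<le> \<epsilon>"
proof -
  obtain B where B: "\<And>\<phi>. test_fun \<Omega> \<phi> \<Longrightarrow> D \<phi> \<le> 2 * p * (E \<phi> + B)"
    by (rule coercive) blast
  define M where "M = max 1 (2 * p * (mval U + 1 + B))"
  have M: "0 < M"
    by (simp add: M_def)
  obtain C where C: "0 < C" "\<And>U \<phi> \<psi>. U \<subseteq> \<Omega> \<Longrightarrow> test_fun U \<phi> \<Longrightarrow> test_fun U \<psi> \<Longrightarrow>
     D (\<lambda>x. \<phi> x - \<psi> x) \<le> \<epsilon> / (2 * M) * D \<psi> + C * (p * ((E \<phi> + E \<psi>) / 2 - mval U))"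
    by (rule D_diff_le[of "\<epsilon> / (2 * M)"]) (use e M in auto)
  \<comment> \<open>The relative term is worth \<open>\<epsilon> / 2\<close> through the bound
    \<open>M\<close> on \<open>D (\<phi> n)\<close>, the energy excess the other half through
    \<open>\<eta>\<close>; \<open>\<eta> \<le> 1\<close> is what makes \<open>M\<close> a valid
    bound.\<close>
  define \<eta> where "\<eta> = min 1 (\<epsilon> / (2 * (C * p)))"
  have \<eta>: "0 < \<eta>" "\<eta> \<le> 1" "C * (p * \<eta>) \<le> \<epsilon> / 2"
  proof -
    show "0 < \<eta>" "\<eta> \<le> 1"
      using e C p by (auto simp: \<eta>_def)
    have "C * p * \<eta> \<le> C * p * (\<epsilon> / (2 * (C * p)))"
      using C p by (intro mult_left_mono) (auto simp: \<eta>_def)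
    also have "\<dots> = \<epsilon> / 2"
      using C p by simp
    finally show "C * (p * \<eta>) \<le> \<epsilon> / 2"
      by (simp add: mult.assoc)
  qed
  have "\<forall>\<^sub>F n in sequentially. E (\<phi> n) < mval U + \<eta>"
    using order_tendstoD(2)[OF lim, of "mval U + \<eta>"] \<eta> by simp
  then obtain N where N: "\<And>n. N \<le> n \<Longrightarrow> E (\<phi> n) < mval U + \<eta>"
    by (auto simp: eventually_sequentially)
  have "D (\<lambda>x. \<phi> m x - \<phi> n x) \<le> \<epsilon>" if mn: "N \<le> m" "N \<le> n" for m n
  proof -
    have "D (\<phi> n) \<le> 2 * p * (E (\<phi> n) + B)"
      using B test_fun_mono[OF \<phi> U] by blast
    also have "\<dots> \<le> 2 * p * (mval U + 1 + B)"
      using N[OF mn(2)] \<eta> p by (intro mult_left_mono) auto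
    also have "\<dots> \<le> M"
      by (simp add: M_def)
    finally have DM: "D (\<phi> n) \<le> M" .
    have "D (\<lambda>x. \<phi> m x - \<phi> n x) \<le> \<epsilon> / (2 * M) * D (\<phi> n) + C * (p * ((E (\<phi> m) + E (\<phi> n)) / 2 - mval U))"
      by (intro C(2) U \<phi>)
    also have "\<dots> \<le> \<epsilon> / (2 * M) * M + C * (p * \<eta>)"
    proof (intro add_mono mult_left_mono)
      show "(E (\<phi> m) + E (\<phi> n)) / 2 - mval U \<le> \<eta>"
        using N[OF mn(1)] N[OF mn(2)] by (simp add: field_simps)
    qed (use DM e M C(1) p in auto)
    also have "\<dots> \<le> \<epsilon>"
      using \<eta> M by simp
    finally show ?thesis .
  qed
  then show ?thesis
    by blast
qed

text \<open>\<open>W0\<close> asks for convergence of functions and gradients. The gradients are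
  Cauchy by convexity, the functions by the Poincare inequality.\<close>

lemma minimizing_sequence_converges:
  assumes U: "U \<subseteq> \<Omega>" and \<phi>: "\<And>n. test_fun U (\<phi> n)" and lim: "(\<lambda>n. E (\<phi> n)) \<longlonglongrightarrow> mval U"
  obtains u g where "u \<in> borel_measurable lebesgue" "g \<in> borel_measurable lebesgue"
    "(\<lambda>n. \<integral>\<^sup>+x. ennreal (\<bar>\<phi> n x - u x\<bar> powr p) \<partial>lebesgue) \<longlonglongrightarrow> 0"
    "(\<lambda>n. \<integral>\<^sup>+x. ennreal (norm (grad (\<phi> n) x - g x) powr p) \<partial>lebesgue) \<longlonglongrightarrow> 0"
proof -
  obtain R where R: "0 < R" "\<Omega> \<subseteq> cube R"
    using bounded_subset_cube[OF bounded_domain] by blast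
  obtain C where C: "0 \<le> C" "\<And>\<phi> :: 'a \<Rightarrow> real. test_fun (cube R) \<phi> \<Longrightarrow>
      (\<integral>\<^sup>+x. ennreal (\<bar>\<phi> x\<bar> powr p) \<partial>lborel) \<le> ennreal C * Dp p \<phi>"
    using test_fun_Poincare[OF p R(1), where 'a='a] by metis
  have diff: "test_fun U (\<lambda>x. \<phi> m x - \<phi> n x)" for m n
    by (intro test_fun_diff \<phi>)
  have meas: "\<phi> n \<in> borel_measurable lebesgue" "grad (\<phi> n) \<in> borel_measurable lebesgue" for n
    using test_fun_measurable[OF \<phi>] test_fun_grad_measurable[OF \<phi>] by (auto intro: measurable_completion)
  have c1: "\<exists>N. \<forall>m\<ge>N. \<forall>n\<ge>N. (\<integral>\<^sup>+x. ennreal (norm (grad (\<phi> m) x - grad (\<phi> n) x) powr p) \<partial>lebesgue) \<le> ennreal \<epsilon>"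
    if "0 < \<epsilon>" for \<epsilon>
  proof -
    have "(\<integral>\<^sup>+x. ennreal (norm (grad (\<phi> m) x - grad (\<phi> n) x) powr p) \<partial>lebesgue) = ennreal (D (\<lambda>x. \<phi> m x - \<phi> n x))" for m n
      using Dp_eq[OF diff] by (simp add: nn_integral_completion grad_diff[OF \<phi> \<phi>])
    then show ?thesis
      using minimizing_sequence_Cauchy[OF U \<phi> lim that] by (metis ennreal_leI)
  qed
  have c2: "\<exists>N. \<forall>m\<ge>N. \<forall>n\<ge>N. (\<integral>\<^sup>+x. ennreal (norm (\<phi> m x - \<phi> n x) powr p) \<partial>lebesgue) \<le> ennreal \<epsilon>"
    if "0 < \<epsilon>" for \<epsilon>
  proof -
    have le: "(\<integral>\<^sup>+x. ennreal (norm (\<phi> m x - \<phi> n x) powr p) \<partial>lebesgue) \<le> ennreal (C * D (\<lambda>x. \<phi> m x - \<phi> n x))" for m n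
      using C(2)[OF test_fun_mono[OF diff order_trans[OF U R(2)]], of m n] C(1)
      by (simp add: nn_integral_completion Dp_eq[OF diff] ennreal_mult')
    \<comment> \<open>Division by \<open>C + 1\<close> because the Poincare constant
      \<open>C\<close> may be 0.\<close>
    obtain N where N: "\<forall>m\<ge>N. \<forall>n\<ge>N. D (\<lambda>x. \<phi> m x - \<phi> n x) \<le> \<epsilon> / (C + 1)"
      by (rule exE[OF minimizing_sequence_Cauchy[OF U \<phi> lim, of "\<epsilon> / (C + 1)"]]) (use \<open>0 < \<epsilon>\<close> C(1) in auto)
    have "C * D (\<lambda>x. \<phi> m x - \<phi> n x) \<le> \<epsilon>" if "N \<le> m" "N \<le> n" for m n
    proof -
      have "C * D (\<lambda>x. \<phi> m x - \<phi> n x) \<le> (C + 1) * (\<epsilon> / (C + 1))"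
        using N that C(1) D_nonneg by (intro mult_mono) auto
      then show ?thesis
        using C(1) by simp
    qed
    then show ?thesis
      using le by (meson ennreal_leI order_trans)
  qed
  obtain g where g: "g \<in> borel_measurable lebesgue"
    "(\<lambda>n. \<integral>\<^sup>+x. ennreal (norm (grad (\<phi> n) x - g x) powr p) \<partial>lebesgue) \<longlonglongrightarrow> 0"
    by (rule Lp_complete[OF _ meas(2) c1]) (use p in auto)
  obtain u where u: "u \<in> borel_measurable lebesgue"
    "(\<lambda>n. \<integral>\<^sup>+x. ennreal (norm (\<phi> n x - u x) powr p) \<partial>lebesgue) \<longlonglongrightarrow> 0"
    by (rule Lp_complete[OF _ meas(1) c2]) (use p in auto)
  show ?thesis
    using that[OF u(1) g(1) _ g(2)] u(2) by simp
qed

text \<open>The gradient part is continuity of the \<open>p\<close>-norm. For the linear part,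
  \<open>f\<close> need not be integrable to the power conjugate to \<open>p\<close>, so
  \<open>Sobolev\<close> is applied to differences of test functions and carried to \<open>u\<close>
  by Fatou along an almost everywhere convergent subsequence.\<close>

lemma energy_tendsto:
  assumes \<phi>: "\<And>n. test_fun \<Omega> (\<phi> n)"
    and u [measurable]: "u \<in> borel_measurable lebesgue" and g [measurable]: "g \<in> borel_measurable lebesgue"
    and lim_u: "(\<lambda>n. \<integral>\<^sup>+x. ennreal (\<bar>\<phi> n x - u x\<bar> powr p) \<partial>lebesgue) \<longlonglongrightarrow> 0"
    and lim_g: "(\<lambda>n. \<integral>\<^sup>+x. ennreal (norm (grad (\<phi> n) x - g x) powr p) \<partial>lebesgue) \<longlonglongrightarrow> 0"
  shows "(\<lambda>n. E (\<phi> n)) \<longlonglongrightarrow> energy p f \<Omega> (u, g)"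
proof -
  have [measurable]: "\<phi> n \<in> borel_measurable lebesgue" "grad (\<phi> n) \<in> borel_measurable lebesgue" for n
    using test_fun_measurable[OF \<phi>] test_fun_grad_measurable[OF \<phi>] by (auto intro: measurable_completion)
  have [measurable]: "\<Omega> \<in> sets lebesgue"
    using open_domain by (simp add: borel_open)
  note F_measurable [measurable]
  define z where "z n = epow (\<integral>\<^sup>+x. ennreal (norm (grad (\<phi> n) x - g x) powr p) \<partial>lebesgue) (1 / p)" for n
  have z: "z \<longlonglongrightarrow> 0"
    unfolding z_def using p by (intro tendsto_epow_0 lim_g) auto
  have zr: "(\<lambda>n. enn2real (z n)) \<longlonglongrightarrow> 0"
    using z by (intro tendsto_enn2real) auto
  have z_fin: "\<forall>\<^sub>F n in sequentially. z n < 1"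
    by (rule order_tendstoD(2)[OF z]) simp

  \<comment> \<open>The energy integrates over \<open>\<Omega>\<close> only. As the gradients of the
    test functions vanish outside, cutting \<open>g\<close> off does not increase its distance to
    them.\<close>
  define G where "G x = indicator \<Omega> x *\<^sub>R g x" for x
  have [measurable]: "G \<in> borel_measurable lebesgue"
    unfolding G_def by measurable
  define y where "y = epow (\<integral>\<^sup>+x. ennreal (norm (G x) powr p) \<partial>lebesgue) (1 / p)"
  define X where "X n = D (\<phi> n) powr (1 / p)" for n
  have x_eq: "epow (\<integral>\<^sup>+x. ennreal (norm (grad (\<phi> n) x) powr p) \<partial>lebesgue) (1 / p) = ennreal (X n)" for n
    by (simp add: nn_integral_completion Dp_eq[OF \<phi>] epow_ennreal D_nonneg X_def)
  have diff_le: "epow (\<integral>\<^sup>+x. ennreal (norm (grad (\<phi> n) x - G x) powr p) \<partial>lebesgue) (1 / p) \<le> z n"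
    "epow (\<integral>\<^sup>+x. ennreal (norm (G x - grad (\<phi> n) x) powr p) \<partial>lebesgue) (1 / p) \<le> z n" for n
  proof -
    have "norm (grad (\<phi> n) x - G x) powr p \<le> norm (grad (\<phi> n) x - g x) powr p" for x
      using test_fun_grad_eq_0[OF \<phi>, of x n] by (auto simp: G_def indicator_def)
    then show "epow (\<integral>\<^sup>+x. ennreal (norm (grad (\<phi> n) x - G x) powr p) \<partial>lebesgue) (1 / p) \<le> z n"
      "epow (\<integral>\<^sup>+x. ennreal (norm (G x - grad (\<phi> n) x) powr p) \<partial>lebesgue) (1 / p) \<le> z n"
      unfolding z_def using p
      by (auto intro!: epow_mono nn_integral_mono ennreal_leI simp: norm_minus_commute[of "G _"])
  qed
  have xy: "ennreal (X n) \<le> y + z n" "y \<le> ennreal (X n) + z n" for n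
    using Minkowski_norm_diff[OF p, of "grad (\<phi> n)" lebesgue G]
      Minkowski_norm_diff[OF p, of G lebesgue "grad (\<phi> n)"] diff_le[of n]
    unfolding x_eq y_def[symmetric] by (auto intro: order_trans[OF _ add_left_mono])
  obtain n0 where "z n0 < 1"
    using z_fin by (auto simp: eventually_sequentially)
  then have "y < top"
    using xy(2)[of n0] by (auto simp: less_top[symmetric] top_unique)
  then obtain Y where Y: "y = ennreal Y" "0 \<le> Y"
    by (cases y) auto
  have "X \<longlonglongrightarrow> Y"
  proof (rule LIM_zero_cancel, rule Lim_null_comparison[OF _ zr])
    show "\<forall>\<^sub>F n in sequentially. norm (X n - Y) \<le> enn2real (z n)"
      using z_fin
    proof (rule eventually_mono)
      fix n assume "z n < 1"
      then obtain r where r: "z n = ennreal r" "0 \<le> r"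
        by (cases "z n") auto
      have "0 \<le> X n"
        by (simp add: X_def)
      with xy[of n] r Y show "norm (X n - Y) \<le> enn2real (z n)"
        by (auto simp: ennreal_le_iff abs_le_iff simp flip: ennreal_plus)
    qed
  qed
  then have "(\<lambda>n. X n powr p) \<longlonglongrightarrow> Y powr p"
    by (rule tendsto_powr'[OF _ tendsto_const]) (use p in \<open>auto simp: X_def\<close>)
  moreover have "X n powr p = D (\<phi> n)" for n
    using p by (simp add: X_def powr_powr D_nonneg)
  moreover have "(\<integral>x. indicator \<Omega> x * norm (g x) powr p \<partial>lebesgue) = Y powr p"
  proof -
    have "(\<integral>\<^sup>+x. ennreal (norm (G x) powr p) \<partial>lebesgue) = epow y p"
      using p by (simp add: y_def epow_epow)
    also have "\<dots> = ennreal (Y powr p)"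
      using Y by (simp add: epow_ennreal)
    finally have "(\<integral>x. norm (G x) powr p \<partial>lebesgue) = Y powr p"
      by (subst integral_eq_nn_integral) auto
    moreover have "norm (G x) powr p = indicator \<Omega> x * norm (g x) powr p" for x
      by (auto simp: G_def indicator_def)
    ultimately show ?thesis by simp
  qed
  ultimately have limD: "(\<lambda>n. D (\<phi> n)) \<longlonglongrightarrow> (\<integral>x. indicator \<Omega> x * norm (g x) powr p \<partial>lebesgue)"
    by simp

  define F where "F x = indicator \<Omega> x * f x" for x
  have [measurable]: "F \<in> borel_measurable lebesgue"
    unfolding F_def[abs_def] by measurable
  obtain r where r: "strict_mono r" "AE x in lebesgue. (\<lambda>k. \<phi> (r k) x) \<longlonglongrightarrow> u x"
    by (rule Lp_AE_subseq[of p \<phi> lebesgue u]) (use p lim_u in auto)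
  have W: "(\<integral>\<^sup>+x. ennreal \<bar>F x * \<phi> n x - F x * u x\<bar> \<partial>lebesgue) \<le> ennreal S * z n" for n
  proof -
    have "(\<integral>\<^sup>+x. ennreal \<bar>F x * \<phi> n x - F x * u x\<bar> \<partial>lebesgue)
        = (\<integral>\<^sup>+x. liminf (\<lambda>k. ennreal \<bar>F x * \<phi> n x - F x * \<phi> (r k) x\<bar>) \<partial>lebesgue)"
    proof (rule nn_integral_cong_AE)
      show "AE x in lebesgue. ennreal \<bar>F x * \<phi> n x - F x * u x\<bar> = liminf (\<lambda>k. ennreal \<bar>F x * \<phi> n x - F x * \<phi> (r k) x\<bar>)"
        using r(2)
      proof (rule eventually_mono)
        fix x assume "(\<lambda>k. \<phi> (r k) x) \<longlonglongrightarrow> u x"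
        then have "(\<lambda>k. ennreal \<bar>F x * \<phi> n x - F x * \<phi> (r k) x\<bar>) \<longlonglongrightarrow> ennreal \<bar>F x * \<phi> n x - F x * u x\<bar>"
          by (intro tendsto_ennrealI tendsto_intros)
        then show "ennreal \<bar>F x * \<phi> n x - F x * u x\<bar> = liminf (\<lambda>k. ennreal \<bar>F x * \<phi> n x - F x * \<phi> (r k) x\<bar>)"
          by (intro lim_imp_Liminf[symmetric]) auto
      qed
    qed
    also have "\<dots> \<le> liminf (\<lambda>k. \<integral>\<^sup>+x. ennreal \<bar>F x * \<phi> n x - F x * \<phi> (r k) x\<bar> \<partial>lebesgue)"
      by (rule nn_integral_liminf) measurable
    also have "\<dots> \<le> liminf (\<lambda>k. ennreal S * (z n + z (r k)))"
    proof (intro Liminf_mono always_eventually allI)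
      fix k
      have t: "test_fun \<Omega> (\<lambda>x. \<phi> n x - \<phi> (r k) x)"
        by (intro test_fun_diff \<phi>)
      have "(\<integral>\<^sup>+x. ennreal \<bar>F x * \<phi> n x - F x * \<phi> (r k) x\<bar> \<partial>lebesgue)
          = (\<integral>\<^sup>+x. ennreal (\<bar>indicator \<Omega> x * f x\<bar> * \<bar>\<phi> n x - \<phi> (r k) x\<bar>) \<partial>lebesgue)"
        by (simp add: F_def abs_mult[symmetric] right_diff_distrib)
      also have "\<dots> \<le> ennreal S * epow (\<integral>\<^sup>+x. ennreal (norm (grad (\<phi> n) x - grad (\<phi> (r k)) x) powr p) \<partial>lebesgue) (1 / p)"
        using Sobolev[OF t] by (simp add: grad_diff[OF \<phi> \<phi>] nn_integral_completion)
      also have "\<dots> \<le> ennreal S * (z n + z (r k))"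
      proof (intro mult_left_mono)
        have eq: "norm ((grad (\<phi> n) x - g x) - (grad (\<phi> n) x - grad (\<phi> (r k)) x)) = norm (grad (\<phi> (r k)) x - g x)" for x
          by simp
        have eq': "norm ((grad (\<phi> n) x - grad (\<phi> (r k)) x) - (grad (\<phi> n) x - g x)) = norm (grad (\<phi> (r k)) x - g x)" for x
          using eq[of x] by (simp only: norm_minus_commute)
        show "epow (\<integral>\<^sup>+x. ennreal (norm (grad (\<phi> n) x - grad (\<phi> (r k)) x) powr p) \<partial>lebesgue) (1 / p) \<le> z n + z (r k)"
          using Minkowski_norm_diff[OF p, of "\<lambda>x. grad (\<phi> n) x - grad (\<phi> (r k)) x" lebesgue "\<lambda>x. grad (\<phi> n) x - g x"]
          unfolding z_def eq' by simp
      qed simp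
      finally show "(\<integral>\<^sup>+x. ennreal \<bar>F x * \<phi> n x - F x * \<phi> (r k) x\<bar> \<partial>lebesgue) \<le> ennreal S * (z n + z (r k))" .
    qed
    also have "\<dots> = ennreal S * z n"
    proof (rule lim_imp_Liminf)
      have "(\<lambda>k. z (r k)) \<longlonglongrightarrow> 0"
        using LIMSEQ_subseq_LIMSEQ[OF z r(1)] by (simp add: o_def)
      then have "(\<lambda>k. ennreal S * (z n + z (r k))) \<longlonglongrightarrow> ennreal S * (z n + 0)"
        by (intro ennreal_tendsto_cmult tendsto_add tendsto_const) auto
      then show "(\<lambda>k. ennreal S * (z n + z (r k))) \<longlonglongrightarrow> ennreal S * z n"
        by simp
    qed simp
    finally show ?thesis .
  qed
  have iF: "integrable lebesgue (\<lambda>x. F x * \<phi> n x)" for n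
    using L_integrable[OF \<phi>, of n] by (simp add: F_def mult.assoc)
  \<comment> \<open>One test function at finite distance suffices: the product with \<open>u\<close>
    is an integrable product minus an integrable error.\<close>
  have iu: "integrable lebesgue (\<lambda>x. F x * u x)"
  proof -
    have "(\<integral>\<^sup>+x. ennreal \<bar>F x * \<phi> n0 x - F x * u x\<bar> \<partial>lebesgue) < \<infinity>"
    proof (rule order_le_less_trans[OF W])
      have "z n0 < top"
        using \<open>z n0 < 1\<close> by (rule order.strict_trans) simp
      then show "ennreal S * z n0 < \<infinity>"
        by (simp add: ennreal_mult_less_top)
    qed
    then have "integrable lebesgue (\<lambda>x. F x * \<phi> n0 x - F x * u x)"
      by (intro integrableI_bounded) auto
    from Bochner_Integration.integrable_diff[OF iF[of n0] this] show ?thesis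
      by simp
  qed
  have "(\<lambda>n. \<integral>x. F x * \<phi> n x \<partial>lebesgue) \<longlonglongrightarrow> (\<integral>x. F x * u x \<partial>lebesgue)"
  proof (rule LIM_zero_cancel, rule Lim_null_comparison)
    show "(\<lambda>n. S * enn2real (z n)) \<longlonglongrightarrow> 0"
      using tendsto_mult_left[OF zr, of S] by simp
    show "\<forall>\<^sub>F n in sequentially. norm ((\<integral>x. F x * \<phi> n x \<partial>lebesgue) - (\<integral>x. F x * u x \<partial>lebesgue)) \<le> S * enn2real (z n)"
      using z_fin
    proof (rule eventually_mono)
      fix n assume "z n < 1"
      then obtain c where c: "z n = ennreal c" "0 \<le> c"
        by (cases "z n") auto
      have "ennreal (norm (\<integral>x. F x * \<phi> n x - F x * u x \<partial>lebesgue)) \<le> (\<integral>\<^sup>+x. ennreal (norm (F x * \<phi> n x - F x * u x)) \<partial>lebesgue)"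
        using iF[of n] iu by (intro integral_norm_bound_ennreal) auto
      also have "\<dots> \<le> ennreal S * ennreal c"
        using W[of n] c by simp
      also have "\<dots> = ennreal (S * c)"
        using S c by (simp add: ennreal_mult)
      finally have "norm (\<integral>x. F x * \<phi> n x - F x * u x \<partial>lebesgue) \<le> S * c"
        using S c by (subst (asm) ennreal_le_iff) auto
      then show "norm ((\<integral>x. F x * \<phi> n x \<partial>lebesgue) - (\<integral>x. F x * u x \<partial>lebesgue)) \<le> S * enn2real (z n)"
        using iF[of n] iu c by simp
    qed
  qed
  then have limL: "(\<lambda>n. L (\<phi> n)) \<longlonglongrightarrow> (\<integral>x. indicator \<Omega> x * (f x * u x) \<partial>lebesgue)"
    by (simp add: L_def F_def mult.assoc)
  show ?thesis
    using tendsto_diff[OF tendsto_divide[OF limD tendsto_const, of p] limL] p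
    by (simp add: E_eq[OF \<phi>] energy_def)
qed

section \<open>Identification of the compliance\<close>

lemma W0_mem_iff:
  "(u, g) \<in> W0 p U \<longleftrightarrow> u \<in> borel_measurable lebesgue \<and> g \<in> borel_measurable lebesgue \<and>
    (\<exists>\<phi>. (\<forall>k. test_fun U (\<phi> k)) \<and>
      (\<lambda>k. \<integral>\<^sup>+x. ennreal (\<bar>\<phi> k x - u x\<bar> powr p) \<partial>lebesgue) \<longlonglongrightarrow> 0 \<and>
      (\<lambda>k. \<integral>\<^sup>+x. ennreal (norm (grad (\<phi> k) x - g x) powr p) \<partial>lebesgue) \<longlonglongrightarrow> 0)"
  unfolding W0_def by simp

text \<open>By continuity of the energy along the approximating sequence of \<open>w\<close>,
  enlarging the class from test functions to \<open>W0\<close> does not lower the infimum.\<close>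

lemma mval_le_energy:
  assumes U: "U \<subseteq> \<Omega>" and w: "w \<in> W0 p U"
  shows "mval U \<le> energy p f \<Omega> w"
proof -
  obtain u g where ug: "w = (u, g)"
    by (cases w)
  from w obtain \<phi> where \<phi>: "\<And>k. test_fun U (\<phi> k)"
    and ms: "u \<in> borel_measurable lebesgue" "g \<in> borel_measurable lebesgue"
    and lim: "(\<lambda>k. \<integral>\<^sup>+x. ennreal (\<bar>\<phi> k x - u x\<bar> powr p) \<partial>lebesgue) \<longlonglongrightarrow> 0"
      "(\<lambda>k. \<integral>\<^sup>+x. ennreal (norm (grad (\<phi> k) x - g x) powr p) \<partial>lebesgue) \<longlonglongrightarrow> 0"
    unfolding ug W0_mem_iff by blast
  have "(\<lambda>n. E (\<phi> n)) \<longlonglongrightarrow> energy p f \<Omega> w"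
    unfolding ug using energy_tendsto[OF test_fun_mono[OF \<phi> U] ms lim] .
  then show ?thesis
    by (rule LIMSEQ_le_const) (use mval_le[OF U \<phi>] in auto)
qed

text \<open>The conclusion keeps the convergence of the given sequence; through it the minimizer
  will be identified as 0.\<close>

lemma minimizer_exists:
  assumes U: "U \<subseteq> \<Omega>" and \<phi>: "\<And>n. test_fun U (\<phi> n)" and lim: "(\<lambda>n. E (\<phi> n)) \<longlonglongrightarrow> mval U"
  obtains u g where "(u, g) \<in> W0 p U" "energy p f \<Omega> (u, g) = mval U"
    "u \<in> borel_measurable lebesgue"
    "(\<lambda>n. \<integral>\<^sup>+x. ennreal (\<bar>\<phi> n x - u x\<bar> powr p) \<partial>lebesgue) \<longlonglongrightarrow> 0"
proof -
  obtain u g where ug: "u \<in> borel_measurable lebesgue" "g \<in> borel_measurable lebesgue"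
    "(\<lambda>n. \<integral>\<^sup>+x. ennreal (\<bar>\<phi> n x - u x\<bar> powr p) \<partial>lebesgue) \<longlonglongrightarrow> 0"
    "(\<lambda>n. \<integral>\<^sup>+x. ennreal (norm (grad (\<phi> n) x - g x) powr p) \<partial>lebesgue) \<longlonglongrightarrow> 0"
    by (rule minimizing_sequence_converges[OF U \<phi> lim])
  have "(\<lambda>n. E (\<phi> n)) \<longlonglongrightarrow> energy p f \<Omega> (u, g)"
    by (rule energy_tendsto[OF test_fun_mono[OF \<phi> U] ug])
  then have "energy p f \<Omega> (u, g) = mval U"
    using lim LIMSEQ_unique by blast
  moreover have "(u, g) \<in> W0 p U"
    unfolding W0_mem_iff using ug \<phi> by blast
  ultimately show ?thesis
    using that ug by blast
qed

lemma minimizing_sequence_exists: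
  assumes "U \<subseteq> \<Omega>"
  obtains \<phi> where "\<And>n::nat. test_fun U (\<phi> n)" "\<And>n. E (\<phi> n) < mval U + inverse (real (Suc n))"
    "(\<lambda>n. E (\<phi> n)) \<longlonglongrightarrow> mval U"
proof -
  have "\<exists>\<phi>. test_fun U \<phi> \<and> E \<phi> < mval U + inverse (real (Suc n))" for n
    using mval_approx[OF assms, of "inverse (real (Suc n))"] by (metis inverse_positive_iff_positive of_nat_0_less_iff zero_less_Suc)
  then obtain \<phi> where \<phi>: "\<And>n. test_fun U (\<phi> n)" "\<And>n. E (\<phi> n) < mval U + inverse (real (Suc n))"
    by metis
  have "(\<lambda>n. E (\<phi> n)) \<longlonglongrightarrow> mval U"
  proof (rule tendsto_sandwich[OF _ _ tendsto_const])
    show "(\<lambda>n. mval U + inverse (real (Suc n))) \<longlonglongrightarrow> mval U"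
      using tendsto_add[OF tendsto_const LIMSEQ_inverse_real_of_nat, of "mval U"] by simp
  qed (use \<phi> mval_le[OF assms] in \<open>auto intro: always_eventually less_imp_le\<close>)
  with \<phi> show ?thesis
    by (rule that)
qed

text \<open>Existence of a minimizer gives the \<open>SOME\<close> in \<open>min_sol\<close> its
  meaning; whichever one is chosen, its energy is \<open>mval (\<Omega> - \<Sigma>)\<close>.\<close>

lemma compliance_eq: "compliance p f \<Omega> \<Sigma> = - mval (\<Omega> - \<Sigma>)"
proof -
  have U: "\<Omega> - \<Sigma> \<subseteq> \<Omega>"
    by blast
  obtain \<phi> where \<phi>: "\<And>n. test_fun (\<Omega> - \<Sigma>) (\<phi> n)"
    "\<And>n. E (\<phi> n) < mval (\<Omega> - \<Sigma>) + inverse (real (Suc n))" "(\<lambda>n. E (\<phi> n)) \<longlonglongrightarrow> mval (\<Omega> - \<Sigma>)"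
    by (rule minimizing_sequence_exists[OF U]) (rule that)
  obtain u g where ug: "(u, g) \<in> W0 p (\<Omega> - \<Sigma>)" "energy p f \<Omega> (u, g) = mval (\<Omega> - \<Sigma>)"
    by (rule minimizer_exists[OF U \<phi>(1,3)])
  have "\<exists>w. w \<in> W0 p (\<Omega> - \<Sigma>) \<and> (\<forall>v\<in>W0 p (\<Omega> - \<Sigma>). energy p f \<Omega> w \<le> energy p f \<Omega> v)"
    using ug(1) mval_le_energy[OF U] unfolding ug(2)[symmetric] by blast
  then have "min_sol p f \<Omega> \<Sigma> \<in> W0 p (\<Omega> - \<Sigma>) \<and>
      (\<forall>v\<in>W0 p (\<Omega> - \<Sigma>). energy p f \<Omega> (min_sol p f \<Omega> \<Sigma>) \<le> energy p f \<Omega> v)"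
    unfolding min_sol_def by (rule someI_ex)
  then have "energy p f \<Omega> (min_sol p f \<Omega> \<Sigma>) = mval (\<Omega> - \<Sigma>)"
    using ug mval_le_energy[OF U] by (metis order_antisym)
  then show ?thesis
    by (simp add: compliance_def)
qed

end

section \<open>The one-dimensional Hausdorff measure\<close>

lemma hdiam_empty [simp]: "hdiam {} = 0"
  by (simp add: hdiam_def)

lemma H1_delta_le:
  assumes "A \<subseteq> (\<Union>i. C i)" "\<And>i. hdiam (C i) \<le> ennreal \<delta>"
  shows "H1_delta \<delta> A \<le> (\<Sum>i. hdiam (C i))"
  unfolding H1_delta_def using assms by (intro INF_lower) auto

lemma H1_empty [simp]: "H1 {} = 0"
proof -
  have "H1_delta \<delta> {} = 0" for \<delta>
    using H1_delta_le[of "{}" "\<lambda>_. {}" \<delta>] by simp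
  then show ?thesis
    unfolding H1_def by (intro antisym SUP_least) auto
qed

text \<open>The finite cover of \<open>B\<close> is put in front of an arbitrary countable cover of
  \<open>A\<close>, whose indices are shifted by \<open>k\<close>.\<close>

lemma H1_delta_Un_finite_cover:
  fixes A B :: "'a::metric_space set"
  assumes B: "B \<subseteq> (\<Union>i<k::nat. G i)" and G: "\<And>i. i < k \<Longrightarrow> hdiam (G i) \<le> ennreal \<delta>"
  shows "H1_delta \<delta> (A \<union> B) \<le> H1_delta \<delta> A + (\<Sum>i<k. hdiam (G i))"
proof (cases "(\<Sum>i<k. hdiam (G i)) = top")
  case False
  \<comment> \<open>The finite sum is subtracted so that the infimum over covers of \<open>A\<close>
    stands alone on the right; moving it back needs it to be different from
    \<open>top\<close>.\<close>
  have "H1_delta \<delta> (A \<union> B) - (\<Sum>i<k. hdiam (G i)) \<le> H1_delta \<delta> A"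
    unfolding H1_delta_def[of \<delta> A]
  proof (rule INF_greatest)
    fix C :: "nat \<Rightarrow> 'a set"
    assume C: "C \<in> {C. A \<subseteq> (\<Union>i. C i) \<and> (\<forall>i. hdiam (C i) \<le> ennreal \<delta>)}"
    define K where "K i = (if i < k then G i else C (i - k))" for i
    have KG: "i < k \<Longrightarrow> K i = G i" and KC: "K (i + k) = C i" for i
      by (auto simp: K_def)
    have "A \<union> B \<subseteq> (\<Union>i. K i)"
    proof
      fix x assume "x \<in> A \<union> B"
      then consider i where "x \<in> C i" | i where "i < k" "x \<in> G i"
        using B C by blast
      then show "x \<in> (\<Union>i. K i)"
        using KG KC by cases blast+
    qed
    moreover have "hdiam (K i) \<le> ennreal \<delta>" for i
      using G C by (auto simp: K_def)
    ultimately have "H1_delta \<delta> (A \<union> B) \<le> (\<Sum>i. hdiam (K i))"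
      by (rule H1_delta_le)
    also have "\<dots> = (\<Sum>i. hdiam (K (i + k))) + (\<Sum>i<k. hdiam (K i))"
      by (rule suminf_offset) auto
    also have "\<dots> = (\<Sum>i. hdiam (C i)) + (\<Sum>i<k. hdiam (G i))"
      using KG KC by simp
    finally show "H1_delta \<delta> (A \<union> B) - (\<Sum>i<k. hdiam (G i)) \<le> (\<Sum>i. hdiam (C i))"
      using False by (simp add: ennreal_minus_le_iff add.commute)
  qed
  then show ?thesis
    using False by (simp add: ennreal_minus_le_iff add.commute)
next
  case True
  then show ?thesis
    by (metis add_top_right_ennreal top_greatest)
qed

text \<open>Equal pieces of length at most \<open>\<delta>\<close> have total length
  \<open>r\<close> at every scale. \<open>B\<close> may be just a part of the segment, since
  competitors keep only what lies in the closure of the domain.\<close>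

lemma H1_Un_segment:
  fixes A :: "'a::euclidean_space set"
  assumes e: "norm e = 1" and r: "0 < r" and B: "B \<subseteq> (\<lambda>t. x + t *\<^sub>R e) ` {0..r}"
  shows "H1 (A \<union> B) \<le> H1 A + ennreal r"
  unfolding H1_def[of "A \<union> B"]
proof (rule SUP_least)
  fix \<delta> :: real
  assume "\<delta> \<in> {0<..}"
  then have \<delta>: "0 < \<delta>" by simp
  obtain k :: nat where k: "r / \<delta> < real k"
    using reals_Archimedean2 by blast
  have k0: "0 < real k"
    using k r \<delta> by (meson divide_pos_pos order.strict_trans)
  have rk: "r / real k \<le> \<delta>"
    using k k0 \<delta> by (simp add: field_simps)
  define G where "G i = (\<lambda>t. x + t *\<^sub>R e) ` {real i * (r / real k)..(real i + 1) * (r / real k)}" for i :: nat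
  have hd: "hdiam (G i) \<le> ennreal (r / real k)" for i
  proof -
    have d: "dist a b \<le> r / real k" if ab: "a \<in> G i" "b \<in> G i" for a b
    proof -
      obtain s where s: "a = x + s *\<^sub>R e" "s \<in> {real i * (r / real k)..(real i + 1) * (r / real k)}"
        using ab(1) unfolding G_def by blast
      obtain t where t: "b = x + t *\<^sub>R e" "t \<in> {real i * (r / real k)..(real i + 1) * (r / real k)}"
        using ab(2) unfolding G_def by blast
      note st = s t
      have "dist a b = \<bar>s - t\<bar>"
        using e by (simp add: st dist_norm flip: scaleR_diff_left)
      also have "\<dots> \<le> r / real k"
      proof -
        define \<rho> where "\<rho> = r / real k"
        have "real i * \<rho> \<le> s" "s \<le> real i * \<rho> + \<rho>" "real i * \<rho> \<le> t" "t \<le> real i * \<rho> + \<rho>"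
          using st(2,4) by (auto simp: \<rho>_def[symmetric] distrib_right)
        then show ?thesis
          unfolding \<rho>_def[symmetric] by linarith
      qed
      finally show ?thesis .
    qed
    have "bounded (G i)"
      unfolding G_def by (intro compact_imp_bounded compact_continuous_image continuous_intros) auto
    moreover have "diameter (G i) \<le> r / real k"
      using d r by (intro diameter_le) (auto simp: dist_norm)
    ultimately show ?thesis
      by (simp add: hdiam_def ennreal_leI)
  qed
  have cov: "B \<subseteq> (\<Union>i<k. G i)"
  proof
    fix y assume "y \<in> B"
    then obtain t where "y = x + t *\<^sub>R e" "t \<in> {0..r}"
      using B by blast
    then have t: "y = x + t *\<^sub>R e" "0 \<le> t" "t \<le> r"
      by auto
    show "y \<in> (\<Union>i<k. G i)"
    \<comment> \<open>At the far end the floor used below would give \<open>k\<close>, one too many;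
      that point belongs to the last piece.\<close>
    proof (cases "t = r")
      case True
      have "real (k - 1) + 1 = real k"
        using k0 by auto
      then have "y \<in> G (k - 1)"
        using t True k0 r by (auto simp: G_def intro!: image_eqI[of _ _ t] mult_left_le)
          (simp add: field_simps)
      then show ?thesis
        using k0 by auto
    next
      case False
      define i where "i = nat \<lfloor>t / (r / real k)\<rfloor>"
      have q: "0 \<le> t / (r / real k)" "t / (r / real k) < real k"
        using t False r k0 by (auto simp: field_simps)
      then have "i < k"
        unfolding i_def by (simp add: nat_less_iff floor_less_iff)
      moreover have "real i \<le> t / (r / real k)" "t / (r / real k) \<le> real i + 1"
        unfolding i_def using q(1) by (auto simp: of_nat_nat)
      then have "real i * (r / real k) \<le> t" "t \<le> (real i + 1) * (r / real k)"
        using r k0 by (auto simp: field_simps)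
      then have "y \<in> G i"
        using t by (auto simp: G_def)
      ultimately show ?thesis by auto
    qed
  qed
  have "H1_delta \<delta> (A \<union> B) \<le> H1_delta \<delta> A + (\<Sum>i<k. hdiam (G i))"
    using hd rk by (intro H1_delta_Un_finite_cover cov) (meson ennreal_leI order_trans)
  also have "\<dots> \<le> H1 A + (\<Sum>i<k. ennreal (r / real k))"
    unfolding H1_def using hd \<delta> by (intro add_mono sum_mono SUP_upper) auto
  also have "(\<Sum>i<k. ennreal (r / real k)) = ennreal r"
    using k0 r by (simp add: ennreal_of_nat_eq_real_of_nat flip: ennreal_mult)
  finally show "H1_delta \<delta> (A \<union> B) \<le> H1 A + ennreal r" .
qed

text \<open>A set of diameter \<open>d\<close> lies in a cube of side \<open>2 * d\<close>. As
  \<open>d \<le> \<delta> \<le> 1\<close> and the dimension is at least 2, one power of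
  \<open>d\<close> is kept, one is traded for \<open>\<delta>\<close>, and the others are at most 1.
  The covering sets are arbitrary, hence the Borel superset.\<close>

lemma small_diameter_subset_borel:
  fixes C :: "'a::euclidean_space set"
  assumes N: "2 \<le> DIM('a)" and \<delta>: "0 < \<delta>" "\<delta> \<le> 1" and C: "hdiam C \<le> ennreal \<delta>"
  obtains B where "B \<in> sets borel" "C \<subseteq> B" "emeasure lborel B \<le> ennreal (2 ^ DIM('a) * \<delta>) * hdiam C"
proof (cases "C = {}")
  case True
  then show ?thesis
    by (intro that[of "{}"]) auto
next
  case False
  then obtain c where c: "c \<in> C" by blast
  have bd: "bounded C"
    using C by (auto simp: hdiam_def top_unique split: if_splits)
  define d where "d = diameter C"
  have d: "0 \<le> d" "d \<le> \<delta>" "hdiam C = ennreal d"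
    using C bd \<delta> diameter_ge_0[OF bd] by (auto simp: hdiam_def d_def ennreal_le_iff)
  let ?B = "cbox (c - d *\<^sub>R One) (c + d *\<^sub>R One)"
  show ?thesis
  proof (rule that)
    show "C \<subseteq> ?B"
    proof
      fix y assume "y \<in> C"
      then have "norm (y - c) \<le> d"
        using diameter_bounded_bound[OF bd _ c] by (simp add: d_def dist_norm)
      then have "\<bar>(y - c) \<bullet> b\<bar> \<le> d" if "b \<in> Basis" for b
        using Basis_le_norm[OF that, of "y - c"] by linarith
      then show "y \<in> ?B"
        by (auto simp: mem_box inner_diff_left inner_add_left abs_le_iff algebra_simps)
    qed
    have "emeasure lborel ?B = ennreal (\<Prod>b\<in>Basis. ((c + d *\<^sub>R One) - (c - d *\<^sub>R One)) \<bullet> b)"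
      using d by (intro emeasure_lborel_cbox) (auto simp: inner_diff_left inner_add_left)
    also have "(\<Prod>b\<in>(Basis::'a set). ((c + d *\<^sub>R One) - (c - d *\<^sub>R One)) \<bullet> b) = (2 * d) ^ DIM('a)"
      by (simp add: inner_diff_left inner_add_left)
    also have "\<dots> \<le> 2 ^ DIM('a) * (\<delta> * d)"
    proof -
      obtain n where n: "DIM('a) = Suc (Suc n)"
        using N by (metis add_2_eq_Suc le_Suc_ex)
      have "d ^ n \<le> 1"
        using d \<delta> by (intro power_le_one) auto
      then have "d ^ n * (d * d) \<le> 1 * (\<delta> * d)"
        using d by (intro mult_mono) auto
      then have "2 ^ DIM('a) * (d ^ n * (d * d)) \<le> 2 ^ DIM('a) * (1 * (\<delta> * d))"
        by (rule mult_left_mono) simp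
      moreover have "(2 * d) ^ DIM('a) = 2 ^ DIM('a) * (d ^ n * (d * d))"
        by (simp add: n power_mult_distrib)
      ultimately show ?thesis
        by simp
    qed
    then have "ennreal ((2 * d) ^ DIM('a)) \<le> ennreal (2 ^ DIM('a) * (\<delta> * d))"
      by (rule ennreal_leI)
    also have "ennreal (2 ^ DIM('a) * (\<delta> * d)) = ennreal (2 ^ DIM('a) * \<delta>) * hdiam C"
      using d \<delta> by (simp add: d(3) mult.assoc flip: ennreal_mult)
    finally show "emeasure lborel ?B \<le> ennreal (2 ^ DIM('a) * \<delta>) * hdiam C" .
  qed simp
qed

text \<open>The volume of a fine cover is at most a multiple of \<open>\<delta>\<close> times its
  total diameter, and the latter stays below \<open>h + 1\<close> while \<open>\<delta>\<close>
  tends to 0.\<close>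

lemma H1_finite_imp_null:
  fixes A :: "'a::euclidean_space set"
  assumes N: "2 \<le> DIM('a)" and A: "A \<in> sets borel" and fin: "H1 A < top"
  shows "emeasure lborel A = 0"
proof -
  obtain h where h: "H1 A = ennreal h" "0 \<le> h"
    using fin by (cases "H1 A") auto
  have le: "emeasure lborel A \<le> ennreal (2 ^ DIM('a) * (h + 1) * \<delta>)" if \<delta>: "0 < \<delta>" "\<delta> \<le> 1" for \<delta>
  proof -
    have "H1_delta \<delta> A \<le> H1 A"
      unfolding H1_def using \<delta> by (intro SUP_upper) auto
    also have "\<dots> < ennreal (h + 1)"
      using h by (simp add: ennreal_less_iff)
    finally obtain C :: "nat \<Rightarrow> 'a set" where C: "A \<subseteq> (\<Union>i. C i)" "\<And>i. hdiam (C i) \<le> ennreal \<delta>"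
      "(\<Sum>i. hdiam (C i)) < ennreal (h + 1)"
      unfolding H1_delta_def by (auto simp: INF_less_iff)
    have "\<exists>B. B \<in> sets borel \<and> C i \<subseteq> B \<and> emeasure lborel B \<le> ennreal (2 ^ DIM('a) * \<delta>) * hdiam (C i)" for i
      by (rule small_diameter_subset_borel[OF N \<delta> C(2)[of i]]) blast
    then obtain B where B: "\<And>i. B i \<in> sets borel" "\<And>i. C i \<subseteq> B i"
      "\<And>i. emeasure lborel (B i) \<le> ennreal (2 ^ DIM('a) * \<delta>) * hdiam (C i)"
      by metis
    have "emeasure lborel A \<le> emeasure lborel (\<Union>i. B i)"
      using order_trans[OF C(1) UN_mono[OF subset_refl B(2)]] B(1) by (intro emeasure_mono) auto
    also have "\<dots> \<le> (\<Sum>i. emeasure lborel (B i))"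
      using B(1) by (intro emeasure_subadditive_countably) auto
    also have "\<dots> \<le> (\<Sum>i. ennreal (2 ^ DIM('a) * \<delta>) * hdiam (C i))"
      by (intro suminf_le B) auto
    also have "\<dots> = ennreal (2 ^ DIM('a) * \<delta>) * (\<Sum>i. hdiam (C i))"
      by (rule ennreal_suminf_cmult)
    also have "\<dots> \<le> ennreal (2 ^ DIM('a) * \<delta>) * ennreal (h + 1)"
      using C(3) by (intro mult_left_mono) auto
    also have "\<dots> = ennreal (2 ^ DIM('a) * (h + 1) * \<delta>)"
      using h \<delta> by (subst ennreal_mult'[symmetric]) (auto simp: mult_ac)
    finally show ?thesis .
  qed
  define c where "c = 2 ^ DIM('a) * (h + 1)"
  have c: "0 < c"
    using h by (simp add: c_def)
  have "emeasure lborel A \<le> 0"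
  proof (rule ennreal_le_epsilon)
    fix \<epsilon> :: real
    assume "0 < \<epsilon>"
    define \<delta> where "\<delta> = min 1 (\<epsilon> / c)"
    have "0 < \<delta>" "\<delta> \<le> 1"
      using \<open>0 < \<epsilon>\<close> c by (auto simp: \<delta>_def)
    then have "emeasure lborel A \<le> ennreal (c * \<delta>)"
      unfolding c_def by (rule le)
    also have "\<dots> \<le> ennreal \<epsilon>"
    proof (rule ennreal_leI)
      have "c * \<delta> \<le> c * (\<epsilon> / c)"
        using c by (intro mult_left_mono) (auto simp: \<delta>_def)
      then show "c * \<delta> \<le> \<epsilon>"
        using c by simp
    qed
    finally show "emeasure lborel A \<le> 0 + ennreal \<epsilon>" by simp
  qed
  then show ?thesis by simp
qed

section \<open>Near-minimizers and short segments\<close>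

context energy_setting
begin

text \<open>Integrated over all starting points, the integrals of \<open>\<bar>\<psi>\<bar>\<close>
  over segments give \<open>r\<close> times the integral of \<open>\<bar>\<psi>\<bar>\<close>, so
  the errors have to be small compared with \<open>r\<close>. The competitor changes with the
  starting point, but its energy bound does not, and that uniformity is all that the averaging
  uses.\<close>

lemma near_minimizers_L1_small:
  assumes N: "2 \<le> DIM('a)" and pN: "real DIM('a) - 1 < p" and U: "U \<subseteq> \<Omega>" and e: "e \<in> Basis" and c: "0 \<le> c"
    and competitor: "\<And>x r. 0 < r \<Longrightarrow> r \<le> 1 \<Longrightarrow>
      \<exists>\<phi>. test_fun U \<phi> \<and> E \<phi> \<le> mval U + c * r \<and> (\<forall>t\<in>{0..r}. \<phi> (x + t *\<^sub>R e) = 0)"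
    and eps: "0 < \<epsilon>"
  obtains r0 where "0 < r0" "r0 \<le> 1"
    "\<And>r \<psi>. 0 < r \<Longrightarrow> r \<le> r0 \<Longrightarrow> test_fun U \<psi> \<Longrightarrow> E \<psi> \<le> mval U + r \<Longrightarrow>
      (\<integral>\<^sup>+x. ennreal \<bar>\<psi> x\<bar> \<partial>lborel) \<le> ennreal \<epsilon>"
proof -
  define n where "n = real DIM('a) - 1"
  define q where "q = p / (p - 1)"
  have q: "1 / p + 1 / q = 1" "0 < q"
    using p by (auto simp: q_def field_simps)
  obtain R where R: "0 < R" "\<Omega> \<subseteq> cube R"
    using bounded_subset_cube[OF bounded_domain] by blast
  \<comment> \<open>\<open>Q\<close> exceeds the cube around the domain by 1, so that each point of
    the domain is reached, for each \<open>t \<le> 1\<close>, from a starting point in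
    \<open>Q\<close>. \<open>R'\<close> then bounds the coordinates of \<open>y - x\<close> for
    \<open>y\<close> in the domain and \<open>x\<close> in \<open>Q\<close>.\<close>
  define R' where "R' = R + (R + 1)"
  define Q :: "'a set" where "Q = cube (R + 1)"
  have [measurable]: "Q \<in> sets borel"
    unfolding Q_def by (rule cube_measurable)
  obtain C0 where C0: "0 < C0"
    "\<And>U (w :: 'a \<Rightarrow> real) x. test_fun U w \<Longrightarrow>
      ennreal \<bar>w x\<bar> \<le> ennreal C0 * (\<integral>\<^sup>+y. ennreal (norm (grad w y)) * riesz n (y - x) \<partial>lborel)"
    unfolding n_def by (rule test_fun_le_riesz_potential[where 'a='a]) blast
  obtain K1 where K1: "0 \<le> K1"
    "\<And>r. 0 < r \<Longrightarrow> r \<le> 1 \<Longrightarrow> (\<integral>\<^sup>+z. indicator (cube R') z * seg_riesz e r z \<partial>lborel) \<le> ennreal (K1 * r)"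
    by (rule nn_integral_seg_riesz_cube[of R' e]) (use R e in \<open>auto simp: R'_def\<close>)
  obtain K2 \<theta> where K2: "0 \<le> K2" "0 < \<theta>"
    "\<And>r. 0 < r \<Longrightarrow> r \<le> 1 \<Longrightarrow>
      epow (\<integral>\<^sup>+z. indicator (cube R') z * epow (seg_riesz e r z) q \<partial>lborel) (1 / q) \<le> ennreal (K2 * r powr (1 / q + \<theta>))"
    by (rule seg_riesz_Lq_cube[OF N pN q(1), of R' e]) (use R e in \<open>auto simp: R'_def\<close>)
  obtain B where B: "\<And>\<phi>. test_fun \<Omega> \<phi> \<Longrightarrow> D \<phi> \<le> 2 * p * (E \<phi> + B)"
    by (rule coercive) blast
  define M where "M = 2 * p * (mval U + 1 + B)"
  \<comment> \<open>A bound on the integral of the gradient norm common to all functions with energy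
    excess at most 1; it goes with the relative error.\<close>
  obtain M1 where M1: "0 \<le> M1"
    "\<And>\<psi>. test_fun U \<psi> \<Longrightarrow> E \<psi> \<le> mval U + 1 \<Longrightarrow> (\<integral>\<^sup>+y. ennreal (norm (grad \<psi> y)) \<partial>lborel) \<le> ennreal M1"
  proof -
    define v where "v = enn2real (epow (emeasure lborel (cube R :: 'a set)) (1 / 1 - 1 / p))"
    have v: "epow (emeasure lborel (cube R :: 'a set)) (1 / 1 - 1 / p) = ennreal v"
    proof -
      have "epow (emeasure lborel (cube R :: 'a set)) (1 / 1 - 1 / p) \<noteq> top"
        using emeasure_cube_finite[of R, where 'a='a] by (simp add: epow_eq_top_iff less_top)
      then show ?thesis
        unfolding v_def by (simp add: less_top)
    qed
    show ?thesis
    proof (rule that)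
      show "0 \<le> v * M powr (1 / p)"
        by (simp add: v_def)
      fix \<psi> assume \<psi>: "test_fun U \<psi>" "E \<psi> \<le> mval U + 1"
      have \<Omega>: "test_fun \<Omega> \<psi>"
        using \<psi>(1) U by (rule test_fun_mono)
      have "D \<psi> \<le> 2 * p * (E \<psi> + B)"
        by (rule B[OF \<Omega>])
      also have "\<dots> \<le> M"
        unfolding M_def using \<psi>(2) p by (intro mult_left_mono) auto
      finally have DM: "D \<psi> \<le> M" .
      have "(\<integral>\<^sup>+y. ennreal (norm (grad \<psi> y)) \<partial>lborel) = epow (Dp 1 \<psi>) (1 / 1)"
        by simp
      also have "\<dots> \<le> ennreal v * epow (Dp p \<psi>) (1 / p)"
        unfolding v[symmetric] using p by (intro Dp_le_Dp_cube test_fun_mono[OF \<Omega> R(2)]) auto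
      also have "\<dots> \<le> ennreal v * ennreal (M powr (1 / p))"
        using DM p by (intro mult_left_mono) (auto simp: Dp_eq[OF \<Omega>] epow_ennreal D_nonneg intro!: ennreal_leI powr_mono2)
      also have "\<dots> = ennreal (v * M powr (1 / p))"
        by (simp add: v_def ennreal_mult)
      finally show "(\<integral>\<^sup>+y. ennreal (norm (grad \<psi> y)) \<partial>lborel) \<le> ennreal (v * M powr (1 / p))" .
    qed
  qed
  \<comment> \<open>After averaging and division by \<open>r\<close> the relative error becomes
    \<open>2 * \<eta> * (C0 * M1 * K1)\<close>, to be at most \<open>\<epsilon> / 2\<close>; the
    added 1 keeps the denominator positive.\<close>
  define \<eta> where "\<eta> = \<epsilon> / (4 * (C0 * M1 * K1 + 1))"
  have CMK: "0 \<le> C0 * M1 * K1"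
    using C0(1) M1(1) K1(1) by simp
  then have \<eta>: "0 < \<eta>"
    using eps by (simp add: \<eta>_def)
  obtain C where C: "0 < C"
    "\<And>a b :: 'a. norm (a - b) powr p \<le> \<eta> powr p * norm b powr p + C * mid_gap p a b"
    by (rule norm_diff_powr_le_mid_gap[OF p, of "\<eta> powr p", where 'a='a]) (use \<eta> in auto)
  \<comment> \<open>Taking \<open>p\<close>-th roots: with \<open>X\<close> the larger of the two
    terms, the sum of their \<open>p\<close>-th powers is at most \<open>2 * X powr p\<close>, hence
    at most \<open>(2 * X) powr p\<close>.\<close>
  have pointwise: "norm (a - b) \<le> 2 * \<eta> * norm b + 2 * (C * mid_gap p a b) powr (1 / p)" for a b :: 'a
  proof -
    define X where "X = max (\<eta> * norm b) ((C * mid_gap p a b) powr (1 / p))"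
    have X: "0 \<le> X"
      using \<eta> by (simp add: X_def le_max_iff_disj)
    have g0: "0 \<le> C * mid_gap p a b"
      using C(1) mid_gap_nonneg[OF p, of a b] by simp
    have "\<eta> powr p * norm b powr p = (\<eta> * norm b) powr p"
      using \<eta> by (simp add: powr_mult)
    also have "\<dots> \<le> X powr p"
      using \<eta> p by (intro powr_mono2) (auto simp: X_def)
    finally have 1: "\<eta> powr p * norm b powr p \<le> X powr p" .
    have "C * mid_gap p a b = ((C * mid_gap p a b) powr (1 / p)) powr p"
      using g0 p by (simp add: powr_powr)
    also have "\<dots> \<le> X powr p"
      using p by (intro powr_mono2) (auto simp: X_def)
    finally have "norm (a - b) powr p \<le> 2 * X powr p"
      using C(2)[of a b] 1 by simp
    also have "\<dots> \<le> (2 * X) powr p"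
    proof -
      have "2 powr 1 \<le> (2::real) powr p"
        using p by (intro powr_mono) auto
      then show ?thesis
        using X by (simp add: powr_mult mult_right_mono)
    qed
    finally have le: "norm (a - b) powr p \<le> (2 * X) powr p" .
    have "norm (a - b) \<le> 2 * X"
    proof (rule ccontr)
      assume "\<not> norm (a - b) \<le> 2 * X"
      then have "(2 * X) powr p < norm (a - b) powr p"
        using p X by (intro powr_less_mono2) auto
      with le show False by simp
    qed
    also have "\<dots> \<le> 2 * \<eta> * norm b + 2 * (C * mid_gap p a b) powr (1 / p)"
      using \<eta> by (auto simp: X_def max_def)
    finally show ?thesis .
  qed
  define v where "v = measure lborel Q"
  have v: "emeasure lborel Q = ennreal v" "0 \<le> v"
    using emeasure_cube_finite[of "R + 1", where 'a='a]
    by (auto simp: v_def Q_def emeasure_eq_ennreal_measure less_top)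
  \<comment> \<open>The mean energy excess of \<open>\<phi>\<close> and \<open>\<psi>\<close> is at
    most \<open>(c + 1) / 2 * r\<close>. The factors \<open>p\<close> and \<open>C\<close> come from
    the gap estimates, \<open>2 powr p\<close> from the factor 2 in the pointwise bound.\<close>
  define G0 where "G0 = 2 powr p * C * (p * ((c + 1) / 2))"
  define G where "G = G0 powr (1 / p)"
  have G0: "0 \<le> G0"
    using C(1) p c by (simp add: G0_def)
  have G: "0 \<le> G"
    by (simp add: G_def)
  \<comment> \<open>The second error will be \<open>C0 * (G * K2) * v * r powr \<theta>\<close>,
    which is at most \<open>\<epsilon> / 2\<close> once
    \<open>r powr \<theta> \<le> \<tau>\<close>.\<close>
  define \<tau> where "\<tau> = \<epsilon> / (2 * (C0 * (G * K2) * v + 1))"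
  define r1 where "r1 = \<tau> powr (1 / \<theta>)"
  have CGK: "0 \<le> C0 * (G * K2) * v"
    using C0(1) G K2(1) v(2) by simp
  have "0 < \<tau>"
    unfolding \<tau>_def using eps CGK by (intro divide_pos_pos) auto
  then have r1: "0 < r1" "r1 powr \<theta> = \<tau>"
    unfolding r1_def using K2(2) by (simp_all add: powr_powr)
  show ?thesis
  proof (rule that)
    show "0 < min 1 r1" "min 1 r1 \<le> 1"
      using r1 by auto
    fix r \<psi> assume r: "0 < r" "r \<le> min 1 r1" and \<psi>: "test_fun U \<psi>" "E \<psi> \<le> mval U + r"
    have r': "r \<le> 1" "r \<le> r1"
      using r by auto
    have [measurable]: "\<psi> \<in> borel_measurable borel" "grad \<psi> \<in> borel_measurable borel"
      using test_fun_measurable[OF \<psi>(1)] test_fun_grad_measurable[OF \<psi>(1)] by auto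
    define k where "k z = indicator (cube R') z * seg_riesz e r z" for z
    have [measurable]: "k \<in> borel_measurable borel"
      unfolding k_def by measurable
    define V where "V x = (\<integral>\<^sup>+y. ennreal (norm (grad \<psi> y)) * k (y - x) \<partial>lborel)" for x
    define A where "A x = (\<integral>\<^sup>+t. indicator {0..r} t * ennreal \<bar>\<psi> (x + t *\<^sub>R e)\<bar> \<partial>lborel)" for x
    have key: "A x \<le> ennreal (C0 * (2 * \<eta>)) * V x + ennreal (C0 * (G * K2) * r powr (1 + \<theta>))" if x: "x \<in> Q" for x
    proof -
      obtain \<phi> where \<phi>: "test_fun U \<phi>" "E \<phi> \<le> mval U + c * r" "\<And>t. t \<in> {0..r} \<Longrightarrow> \<phi> (x + t *\<^sub>R e) = 0"
        using competitor[OF r(1) r'(1), of x] by blast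
      have [measurable]: "grad \<phi> \<in> borel_measurable borel"
        using test_fun_grad_measurable[OF \<phi>(1)] .
      define w where "w y = \<phi> y - \<psi> y" for y
      have w: "test_fun U w"
        unfolding w_def by (intro test_fun_diff \<phi> \<psi>)
      have gw: "grad w y = grad \<phi> y - grad \<psi> y" for y
        unfolding w_def by (rule grad_diff[OF \<phi>(1) \<psi>(1)])
      have [measurable]: "grad w \<in> borel_measurable borel"
        using test_fun_grad_measurable[OF w] .
      \<comment> \<open>\<open>H\<close> depends on \<open>x\<close> through \<open>\<phi>\<close>,
        so it cannot be averaged over \<open>x\<close> as the gradient of \<open>\<psi>\<close> can;
        what is uniform in \<open>x\<close> is its \<open>p\<close>-norm. Hence Hoelder and the
        \<open>q\<close>-norm of the segment potential.\<close>
      define H where "H y = 2 * (C * mid_gap p (grad \<phi> y) (grad \<psi> y)) powr (1 / p)" for y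
      have H0: "0 \<le> H y" for y
        by (simp add: H_def)
      have [measurable]: "(\<lambda>y. mid_gap p (grad \<phi> y) (grad \<psi> y)) \<in> borel_measurable borel"
        unfolding mid_gap_def by measurable
      have [measurable]: "H \<in> borel_measurable borel"
        unfolding H_def by measurable
      have Hp: "epow (\<integral>\<^sup>+y. epow (ennreal (H y)) p \<partial>lborel) (1 / p) \<le> ennreal (G * r powr (1 / p))"
      proof -
        have gap0: "0 \<le> mid_gap p (grad \<phi> y) (grad \<psi> y)" for y
          by (rule mid_gap_nonneg[OF p])
        have "(\<integral>\<^sup>+y. epow (ennreal (H y)) p \<partial>lborel) = (\<integral>\<^sup>+y. ennreal (2 powr p * C) * ennreal (mid_gap p (grad \<phi> y) (grad \<psi> y)) \<partial>lborel)"
          using C(1) gap0 p by (intro nn_integral_cong)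
            (simp add: H_def epow_ennreal powr_mult[of 2] powr_powr mult.assoc flip: ennreal_mult)
        also have "\<dots> = ennreal (2 powr p * C) * ennreal (\<integral>y. mid_gap p (grad \<phi> y) (grad \<psi> y) \<partial>lborel)"
          using mid_gap_integrable(1)[OF \<phi>(1) \<psi>(1)] gap0
          by (simp add: nn_integral_cmult nn_integral_eq_integral)
        also have "\<dots> \<le> ennreal (2 powr p * C) * ennreal (p * ((c + 1) / 2 * r))"
        proof (intro mult_left_mono ennreal_leI)
          have "(\<integral>y. mid_gap p (grad \<phi> y) (grad \<psi> y) \<partial>lborel) \<le> p * ((E \<phi> + E \<psi>) / 2 - mval U)"
            by (rule mid_gap_integral_le[OF U \<phi>(1) \<psi>(1)])
          also have "\<dots> \<le> p * ((c + 1) / 2 * r)"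
            using \<phi>(2) \<psi>(2) p by (intro mult_left_mono) (auto simp: algebra_simps add_divide_distrib)
          finally show "(\<integral>y. mid_gap p (grad \<phi> y) (grad \<psi> y) \<partial>lborel) \<le> p * ((c + 1) / 2 * r)" .
        qed simp
        also have "\<dots> = ennreal (G0 * r)"
          using C(1) p c r by (simp add: G0_def mult.assoc flip: ennreal_mult)
        finally have "epow (\<integral>\<^sup>+y. epow (ennreal (H y)) p \<partial>lborel) (1 / p) \<le> epow (ennreal (G0 * r)) (1 / p)"
          using p by (intro epow_mono) auto
        also have "\<dots> = ennreal (G * r powr (1 / p))"
          unfolding G_def using G0 r by (simp add: epow_ennreal powr_mult)
        finally show ?thesis .
      qed
      have "A x = (\<integral>\<^sup>+t. indicator {0..r} t * ennreal \<bar>w (x + t *\<^sub>R e)\<bar> \<partial>lborel)"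
        unfolding A_def using \<phi>(3) by (intro nn_integral_cong) (auto simp: w_def indicator_def)
      also have "\<dots> \<le> (\<integral>\<^sup>+t. indicator {0..r} t * (ennreal C0 * (\<integral>\<^sup>+y. ennreal (norm (grad w y)) * riesz n (y - (x + t *\<^sub>R e)) \<partial>lborel)) \<partial>lborel)"
        by (intro nn_integral_mono mult_left_mono C0(2)[OF w]) auto
      also have "\<dots> = ennreal C0 * (\<integral>\<^sup>+t. \<integral>\<^sup>+y. ennreal (norm (grad w y)) * (indicator {0..r} t * riesz n (y - x - t *\<^sub>R e)) \<partial>lborel \<partial>lborel)"
        by (simp add: nn_integral_cmult[symmetric] mult_ac diff_diff_eq)
      also have "(\<integral>\<^sup>+t. \<integral>\<^sup>+y. ennreal (norm (grad w y)) * (indicator {0..r} t * riesz n (y - x - t *\<^sub>R e)) \<partial>lborel \<partial>lborel)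
          = (\<integral>\<^sup>+y. \<integral>\<^sup>+t. ennreal (norm (grad w y)) * (indicator {0..r} t * riesz n (y - x - t *\<^sub>R e)) \<partial>lborel \<partial>lborel)"
        by (rule nn_integral_lborel_swap) measurable
      also have "\<dots> = (\<integral>\<^sup>+y. ennreal (norm (grad w y)) * seg_riesz e r (y - x) \<partial>lborel)"
        unfolding seg_riesz_def n_def by (intro nn_integral_cong nn_integral_cmult) measurable
      also have "\<dots> \<le> (\<integral>\<^sup>+y. ennreal (2 * \<eta>) * (ennreal (norm (grad \<psi> y)) * k (y - x)) + ennreal (H y) * k (y - x) \<partial>lborel)"
      proof (intro nn_integral_mono)
        fix y
        show "ennreal (norm (grad w y)) * seg_riesz e r (y - x)
          \<le> ennreal (2 * \<eta>) * (ennreal (norm (grad \<psi> y)) * k (y - x)) + ennreal (H y) * k (y - x)"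
        proof (cases "y \<in> U")
          case False
          then show ?thesis
            using test_fun_grad_eq_0[OF w False] by simp
        next
          case True
          then have "y - x \<in> cube R'"
            unfolding R'_def using U R(2) x by (intro cube_diff) (auto simp: Q_def)
          then have kk: "k (y - x) = seg_riesz e r (y - x)"
            by (simp add: k_def)
          have "ennreal (norm (grad w y)) \<le> ennreal (2 * \<eta> * norm (grad \<psi> y) + H y)"
            unfolding gw H_def by (intro ennreal_leI pointwise)
          also have "\<dots> = ennreal (2 * \<eta>) * ennreal (norm (grad \<psi> y)) + ennreal (H y)"
            using \<eta> H0 by (simp add: ennreal_plus ennreal_mult)
          finally show ?thesis
            unfolding kk by (simp add: distrib_right[symmetric] mult.assoc[symmetric] mult_right_mono)
        qed
      qed
      also have "\<dots> = ennreal (2 * \<eta>) * V x + (\<integral>\<^sup>+y. ennreal (H y) * k (y - x) \<partial>lborel)"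
        unfolding V_def by (simp add: nn_integral_add nn_integral_cmult)
      also have "(\<integral>\<^sup>+y. ennreal (H y) * k (y - x) \<partial>lborel) \<le> ennreal (G * K2 * r powr (1 + \<theta>))"
      proof -
        have "(\<integral>\<^sup>+y. ennreal (H y) * k (y - x) \<partial>lborel)
            \<le> epow (\<integral>\<^sup>+y. epow (ennreal (H y)) p \<partial>lborel) (1 / p) * epow (\<integral>\<^sup>+y. epow (k (y - x)) q \<partial>lborel) (1 / q)"
          using p q by (intro Holder_nn_integral) auto
        also have "(\<integral>\<^sup>+y. epow (k (y - x)) q \<partial>lborel) = (\<integral>\<^sup>+y. epow (k y) q \<partial>lborel)"
          using nn_integral_lborel_translate[of "\<lambda>y. epow (k y) q" "- x"] by simp
        also have "\<dots> = (\<integral>\<^sup>+z. indicator (cube R') z * epow (seg_riesz e r z) q \<partial>lborel)"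
          by (intro nn_integral_cong) (auto simp: k_def indicator_def)
        also have "epow (\<integral>\<^sup>+y. epow (ennreal (H y)) p \<partial>lborel) (1 / p) * epow (\<integral>\<^sup>+z. indicator (cube R') z * epow (seg_riesz e r z) q \<partial>lborel) (1 / q)
            \<le> ennreal (G * r powr (1 / p)) * ennreal (K2 * r powr (1 / q + \<theta>))"
          by (intro mult_mono Hp K2(3) r(1) r'(1)) auto
        also have "\<dots> = ennreal (G * K2 * (r powr (1 / p) * r powr (1 / q + \<theta>)))"
          using G K2(1) by (simp add: mult_ac flip: ennreal_mult)
        \<comment> \<open>The exponents \<open>1 / p\<close> of the energy excess and
          \<open>1 / q + \<theta>\<close> of the potential add up to more than 1, which beats the
          length \<open>r\<close>.\<close>
        also have "r powr (1 / p) * r powr (1 / q + \<theta>) = r powr (1 + \<theta>)"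
          unfolding powr_add[symmetric] using q(1) by (simp add: add.assoc[symmetric])
        finally show ?thesis .
      qed
      finally have "A x \<le> ennreal C0 * (ennreal (2 * \<eta>) * V x + ennreal (G * K2 * r powr (1 + \<theta>)))"
        using mult_left_mono[of _ _ "ennreal C0"] by (simp add: add_left_mono)
      then show ?thesis
        using C0(1) \<eta> G K2(1) by (simp add: distrib_left ennreal_mult mult_ac)
    qed
    have [measurable]: "V \<in> borel_measurable borel"
    proof -
      have "V \<in> borel_measurable lborel"
        unfolding V_def by measurable
      then show ?thesis by simp
    qed
    have intV: "(\<integral>\<^sup>+x. V x \<partial>lborel) \<le> ennreal (M1 * (K1 * r))"
    proof -
      have "(\<integral>\<^sup>+x. V x \<partial>lborel) = (\<integral>\<^sup>+y. \<integral>\<^sup>+x. ennreal (norm (grad \<psi> y)) * k (y - x) \<partial>lborel \<partial>lborel)"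
        unfolding V_def by (rule nn_integral_lborel_swap) measurable
      also have "\<dots> = (\<integral>\<^sup>+y. ennreal (norm (grad \<psi> y)) * (\<integral>\<^sup>+x. k (y - x) \<partial>lborel) \<partial>lborel)"
        by (intro nn_integral_cong nn_integral_cmult) measurable
      also have "\<dots> = (\<integral>\<^sup>+y. ennreal (norm (grad \<psi> y)) * (\<integral>\<^sup>+z. k z \<partial>lborel) \<partial>lborel)"
        by (subst nn_integral_lborel_reflect) auto
      also have "\<dots> = (\<integral>\<^sup>+y. ennreal (norm (grad \<psi> y)) \<partial>lborel) * (\<integral>\<^sup>+z. k z \<partial>lborel)"
        by (intro nn_integral_multc) measurable
      also have "\<dots> \<le> ennreal M1 * ennreal (K1 * r)"
        unfolding k_def using \<psi> r'(1) by (intro mult_mono M1(2) K1(2) r(1)) auto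
      also have "\<dots> = ennreal (M1 * (K1 * r))"
        using M1(1) K1(1) r(1) by (simp add: ennreal_mult)
      finally show ?thesis .
    qed
    \<comment> \<open>For each \<open>t\<close> in question the translate of \<open>\<psi>\<close>
      by \<open>t *\<^sub>R e\<close> still vanishes outside \<open>Q\<close>, so restricting the
      starting points to \<open>Q\<close> loses nothing.\<close>
    have intA: "(\<integral>\<^sup>+x. indicator Q x * A x \<partial>lborel) = ennreal r * (\<integral>\<^sup>+x. ennreal \<bar>\<psi> x\<bar> \<partial>lborel)"
    proof -
      have "(\<integral>\<^sup>+x. indicator Q x * A x \<partial>lborel)
          = (\<integral>\<^sup>+x. \<integral>\<^sup>+t. indicator Q x * (indicator {0..r} t * ennreal \<bar>\<psi> (x + t *\<^sub>R e)\<bar>) \<partial>lborel \<partial>lborel)"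
        unfolding A_def by (intro nn_integral_cong nn_integral_cmult[symmetric]) measurable
      also have "\<dots> = (\<integral>\<^sup>+t. \<integral>\<^sup>+x. indicator Q x * (indicator {0..r} t * ennreal \<bar>\<psi> (x + t *\<^sub>R e)\<bar>) \<partial>lborel \<partial>lborel)"
        by (rule nn_integral_lborel_swap) measurable
      also have "\<dots> = (\<integral>\<^sup>+t. indicator {0..r} t * (\<integral>\<^sup>+x. ennreal \<bar>\<psi> x\<bar> \<partial>lborel) \<partial>lborel)"
      proof (intro nn_integral_cong)
        fix t
        have "(\<integral>\<^sup>+x. indicator Q x * (indicator {0..r} t * ennreal \<bar>\<psi> (x + t *\<^sub>R e)\<bar>) \<partial>lborel)
            = (\<integral>\<^sup>+x. indicator {0..r} t * ennreal \<bar>\<psi> (t *\<^sub>R e + x)\<bar> \<partial>lborel)"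
        proof (intro nn_integral_cong)
          fix x
          have "x \<in> Q" if "\<psi> (t *\<^sub>R e + x) \<noteq> 0" "t \<in> {0..r}"
          proof -
            have "t *\<^sub>R e + x \<in> cube R"
              using that(1) test_fun_eq_0[OF \<psi>(1)] U R(2) by blast
            moreover have "t *\<^sub>R e \<in> cube 1"
              using that(2) r'(1) e by (auto simp: cube_def inner_Basis)
            ultimately have "(t *\<^sub>R e + x) - t *\<^sub>R e \<in> Q"
              unfolding Q_def by (rule cube_diff)
            then show ?thesis by simp
          qed
          then show "indicator Q x * (indicator {0..r} t * ennreal \<bar>\<psi> (x + t *\<^sub>R e)\<bar>) = indicator {0..r} t * ennreal \<bar>\<psi> (t *\<^sub>R e + x)\<bar>"
            by (cases "\<psi> (t *\<^sub>R e + x) = 0") (auto simp: indicator_def add.commute)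
        qed
        also have "\<dots> = indicator {0..r} t * (\<integral>\<^sup>+x. ennreal \<bar>\<psi> (t *\<^sub>R e + x)\<bar> \<partial>lborel)"
          by (intro nn_integral_cmult) measurable
        also have "(\<integral>\<^sup>+x. ennreal \<bar>\<psi> (t *\<^sub>R e + x)\<bar> \<partial>lborel) = (\<integral>\<^sup>+x. ennreal \<bar>\<psi> x\<bar> \<partial>lborel)"
          by (rule nn_integral_lborel_translate) measurable
        finally show "(\<integral>\<^sup>+x. indicator Q x * (indicator {0..r} t * ennreal \<bar>\<psi> (x + t *\<^sub>R e)\<bar>) \<partial>lborel) = indicator {0..r} t * (\<integral>\<^sup>+x. ennreal \<bar>\<psi> x\<bar> \<partial>lborel)" .
      qed
      also have "\<dots> = ennreal r * (\<integral>\<^sup>+x. ennreal \<bar>\<psi> x\<bar> \<partial>lborel)"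
        using r(1) by (simp add: nn_integral_multc)
      finally show ?thesis .
    qed
    have "ennreal r * (\<integral>\<^sup>+x. ennreal \<bar>\<psi> x\<bar> \<partial>lborel) \<le> (\<integral>\<^sup>+x. ennreal (C0 * (2 * \<eta>)) * V x + ennreal (C0 * (G * K2) * r powr (1 + \<theta>)) * indicator Q x \<partial>lborel)"
      unfolding intA[symmetric]
    proof (intro nn_integral_mono)
      fix x
      show "indicator Q x * A x \<le> ennreal (C0 * (2 * \<eta>)) * V x + ennreal (C0 * (G * K2) * r powr (1 + \<theta>)) * indicator Q x"
        using key[of x] by (cases "x \<in> Q") auto
    qed
    also have "\<dots> = ennreal (C0 * (2 * \<eta>)) * (\<integral>\<^sup>+x. V x \<partial>lborel) + ennreal (C0 * (G * K2) * r powr (1 + \<theta>)) * ennreal v"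
      by (simp add: nn_integral_add nn_integral_cmult v(1))
    also have "\<dots> \<le> ennreal (C0 * (2 * \<eta>)) * ennreal (M1 * (K1 * r)) + ennreal (C0 * (G * K2) * r powr (1 + \<theta>)) * ennreal v"
      by (intro add_right_mono mult_left_mono intV) simp
    also have "\<dots> = ennreal (r * (2 * \<eta> * (C0 * M1 * K1) + C0 * (G * K2) * v * r powr \<theta>))"
    proof -
      have "r powr (1 + \<theta>) = r * r powr \<theta>"
        using r(1) by (simp add: powr_add)
      then show ?thesis
        using C0(1) \<eta> M1(1) K1(1) G K2(1) v(2) r(1)
        by (simp add: distrib_left mult_ac ennreal_plus flip: ennreal_mult)
    qed
    also have "\<dots> \<le> ennreal (r * \<epsilon>)"
    proof (intro ennreal_leI mult_left_mono)
      have "2 * \<eta> * (C0 * M1 * K1) \<le> 2 * \<eta> * (C0 * M1 * K1 + 1)"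
        using \<eta> by simp
      also have "\<dots> = \<epsilon> / 2"
        using CMK by (simp add: \<eta>_def field_simps)
      finally have 1: "2 * \<eta> * (C0 * M1 * K1) \<le> \<epsilon> / 2" .
      have "C0 * (G * K2) * v * r powr \<theta> \<le> (C0 * (G * K2) * v + 1) * r1 powr \<theta>"
        using CGK r(1) r'(2) K2(2) by (intro mult_mono powr_mono2) auto
      also have "\<dots> = \<epsilon> / 2"
        unfolding r1(2) \<tau>_def using CGK by (simp add: field_simps)
      finally show "2 * \<eta> * (C0 * M1 * K1) + C0 * (G * K2) * v * r powr \<theta> \<le> \<epsilon>"
        using 1 by simp
    qed (use r in simp)
    also have "\<dots> = ennreal r * ennreal \<epsilon>"
      using r(1) eps by (simp add: ennreal_mult)
    finally have "ennreal (1 / r) * (ennreal r * (\<integral>\<^sup>+x. ennreal \<bar>\<psi> x\<bar> \<partial>lborel)) \<le> ennreal (1 / r) * (ennreal r * ennreal \<epsilon>)"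
      by (rule mult_left_mono) simp
    then show "(\<integral>\<^sup>+x. ennreal \<bar>\<psi> x\<bar> \<partial>lborel) \<le> ennreal \<epsilon>"
      using r(1) by (simp add: mult.assoc[symmetric] flip: ennreal_mult)
  qed
qed

text \<open>One minimizing sequence has two limits, the minimizer in the \<open>p\<close>-norm and 0
  in the mean, which agree almost everywhere along a common subsequence. The energy of the minimizer
  is thus reduced to its gradient part, which has a sign.\<close>

lemma mval_nonneg:
  assumes N: "2 \<le> DIM('a)" and pN: "real DIM('a) - 1 < p" and U: "U \<subseteq> \<Omega>" and e: "e \<in> Basis" and c: "0 \<le> c"
    and competitor: "\<And>x r. 0 < r \<Longrightarrow> r \<le> 1 \<Longrightarrow>
      \<exists>\<phi>. test_fun U \<phi> \<and> E \<phi> \<le> mval U + c * r \<and> (\<forall>t\<in>{0..r}. \<phi> (x + t *\<^sub>R e) = 0)"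
  shows "0 \<le> mval U"
proof -
  obtain \<phi> where \<phi>: "\<And>n. test_fun U (\<phi> n)" "\<And>n. E (\<phi> n) < mval U + inverse (real (Suc n))"
    "(\<lambda>n. E (\<phi> n)) \<longlonglongrightarrow> mval U"
    by (rule minimizing_sequence_exists[OF U]) (rule that)
  obtain u g where ug: "energy p f \<Omega> (u, g) = mval U" "u \<in> borel_measurable lebesgue"
    "(\<lambda>n. \<integral>\<^sup>+x. ennreal (\<bar>\<phi> n x - u x\<bar> powr p) \<partial>lebesgue) \<longlonglongrightarrow> 0"
    by (rule minimizer_exists[OF U \<phi>(1,3)])
  have meas: "\<phi> n \<in> borel_measurable lebesgue" for n
    using test_fun_measurable[OF \<phi>(1)] by (auto intro: measurable_completion)
  obtain s where s: "strict_mono s" "AE x in lebesgue. (\<lambda>k. \<phi> (s k) x) \<longlonglongrightarrow> u x"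
    by (rule Lp_AE_subseq[OF _ meas ug(2), of p]) (use p ug(3) in auto)
  have L1: "(\<lambda>n. \<integral>\<^sup>+x. ennreal \<bar>\<phi> n x\<bar> \<partial>lborel) \<longlonglongrightarrow> 0"
  proof (rule order_tendstoI)
    fix a :: ennreal assume "0 < a"
    then obtain b where b: "0 < b" "b < a"
      using dense by blast
    then obtain \<epsilon> where \<epsilon>: "b = ennreal \<epsilon>" "0 < \<epsilon>"
      by (cases b) auto
    obtain r0 where r0: "0 < r0" "\<And>r \<psi>. 0 < r \<Longrightarrow> r \<le> r0 \<Longrightarrow> test_fun U \<psi> \<Longrightarrow> E \<psi> \<le> mval U + r \<Longrightarrow>
      (\<integral>\<^sup>+x. ennreal \<bar>\<psi> x\<bar> \<partial>lborel) \<le> ennreal \<epsilon>"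
      by (rule near_minimizers_L1_small[OF N pN U e c competitor \<epsilon>(2)]) (assumption | rule that)+
    have "\<forall>\<^sub>F n in sequentially. inverse (real (Suc n)) < r0"
      by (rule order_tendstoD(2)[OF LIMSEQ_inverse_real_of_nat r0(1)])
    then show "\<forall>\<^sub>F n in sequentially. (\<integral>\<^sup>+x. ennreal \<bar>\<phi> n x\<bar> \<partial>lborel) < a"
    proof (rule eventually_mono)
      fix n assume "inverse (real (Suc n)) < r0"
      then have "(\<integral>\<^sup>+x. ennreal \<bar>\<phi> n x\<bar> \<partial>lborel) \<le> ennreal \<epsilon>"
        using \<phi>(1) less_imp_le[OF \<phi>(2)] by (intro r0(2)[of "inverse (real (Suc n))"]) auto
      then show "(\<integral>\<^sup>+x. ennreal \<bar>\<phi> n x\<bar> \<partial>lborel) < a"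
        using b(2) \<epsilon>(1) by (metis order_le_less_trans)
    qed
  qed simp
  \<comment> \<open>Extracted from the first subsequence, so that both almost everywhere limits
    belong to the same functions.\<close>
  obtain s' where s': "strict_mono s'" "AE x in lebesgue. (\<lambda>k. \<phi> (s (s' k)) x) \<longlonglongrightarrow> 0"
  proof (rule Lp_AE_subseq[of 1 "\<lambda>k. \<phi> (s k)" lebesgue "\<lambda>_. 0"])
    show "(\<lambda>k. \<integral>\<^sup>+x. ennreal (norm (\<phi> (s k) x - 0) powr 1) \<partial>lebesgue) \<longlonglongrightarrow> 0"
      using LIMSEQ_subseq_LIMSEQ[OF L1 s(1)] by (simp add: o_def nn_integral_completion)
  qed (use meas in auto)
  have "AE x in lebesgue. u x = 0"
    using s(2) s'(2)
  proof eventually_elim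
    case (elim x)
    have "(\<lambda>k. \<phi> (s (s' k)) x) \<longlonglongrightarrow> u x"
      using LIMSEQ_subseq_LIMSEQ[OF elim(1) s'(1)] by (simp add: o_def)
    then show ?case
      using elim(2) LIMSEQ_unique by blast
  qed
  then have "(\<integral>x. indicator \<Omega> x * (f x * u x) \<partial>lebesgue) = 0"
    by (intro integral_eq_zero_AE) (auto elim!: eventually_mono)
  then have "energy p f \<Omega> (u, g) = (1 / p) * (\<integral>x. indicator \<Omega> x * norm (g x) powr p \<partial>lebesgue)"
    by (simp add: energy_def)
  moreover have "0 \<le> (\<integral>x. indicator \<Omega> x * norm (g x) powr p \<partial>lebesgue)"
    by (intro Bochner_Integration.integral_nonneg) (auto simp: indicator_def)
  ultimately show ?thesis
    using ug(1) p by simp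
qed

text \<open>The energy of \<open>s * \<phi>\<close> is \<open>- s * L \<phi>\<close> plus a term of
  order \<open>s powr p\<close>, negligible against \<open>s\<close> because \<open>p > 1\<close>.
  Nonnegativity for small \<open>s\<close> gives \<open>L \<phi> \<le> 0\<close>, and
  \<open>- \<phi>\<close> gives the other sign.\<close>

lemma L_eq_0_if_mval_nonneg:
  assumes U: "U \<subseteq> \<Omega>" and m: "0 \<le> mval U" and \<phi>: "test_fun U \<phi>"
  shows "L \<phi> = 0"
proof -
  have le: "L \<phi> \<le> 0" if \<phi>: "test_fun U \<phi>" for \<phi>
  proof (rule LIMSEQ_le_const)
    have "(\<lambda>n. inverse (real (Suc n)) powr (p - 1)) \<longlonglongrightarrow> 0 powr (p - 1)"
      by (rule tendsto_powr'[OF LIMSEQ_inverse_real_of_nat tendsto_const]) (use p in auto)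
    from tendsto_mult_right[OF this, of "D \<phi> / p"]
    show "(\<lambda>n. inverse (real (Suc n)) powr (p - 1) * (D \<phi> / p)) \<longlonglongrightarrow> 0"
      by simp
    show "\<exists>N. \<forall>n\<ge>N. L \<phi> \<le> inverse (real (Suc n)) powr (p - 1) * (D \<phi> / p)"
    proof (intro exI allI impI)
      fix n :: nat
      define s where "s = inverse (real (Suc n))"
      have s: "0 < s"
        by (simp add: s_def)
      have \<Omega>: "test_fun \<Omega> (\<lambda>x. s * \<phi> x)"
        by (rule test_fun_mono[OF test_fun_cmult[OF \<phi>] U])
      have "0 \<le> E (\<lambda>x. s * \<phi> x)"
        using m mval_le[OF U test_fun_cmult[OF \<phi>], of s] by linarith
      also have "\<dots> = s powr p * D \<phi> / p - s * L \<phi>"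
        unfolding E_eq[OF \<Omega>] D_cmult[OF \<phi>] L_cmult using s by simp
      also have "s powr p = s * s powr (p - 1)"
        using s powr_add[of s 1 "p - 1"] by simp
      finally have "s * L \<phi> \<le> s * (s powr (p - 1) * (D \<phi> / p))"
        by (simp add: mult.assoc)
      then show "L \<phi> \<le> inverse (real (Suc n)) powr (p - 1) * (D \<phi> / p)"
        using s unfolding s_def[symmetric] by (simp only: mult_le_cancel_left_pos)
    qed
  qed
  have "L (\<lambda>x. -1 * \<phi> x) \<le> 0"
    by (rule le[OF test_fun_cmult[OF \<phi>]])
  then show ?thesis
    using le[OF \<phi>] unfolding L_cmult by simp
qed

end

theorem theorem1p3:
  fixes \<Omega> :: "'a::euclidean_space set" and lam p q0 :: real and f :: "'a \<Rightarrow> real"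
  assumes "DIM('a) \<ge> 2"
    and "open \<Omega>" and "bounded \<Omega>" and "\<Omega> \<noteq> {}"
    and "lam > 0"
    and "p > real DIM('a) - 1"
    and "q0_adm DIM('a) p q0"
    and "Lq_on q0 \<Omega> f"
    and "\<not> (AE x in lebesgue. x \<in> \<Omega> \<longrightarrow> f x = 0)"
  shows "\<not> (\<exists>\<Sigma>. closed_proper_subset \<Omega> \<Sigma> \<and>
            (\<forall>\<Sigma>'. closed_proper_subset \<Omega> \<Sigma>' \<longrightarrow> Ffun lam p f \<Omega> \<Sigma> \<le> Ffun lam p f \<Omega> \<Sigma>'))"
proof
  assume "\<exists>\<Sigma>. closed_proper_subset \<Omega> \<Sigma> \<and>
            (\<forall>\<Sigma>'. closed_proper_subset \<Omega> \<Sigma>' \<longrightarrow> Ffun lam p f \<Omega> \<Sigma> \<le> Ffun lam p f \<Omega> \<Sigma>')"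
  then obtain \<Sigma> where \<Sigma>: "closed \<Sigma>" "\<Sigma> \<subseteq> closure \<Omega>" "\<Sigma> \<noteq> closure \<Omega>"
    and min: "\<And>\<Sigma>'. closed_proper_subset \<Omega> \<Sigma>' \<Longrightarrow> Ffun lam p f \<Omega> \<Sigma> \<le> Ffun lam p f \<Omega> \<Sigma>'"
    unfolding closed_proper_subset_def by blast
  have p: "1 < p"
    using assms(1,6) by simp
  obtain S where S: "0 \<le> S" "\<And>\<phi>. test_fun \<Omega> \<phi> \<Longrightarrow>
      (\<integral>\<^sup>+x. ennreal (\<bar>indicator \<Omega> x * f x\<bar> * \<bar>\<phi> x\<bar>) \<partial>lebesgue) \<le> ennreal S * epow (Dp p \<phi>) (1 / p)"
    by (rule Sobolev_functional_bounded[OF assms(1) p assms(3,7,8)]) blast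
  have f_int: "integrable lebesgue (\<lambda>x. indicator \<Omega> x * f x)"
  proof (rule Lq_on_integrable[OF assms(3) _ assms(8)])
    show "1 \<le> q0"
      using assms(7) p by (cases rule: q0_adm_cases) auto
  qed
  interpret energy_setting \<Omega> p f S
    by unfold_locales (use p assms(2,3) S f_int in auto)
  have Ffun_eq: "Ffun lam p f \<Omega> T = ereal (- mval (\<Omega> - T)) + ereal lam * enn2ereal (H1 T)" for T
    by (simp add: Ffun_def compliance_eq)
  \<comment> \<open>A closed null set is therefore never the whole closure; this is how competitors
    are seen to be proper.\<close>
  have not_null: "emeasure lborel (closure \<Omega>) \<noteq> 0"
  proof
    assume "emeasure lborel (closure \<Omega>) = 0"
    then have "closure \<Omega> \<in> null_sets lebesgue"
      by (auto simp: null_sets_def)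
    then have "negligible \<Omega>"
      using negligible_subset[OF _ closure_subset] by (simp add: negligible_iff_null_sets)
    then show False
      using open_not_negligible[OF assms(2,4)] by simp
  qed
  \<comment> \<open>Comparison with the empty set bounds the value at \<open>\<Sigma>\<close> by a
    real number, which forces finite length.\<close>
  have "closed_proper_subset \<Omega> {}"
    using assms(4) closure_subset[of \<Omega>] unfolding closed_proper_subset_def by blast
  from min[OF this] have "Ffun lam p f \<Omega> \<Sigma> \<le> ereal (- mval \<Omega>)"
    by (simp add: Ffun_eq zero_ennreal.rep_eq)
  then have "H1 \<Sigma> \<noteq> top"
    using assms(5) by (auto simp: Ffun_eq)
  then obtain h where h: "H1 \<Sigma> = ennreal h" "0 \<le> h"
    by (cases "H1 \<Sigma>") auto
  have \<Sigma>_null: "emeasure lborel \<Sigma> = 0"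
    by (rule H1_finite_imp_null[OF assms(1)]) (use \<Sigma>(1) h in auto)
  obtain e :: 'a where e: "e \<in> Basis"
    using nonempty_Basis by blast
  have U: "\<Omega> - \<Sigma> \<subseteq> \<Omega>"
    by blast
  \<comment> \<open>In \<open>lam + 1\<close> the \<open>lam\<close> pays for the added length, and
    the 1 for picking a test function with energy within \<open>r\<close> of the infimum on the
    smaller set.\<close>
  have competitor: "\<exists>\<phi>. test_fun (\<Omega> - \<Sigma>) \<phi> \<and> E \<phi> \<le> mval (\<Omega> - \<Sigma>) + (lam + 1) * r \<and> (\<forall>t\<in>{0..r}. \<phi> (x + t *\<^sub>R e) = 0)"
    if r: "0 < r" for x r
  proof -
    define I where "I = (\<lambda>t. x + t *\<^sub>R e) ` {0..r}"
    \<comment> \<open>The segment may leave the domain or meet \<open>\<Sigma>\<close>. Intersecting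
      with the closure keeps \<open>T\<close> admissible; on the rest of the segment test functions
      on \<open>\<Omega> - T\<close> vanish anyway, being 0 outside \<open>\<Omega>\<close>.\<close>
    define T where "T = \<Sigma> \<union> (I \<inter> closure \<Omega>)"
    have "compact I"
      unfolding I_def by (intro compact_continuous_image continuous_intros) auto
    then have "closed T"
      unfolding T_def using \<Sigma>(1) by (intro closed_Un closed_Int) (auto intro: compact_imp_closed)
    have H1T: "H1 T \<le> ennreal (h + r)"
    proof -
      have "H1 T \<le> H1 \<Sigma> + ennreal r"
        unfolding T_def using e r by (intro H1_Un_segment[of e r _ x]) (auto simp: I_def)
      then show ?thesis
        using h r by simp
    qed
    then obtain h' where h': "H1 T = ennreal h'" "0 \<le> h'"
      by (cases "H1 T") (auto simp: top_unique)
    then have "h' \<le> h + r"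
      using H1T h r by (simp add: ennreal_le_iff del: ennreal_plus)
    note h' = h' this
    have "emeasure lborel T = 0"
      by (rule H1_finite_imp_null[OF assms(1)]) (use \<open>closed T\<close> h' in auto)
    then have "T \<noteq> closure \<Omega>"
      using not_null by auto
    then have "closed_proper_subset \<Omega> T"
      using \<open>closed T\<close> \<Sigma>(2) by (auto simp: closed_proper_subset_def T_def)
    from min[OF this] have "- mval (\<Omega> - \<Sigma>) + lam * h \<le> - mval (\<Omega> - T) + lam * h'"
      using h h' by (simp add: Ffun_eq)
    also have "\<dots> \<le> - mval (\<Omega> - T) + lam * (h + r)"
      using h' assms(5) by simp
    finally have mT: "mval (\<Omega> - T) \<le> mval (\<Omega> - \<Sigma>) + lam * r"
      by (simp add: distrib_left)
    obtain \<phi> where \<phi>: "test_fun (\<Omega> - T) \<phi>" "E \<phi> < mval (\<Omega> - T) + r"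
      using mval_approx[of "\<Omega> - T" r] r by blast
    have "\<phi> (x + t *\<^sub>R e) = 0" if "t \<in> {0..r}" for t
    proof (rule test_fun_eq_0[OF \<phi>(1)])
      have "x + t *\<^sub>R e \<in> I"
        unfolding I_def using that by (rule imageI)
      then show "x + t *\<^sub>R e \<notin> \<Omega> - T"
        using closure_subset by (auto simp: T_def)
    qed
    moreover have "test_fun (\<Omega> - \<Sigma>) \<phi>"
      by (rule test_fun_mono[OF \<phi>(1)]) (auto simp: T_def)
    moreover have "E \<phi> \<le> mval (\<Omega> - \<Sigma>) + (lam + 1) * r"
      using \<phi>(2) mT by (simp add: distrib_right)
    ultimately show ?thesis
      by blast
  qed
  have "0 \<le> mval (\<Omega> - \<Sigma>)"
    by (rule mval_nonneg[OF assms(1,6) U e _ competitor]) (use assms(5) in auto)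
  then have "L \<phi> = 0" if "test_fun (\<Omega> - \<Sigma>) \<phi>" for \<phi>
    using L_eq_0_if_mval_nonneg[OF U _ that] by blast
  then have "AE x in lebesgue. x \<in> \<Omega> - \<Sigma> \<longrightarrow> indicator \<Omega> x * f x = 0"
    using assms(2) \<Sigma>(1) f_int
    by (intro AE_eq_0_if_test_integral_0) (auto simp: L_def mult.assoc)
  moreover have "AE x in lebesgue. x \<notin> \<Sigma>"
    using \<Sigma>_null \<Sigma>(1) by (intro AE_not_in null_sets_completionI) (auto simp: null_sets_def)
  ultimately have "AE x in lebesgue. x \<in> \<Omega> \<longrightarrow> f x = 0"
    by eventually_elim (auto simp: indicator_def)
  then show False
    using assms(9) by blast
qed

end
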